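(* The decision problem Extension Globally Minimal Defensive Alliance is $\mathsf{NP}$-complete, even when restricted to planar bipartite input graphs of maximum degree at most $9$.
   Context: Graphs are finite, simple and undirected. For $G=(V,E)$, $X\subseteq V$ and $v\in V$, $\deg_X(v)$ is the number of neighbors of $v$ in $X$, and $\overline{X}=V\setminus X$. A set $A\subseteq V$ is a defensive alliance if $\deg_A(v)+1\ge \deg_{\overline{A}}(v)$ for every $v\in A$. A non-empty defensive alliance is globally minimal if no proper subset of it is a non-empty defensive alliance. Problem Extension Globally Minimal Defensive Alliance. Input: a graph $G=(V,E)$ and sets $U,N\subseteq V$. Question: is there a globally minimal defensive alliance $A\subseteq V\setminus N$ of $G$ with $U\subseteq A$? *)

theory Defs
  imports "HOL-Analysis.Analysis" "HOL-Computational_Algebra.Polynomial"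
begin

section \<open>Deterministic multi-tape Turing machines\<close>

text \<open>
  The states are the numbers up to and including \<^term>\<open>states M\<close>: state 0 is the start state and
  \<^term>\<open>states M\<close> the halting state. The tape symbols are the numbers below \<^term>\<open>symbols M\<close>, where
  0 is the blank, 1 the left end marker, 2 and 3 the two bits, and 4 a separator. Tapes are
  infinite to the right only; a head on cell 0 that is told to move left stays where it is.
  Tape 0 is the input tape and tape 1 the output tape.
\<close>

datatype move = Move_Left | Stay | Move_Right

record tm =
  tapes :: nat
  symbols :: nat
  states :: nat
  delta :: "nat \<Rightarrow> nat list \<Rightarrow> nat \<times> (nat \<times> move) list"

definition tm_wf :: "tm \<Rightarrow> bool" where
  "tm_wf M \<longleftrightarrow> 2 \<le> tapes M \<and> 5 \<le> symbols M \<and>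
     (\<forall>q < states M. \<forall>s. length s = tapes M \<and> set s \<subseteq> {..<symbols M} \<longrightarrow>
        (case delta M q s of (q', as) \<Rightarrow>
           q' \<le> states M \<and> length as = tapes M \<and> fst ` set as \<subseteq> {..<symbols M}))"

text \<open>A configuration consists of the state and, for each tape, its contents and head position.\<close>

type_synonym tape = "(nat \<Rightarrow> nat) \<times> nat"
type_synonym config = "nat \<times> tape list"

fun move_head :: "move \<Rightarrow> nat \<Rightarrow> nat" where
  "move_head Move_Left h = h - 1"
| "move_head Stay h = h"
| "move_head Move_Right h = h + 1"

fun act :: "nat \<times> move \<Rightarrow> tape \<Rightarrow> tape" where
  "act (a, d) (c, h) = (c(h := a), move_head d h)"

fun step :: "tm \<Rightarrow> config \<Rightarrow> config" where
  "step M (q, ts) =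
     (if q \<ge> states M then (q, ts)
      else case delta M q (map (\<lambda>(c, h). c h) ts) of (q', as) \<Rightarrow> (q', map2 act as ts))"

definition contents :: "nat list \<Rightarrow> nat \<Rightarrow> nat" where
  "contents w i = (if i = 0 then 1 else if i \<le> length w then w ! (i - 1) else 0)"

definition init :: "tm \<Rightarrow> nat list \<Rightarrow> config" where
  "init M w = (0, (contents w, 0) # replicate (tapes M - 1) (contents [], 0))"

definition outputs_within :: "tm \<Rightarrow> nat list \<Rightarrow> nat list \<Rightarrow> nat \<Rightarrow> bool" where
  "outputs_within M u v t \<longleftrightarrow>
     (\<exists>t' \<le> t. case (step M ^^ t') (init M u) of (q, ts) \<Rightarrow>
        q = states M \<and> fst (ts ! 1) = contents v)"

section \<open>Polynomial time, NP and NP-completeness\<close>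

definition bits :: "bool list \<Rightarrow> nat list" where
  "bits = map (\<lambda>b. if b then 3 else 2)"

definition poly_time :: "(bool list \<Rightarrow> bool list) \<Rightarrow> bool" where
  "poly_time f \<longleftrightarrow>
     (\<exists>M (p :: nat poly). tm_wf M \<and>
        (\<forall>x. outputs_within M (bits x) (bits (f x)) (poly p (length x))))"

definition poly_time_verifier :: "(bool list \<Rightarrow> bool list \<Rightarrow> bool) \<Rightarrow> bool" where
  "poly_time_verifier R \<longleftrightarrow>
     (\<exists>M (p :: nat poly). tm_wf M \<and>
        (\<forall>x y. outputs_within M (bits x @ [4] @ bits y) (bits [R x y])
           (poly p (length x + length y))))"

definition NP :: "bool list set set" where
  "NP = {L. \<exists>R (p :: nat poly). poly_time_verifier R \<and>
     (\<forall>x. x \<in> L \<longleftrightarrow> (\<exists>y. length y \<le> poly p (length x) \<and> R x y))}"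

definition NP_hard :: "bool list set \<Rightarrow> bool" where
  "NP_hard L \<longleftrightarrow> (\<forall>K \<in> NP. \<exists>f. poly_time f \<and> (\<forall>x. x \<in> K \<longleftrightarrow> f x \<in> L))"

definition NP_complete :: "bool list set \<Rightarrow> bool" where
  "NP_complete L \<longleftrightarrow> L \<in> NP \<and> NP_hard L"

text \<open>
  The problem \<open>L\<close> with its inputs restricted to \<open>D\<close>: only inputs in \<open>D\<close> have to be
  answered correctly, and reductions may only produce inputs in \<open>D\<close>.
\<close>

definition NP_complete_on :: "bool list set \<Rightarrow> bool list set \<Rightarrow> bool" where
  "NP_complete_on D L \<longleftrightarrow>
     (\<exists>K \<in> NP. K \<inter> D = L \<inter> D) \<and>
     (\<forall>K \<in> NP. \<exists>f. poly_time f \<and> (\<forall>x. f x \<in> D) \<and> (\<forall>x. x \<in> K \<longleftrightarrow> f x \<in> L))"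

section \<open>Graphs\<close>

definition simple_graph :: "'a set \<Rightarrow> 'a set set \<Rightarrow> bool" where
  "simple_graph V E \<longleftrightarrow> finite V \<and> (\<forall>e \<in> E. e \<subseteq> V \<and> card e = 2)"

definition deg :: "'a set set \<Rightarrow> 'a set \<Rightarrow> 'a \<Rightarrow> nat" where
  "deg E X v = card {w \<in> X. {v, w} \<in> E}"

definition bipartite :: "'a set \<Rightarrow> 'a set set \<Rightarrow> bool" where
  "bipartite V E \<longleftrightarrow>
     (\<exists>X Y. X \<union> Y = V \<and> X \<inter> Y = {} \<and> (\<forall>e \<in> E. \<exists>x \<in> X. \<exists>y \<in> Y. e = {x, y}))"

text \<open>Drawings in the plane: vertices are points, edges are arcs meeting only in common ends.\<close>

definition planar :: "'a set \<Rightarrow> 'a set set \<Rightarrow> bool" where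
  "planar V E \<longleftrightarrow>
     (\<exists>(pt :: 'a \<Rightarrow> complex) (\<gamma> :: 'a set \<Rightarrow> real \<Rightarrow> complex).
        inj_on pt V \<and>
        (\<forall>e \<in> E. arc (\<gamma> e) \<and> {pathstart (\<gamma> e), pathfinish (\<gamma> e)} = pt ` e \<and>
           path_image (\<gamma> e) \<inter> pt ` V = pt ` e) \<and>
        (\<forall>e \<in> E. \<forall>e' \<in> E. e \<noteq> e' \<longrightarrow>
           path_image (\<gamma> e) \<inter> path_image (\<gamma> e') = pt ` (e \<inter> e')))"

section \<open>Defensive alliances\<close>

definition defensive_alliance :: "'a set \<Rightarrow> 'a set set \<Rightarrow> 'a set \<Rightarrow> bool" where
  "defensive_alliance V E A \<longleftrightarrow> A \<subseteq> V \<and> (\<forall>v \<in> A. deg E A v + 1 \<ge> deg E (V - A) v)"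

definition globally_minimal :: "'a set \<Rightarrow> 'a set set \<Rightarrow> 'a set \<Rightarrow> bool" where
  "globally_minimal V E A \<longleftrightarrow>
     A \<noteq> {} \<and> defensive_alliance V E A \<and>
     \<not> (\<exists>B. B \<subset> A \<and> B \<noteq> {} \<and> defensive_alliance V E B)"

definition ext_gm_defensive_alliance ::
  "'a set \<Rightarrow> 'a set set \<Rightarrow> 'a set \<Rightarrow> 'a set \<Rightarrow> bool" where
  "ext_gm_defensive_alliance V E U N \<longleftrightarrow>
     (\<exists>A. A \<subseteq> V - N \<and> U \<subseteq> A \<and> globally_minimal V E A)"

section \<open>Encoding of the inputs\<close>

definition valid_input :: "nat \<Rightarrow> nat set set \<Rightarrow> nat set \<Rightarrow> nat set \<Rightarrow> bool" where
  "valid_input n E U N \<longleftrightarrow> simple_graph {0..<n} E \<and> U \<subseteq> {0..<n} \<and> N \<subseteq> {0..<n}"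

text \<open>
  The number of vertices in unary, followed by the adjacency matrix and the
  characteristic vectors of the two vertex sets.
\<close>

definition encode :: "nat \<Rightarrow> nat set set \<Rightarrow> nat set \<Rightarrow> nat set \<Rightarrow> bool list" where
  "encode n E U N =
     replicate n True @ [False] @
     concat (map (\<lambda>i. map (\<lambda>j. {i, j} \<in> E) [0..<n]) [0..<n]) @
     map (\<lambda>i. i \<in> U) [0..<n] @ map (\<lambda>i. i \<in> N) [0..<n]"

definition Ext_GM_Defensive_Alliance :: "bool list set" where
  "Ext_GM_Defensive_Alliance =
     {encode n E U N | n E U N.
        valid_input n E U N \<and> ext_gm_defensive_alliance {0..<n} E U N}"

definition planar_bipartite_inputs :: "nat \<Rightarrow> bool list set" where
  "planar_bipartite_inputs d =
     {encode n E U N | n E U N.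
        valid_input n E U N \<and> planar {0..<n} E \<and> bipartite {0..<n} E \<and>
        (\<forall>v \<in> {0..<n}. deg E {0..<n} v \<le> d)}"

lemma encode_inject:
  assumes "valid_input n E U N" "valid_input n' E' U' N'" "encode n E U N = encode n' E' U' N'"
  shows "n = n' \<and> E = E' \<and> U = U' \<and> N = N'"
proof -
  have tw: "takeWhile (\<lambda>b. b) (replicate k True @ [False] @ zs) = replicate k True" for k zs
    by (induction k) auto
  from assms(3) have "replicate n True = replicate n' True"
    unfolding encode_def by (metis tw)
  then have n: "n' = n" by (metis length_replicate)
  have len: "length (concat (map (\<lambda>i. map (\<lambda>j. {i, j} \<in> F) [0..<n]) xs)) = length xs * n"
    for F :: "nat set set" and xs
    by (induction xs) auto
  from assms(3) have M: "concat (map (\<lambda>i. map (\<lambda>j. {i, j} \<in> E) [0..<n]) [0..<n]) =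
      concat (map (\<lambda>i. map (\<lambda>j. {i, j} \<in> E') [0..<n]) [0..<n])"
    and UN: "map (\<lambda>i. i \<in> U) [0..<n] = map (\<lambda>i. i \<in> U') [0..<n]"
      "map (\<lambda>i. i \<in> N) [0..<n] = map (\<lambda>i. i \<in> N') [0..<n]"
    unfolding encode_def n by (simp_all add: len)
  have rows: "\<forall>i \<in> set xs. map (\<lambda>j. {i, j} \<in> E) [0..<n] = map (\<lambda>j. {i, j} \<in> E') [0..<n]"
    if "concat (map (\<lambda>i. map (\<lambda>j. {i, j} \<in> E) [0..<n]) xs) =
      concat (map (\<lambda>i. map (\<lambda>j. {i, j} \<in> E') [0..<n]) xs)" for xs
    using that by (induction xs) auto
  have adj: "{i, j} \<in> E \<longleftrightarrow> {i, j} \<in> E'" if "i < n" "j < n" for i j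
    using rows[OF M] that by auto
  have "e \<in> F" if "e \<in> E \<union> E'" "F = E \<or> F = E'" for e F
  proof -
    have "e \<subseteq> {0..<n}" "card e = 2"
      using that assms(1,2) unfolding valid_input_def simple_graph_def n by auto
    then obtain i j where "e = {i, j}" "i < n" "j < n" by (auto simp: card_2_iff)
    then show ?thesis using adj[of i j] that by auto
  qed
  then have "E = E'" by blast
  moreover have "U = U'" "N = N'"
    using assms(1,2) UN unfolding valid_input_def n by auto
  ultimately show ?thesis using n by simp
qed

end

theory Submission
  imports Defs
begin

text \<open>
  Membership: an alliance \<open>A\<close> is globally minimal iff for every \<open>u \<in> A\<close> the greedy removal
  of vertices that violate the alliance condition empties \<open>A - {u}\<close>; the removal sequences are
  a certificate that is checked by an expression of bounded arithmetic. All such expressions are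
  computable in polynomial time.

  Hardness: a computation tableau is a CNF formula whose incidence of clauses and variables is itself
  given by an arithmetic expression. The formula is laid out in a rectangular mesh with one cell per
  pair of a clause and a variable, so that no crossings have to be removed. The required vertices \<open>U\<close>
  span a tree in which every vertex has just enough neighbours to survive, so an alliance between
  \<open>U\<close> and \<open>U\<close> plus the independent set of literals is globally minimal iff each group vertex of
  the tree has exactly one chosen literal as neighbour. These exact-one constraints pass the value of
  a variable down its column and the truth of the clause along its row. The mesh is periodic, so the
  straight-line drawing of a few cells shows its planarity.
\<close>

section \<open>Structured programs for Turing machines\<close>

text \<open>Verifier and reduction must both run on explicit Turing machines. Neither is programmed
  by hand: each is a formula of a language whose only iteration is a sum with an upper limit. Bounds
  on values then compose to polynomials, and one compiler yields all machines. On the graph side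
  planarity is the obstacle. Every clause-variable pair gets a cell, even if the variable does not
  occur in the clause, so each wire runs along a row or a column. Clauses may have any length, as
  they are evaluated from left to right. The alliance condition amounts to deg V v \<le> 2 * deg A v
  + 1: a vertex of total degree 2d or 2d + 1 needs at least d companions. Pendant vertices tune d to
  the number of tree neighbours, plus one literal for a group. Minimality is what turns "at least
  one literal" into "exactly one": a second literal makes the parent dispensable. The bound 9 is the
  degree of the group that separates the six cases of a cell: six literals and three tree
  neighbours, threshold 3 + 1 = 4, and 9 = 2 * 4 + 1.\<close>

datatype prog =
    Act "nat list \<Rightarrow> (nat \<times> move) list"
  | Seq prog prog
  | Cond "nat list \<Rightarrow> bool" prog prog
  | Loop "nat list \<Rightarrow> bool" prog

definition reads :: "tape list \<Rightarrow> nat list" where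
  "reads ts = map (\<lambda>(c, h). c h) ts"

definition idle :: "nat list \<Rightarrow> (nat \<times> move) list" where
  "idle s = map (\<lambda>a. (a, Stay)) s"

text \<open>The time index is exact: it counts the machine steps of the compiled code. Each test of
  \<open>Cond\<close> and \<open>Loop\<close> costs one idle step, while \<open>Seq\<close> is free
  because the exit of the first program is the entry of the second.\<close>

inductive exec :: "prog \<Rightarrow> tape list \<Rightarrow> nat \<Rightarrow> tape list \<Rightarrow> bool" where
  exec_Act: "exec (Act a) ts 1 (map2 act (a (reads ts)) ts)"
| exec_Seq: "exec P ts m us \<Longrightarrow> exec Q us n vs \<Longrightarrow> exec (Seq P Q) ts (m + n) vs"
| exec_CondT: "b (reads ts) \<Longrightarrow> exec P ts m us \<Longrightarrow> exec (Cond b P Q) ts (Suc m) us"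
| exec_CondF: "\<not> b (reads ts) \<Longrightarrow> exec Q ts m us \<Longrightarrow> exec (Cond b P Q) ts (Suc m) us"
| exec_LoopF: "\<not> b (reads ts) \<Longrightarrow> exec (Loop b P) ts 1 ts"
| exec_LoopT: "b (reads ts) \<Longrightarrow> exec P ts m us \<Longrightarrow> exec (Loop b P) us n vs \<Longrightarrow>
    exec (Loop b P) ts (Suc (m + n)) vs"

fun sz :: "prog \<Rightarrow> nat" where
  "sz (Act a) = 1"
| "sz (Seq P Q) = sz P + sz Q"
| "sz (Cond b P Q) = 1 + sz P + sz Q"
| "sz (Loop b P) = 1 + sz P"

text \<open>Local states of \<open>P\<close> are the numbers below \<open>sz P\<close>, and
  \<open>sz P\<close> is its exit. The extra tests redirect this exit: from the first branch of a
  \<open>Cond\<close> past the second one, from the body of a \<open>Loop\<close> back to its test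
  in state 0.\<close>

fun code :: "prog \<Rightarrow> nat \<Rightarrow> nat list \<Rightarrow> nat \<times> (nat \<times> move) list" where
  "code (Act a) q s = (1, a s)"
| "code (Seq P Q) q s =
    (if q < sz P then code P q s else apfst ((+) (sz P)) (code Q (q - sz P) s))"
| "code (Cond b P Q) q s =
    (if q = 0 then (if b s then 1 else 1 + sz P, idle s)
     else if q < 1 + sz P
     then (case code P (q - 1) s of (q', as) \<Rightarrow> (if q' = sz P then 1 + sz P + sz Q else 1 + q', as))
     else apfst ((+) (1 + sz P)) (code Q (q - 1 - sz P) s))"
| "code (Loop b P) q s =
    (if q = 0 then (if b s then 1 else 1 + sz P, idle s)
     else (case code P (q - 1) s of (q', as) \<Rightarrow> (if q' = sz P then 0 else 1 + q', as)))"

definition prog_tm :: "nat \<Rightarrow> prog \<Rightarrow> tm" where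
  "prog_tm k P = \<lparr>tapes = k, symbols = 5, states = sz P, delta = code P\<rparr>"

fun acts_ok :: "nat \<Rightarrow> prog \<Rightarrow> bool" where
  "acts_ok k (Act a) \<longleftrightarrow> (\<forall>s. length s = k \<and> set s \<subseteq> {..<5} \<longrightarrow>
     length (a s) = k \<and> fst ` set (a s) \<subseteq> {..<5})"
| "acts_ok k (Seq P Q) \<longleftrightarrow> acts_ok k P \<and> acts_ok k Q"
| "acts_ok k (Cond b P Q) \<longleftrightarrow> acts_ok k P \<and> acts_ok k Q"
| "acts_ok k (Loop b P) \<longleftrightarrow> acts_ok k P"

lemma sz_pos: "0 < sz P"
  by (induction P) auto

lemma idle_ok: "length (idle s) = length s" "fst ` set (idle s) = set s"
  by (auto simp: idle_def image_image)

lemma map2_act_idle: "map2 act (idle (reads ts)) ts = ts"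
  by (induction ts) (auto simp: idle_def reads_def)

lemma code_le: "fst (code P q s) \<le> sz P"
proof (induction P arbitrary: q)
  case (Seq P Q)
  then show ?case by (auto simp: case_prod_unfold intro: trans_le_add1)
next
  case (Cond b P Q)
  then show ?case by (auto simp: case_prod_unfold intro: trans_le_add1)
next
  case (Loop b P)
  then show ?case by (auto simp: case_prod_unfold)
qed auto

lemma code_ok:
  assumes "acts_ok k P" "q < sz P" "length s = k" "set s \<subseteq> {..<5}"
  shows "fst (code P q s) \<le> sz P \<and> length (snd (code P q s)) = k \<and>
    fst ` set (snd (code P q s)) \<subseteq> {..<5}"
  using assms(1,2)
proof (induction P arbitrary: q)
  case (Act a)
  then show ?case using assms by auto
next
  case (Seq P Q)
  show ?case
  proof (cases "q < sz P")
    case True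
    then show ?thesis using Seq.IH(1)[of q] Seq.prems by auto
  next
    case False
    then have "q - sz P < sz Q" using Seq.prems by auto
    then show ?thesis using Seq.IH(2)[of "q - sz P"] Seq.prems False by (auto simp: case_prod_unfold)
  qed
next
  case (Cond b P Q)
  consider "q = 0" | "q > 0" "q < 1 + sz P" | "q \<ge> 1 + sz P" by linarith
  then show ?case
  proof cases
    case 1
    then show ?thesis using assms by (auto simp: idle_ok)
  next
    case 2
    then have "q - 1 < sz P" by auto
    then show ?thesis using Cond.IH(1)[of "q - 1"] Cond.prems 2
      by (auto simp: case_prod_unfold)
  next
    case 3
    then have "q - 1 - sz P < sz Q" using Cond.prems by auto
    then show ?thesis using Cond.IH(2)[of "q - 1 - sz P"] Cond.prems 3
      by (auto simp: case_prod_unfold)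
  qed
next
  case (Loop b P)
  show ?case
  proof (cases "q = 0")
    case True
    then show ?thesis using assms by (auto simp: idle_ok)
  next
    case False
    then have "q - 1 < sz P" using Loop.prems by auto
    then show ?thesis using Loop.IH[of "q - 1"] Loop.prems False
      by (auto simp: case_prod_unfold)
  qed
qed

lemma prog_tm_wf:
  assumes "acts_ok k P" "2 \<le> k"
  shows "tm_wf (prog_tm k P)"
proof -
  have "case code P q s of (q', as) \<Rightarrow> q' \<le> sz P \<and> length as = k \<and> fst ` set as \<subseteq> {..<5}"
    if "q < sz P" "length s = k" "set s \<subseteq> {..<5}" for q s
    using code_ok[OF assms(1) that] by (cases "code P q s") simp
  then show ?thesis using assms(2) by (simp add: tm_wf_def prog_tm_def)
qed

section \<open>Compiled programs inside a larger transition table\<close>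

definition gstep ::
  "(nat \<Rightarrow> nat list \<Rightarrow> nat \<times> (nat \<times> move) list) \<Rightarrow> config \<Rightarrow> config" where
  "gstep D c = (case c of (q, ts) \<Rightarrow> case D q (reads ts) of (q', as) \<Rightarrow> (q', map2 act as ts))"

text \<open>The code of \<open>P\<close> occupies the table from address \<open>b\<close> on, with
  its exit redirected to \<open>x\<close>. Keeping \<open>x\<close> free makes the notion
  compositional: a loop body exits to the test, both branches of a conditional to its end.\<close>

definition placed ::
  "(nat \<Rightarrow> nat list \<Rightarrow> nat \<times> (nat \<times> move) list) \<Rightarrow> nat \<Rightarrow> nat \<Rightarrow> prog \<Rightarrow> bool" where
  "placed D b x P \<longleftrightarrow> (\<forall>q < sz P. \<forall>s. D (b + q) s =
     (case code P q s of (q', as) \<Rightarrow> (if q' = sz P then x else b + q', as)))"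

lemma placed_Seq:
  assumes "placed D b x (Seq P Q)"
  shows "placed D b (b + sz P) P" "placed D (b + sz P) x Q"
proof -
  have D: "D (b + q) s = (case code (Seq P Q) q s of (q', as) \<Rightarrow> (if q' = sz (Seq P Q) then x else b + q', as))"
    if "q < sz (Seq P Q)" for q s
    using assms that unfolding placed_def by blast
  show "placed D b (b + sz P) P"
    unfolding placed_def
  proof (intro allI impI)
    fix q s assume q: "q < sz P"
    show "D (b + q) s = (case code P q s of (q', as) \<Rightarrow> (if q' = sz P then b + sz P else b + q', as))"
      using D[of q s] q code_le[of P q s] sz_pos[of Q] by (simp add: case_prod_unfold)
  qed
  show "placed D (b + sz P) x Q"
    unfolding placed_def
  proof (intro allI impI)
    fix q s assume q: "q < sz Q"
    show "D (b + sz P + q) s = (case code Q q s of (q', as) \<Rightarrow> (if q' = sz Q then x else b + sz P + q', as))"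
      using D[of "sz P + q" s] q by (simp add: case_prod_unfold add.assoc)
  qed
qed

lemma placed_Cond:
  assumes "placed D b x (Cond c P Q)"
  shows "D b s = (if c s then b + 1 else b + 1 + sz P, idle s)"
    "placed D (b + 1) x P" "placed D (b + 1 + sz P) x Q"
proof -
  have D: "D (b + q) s = (case code (Cond c P Q) q s of (q', as) \<Rightarrow> (if q' = sz (Cond c P Q) then x else b + q', as))"
    if "q < sz (Cond c P Q)" for q s
    using assms that unfolding placed_def by blast
  show "D b s = (if c s then b + 1 else b + 1 + sz P, idle s)"
    using D[of 0 s] sz_pos[of Q] by auto
  show "placed D (b + 1) x P"
    unfolding placed_def
  proof (intro allI impI)
    fix q s assume q: "q < sz P"
    show "D (b + 1 + q) s = (case code P q s of (q', as) \<Rightarrow> (if q' = sz P then x else b + 1 + q', as))"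
      using D[of "Suc q" s] q code_le[of P q s] by (auto simp: case_prod_unfold)
  qed
  show "placed D (b + 1 + sz P) x Q"
    unfolding placed_def
  proof (intro allI impI)
    fix q s assume q: "q < sz Q"
    show "D (b + 1 + sz P + q) s = (case code Q q s of (q', as) \<Rightarrow> (if q' = sz Q then x else b + 1 + sz P + q', as))"
      using D[of "1 + sz P + q" s] q by (auto simp: add.assoc case_prod_unfold)
  qed
qed

lemma placed_Loop:
  assumes "placed D b x (Loop c P)"
  shows "D b s = (if c s then b + 1 else x, idle s)" "placed D (b + 1) b P"
proof -
  have D: "D (b + q) s = (case code (Loop c P) q s of (q', as) \<Rightarrow> (if q' = sz (Loop c P) then x else b + q', as))"
    if "q < sz (Loop c P)" for q s
    using assms that unfolding placed_def by blast
  show "D b s = (if c s then b + 1 else x, idle s)"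
    using D[of 0 s] sz_pos[of P] by auto
  show "placed D (b + 1) b P"
    unfolding placed_def
  proof (intro allI impI)
    fix q s assume q: "q < sz P"
    show "D (b + 1 + q) s = (case code P q s of (q', as) \<Rightarrow> (if q' = sz P then b else b + 1 + q', as))"
      using D[of "Suc q" s] q code_le[of P q s] by (auto simp: case_prod_unfold)
  qed
qed

text \<open>Induction over the derivation with \<open>b\<close> and \<open>x\<close> arbitrary,
  since each subprogram is placed at its own address with its own exit.\<close>

lemma exec_gstep:
  assumes "exec P ts t us" "placed D b x P"
  shows "(gstep D ^^ t) (b, ts) = (x, us)"
  using assms
proof (induction arbitrary: b x)
  case (exec_Act a ts)
  then show ?case by (simp add: placed_def gstep_def)
next
  case (exec_Seq P ts m us Q n vs)
  have "m + n = n + m" by simp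
  then show ?case
    using exec_Seq.IH(1)[OF placed_Seq(1)[OF exec_Seq.prems]]
      exec_Seq.IH(2)[OF placed_Seq(2)[OF exec_Seq.prems]]
    by (simp only: funpow_add o_apply)
next
  case (exec_CondT c ts P m us Q)
  have "gstep D (b, ts) = (b + 1, ts)"
    using placed_Cond(1)[OF exec_CondT.prems] exec_CondT.hyps by (simp add: gstep_def map2_act_idle)
  with exec_CondT.IH[OF placed_Cond(2)[OF exec_CondT.prems]] show ?case
    by (simp only: funpow_Suc_right o_apply)
next
  case (exec_CondF c ts Q m us P)
  have "gstep D (b, ts) = (b + 1 + sz P, ts)"
    using placed_Cond(1)[OF exec_CondF.prems] exec_CondF.hyps by (simp add: gstep_def map2_act_idle)
  with exec_CondF.IH[OF placed_Cond(3)[OF exec_CondF.prems]] show ?case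
    by (simp only: funpow_Suc_right o_apply)
next
  case (exec_LoopF c ts P)
  then show ?case
    using placed_Loop(1)[OF exec_LoopF.prems] by (simp add: gstep_def map2_act_idle)
next
  case (exec_LoopT c ts P m us n vs)
  have "gstep D (b, ts) = (b + 1, ts)"
    using placed_Loop(1)[OF exec_LoopT.prems] exec_LoopT.hyps by (simp add: gstep_def map2_act_idle)
  then have "(gstep D ^^ Suc m) (b, ts) = (b, us)"
    using exec_LoopT.IH(1)[OF placed_Loop(2)[OF exec_LoopT.prems]]
    by (simp only: funpow_Suc_right o_apply)
  moreover have "Suc (m + n) = n + Suc m" by simp
  ultimately show ?case
    using exec_LoopT.IH(2)[OF exec_LoopT.prems] by (simp only: funpow_add o_apply)
qed

text \<open>The halting test of \<open>step\<close> is absorbed into the table as idle entries for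
  the states from \<open>sz P\<close> on, so that results on \<open>gstep\<close> apply to the
  machine itself.\<close>

lemma step_prog_tm:
  "step (prog_tm k P) = gstep (\<lambda>q s. if q \<ge> sz P then (q, idle s) else code P q s)"
proof (rule ext)
  fix c :: config
  obtain q ts where c: "c = (q, ts)" by (cases c)
  show "step (prog_tm k P) c = gstep (\<lambda>q s. if q \<ge> sz P then (q, idle s) else code P q s) c"
    unfolding c step.simps gstep_def prog_tm_def reads_def[symmetric]
    by (simp add: map2_act_idle)
qed

lemma exec_step:
  assumes "exec P ts t us"
  shows "(step (prog_tm k P) ^^ t) (0, ts) = (sz P, us)"
  unfolding step_prog_tm
proof (rule exec_gstep[OF assms])
  show "placed (\<lambda>q s. if q \<ge> sz P then (q, idle s) else code P q s) 0 (sz P) P"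
    by (simp add: placed_def case_prod_unfold prod_eq_iff)
qed

section \<open>Counter registers\<close>

text \<open>
  A register is the head position on a tape that stays as it was initially, so that the end
  marker tells whether it is 0.
\<close>

definition conf :: "nat list \<Rightarrow> nat \<Rightarrow> nat \<times> nat list \<times> (nat \<Rightarrow> nat) \<Rightarrow> tape list" where
  "conf w m \<sigma> = (case \<sigma> of (h, out, r) \<Rightarrow>
     (contents w, h) # (contents out, Suc (length out)) # map (\<lambda>i. (contents [], r i)) [0..<m])"

definition runs :: "nat list \<Rightarrow> nat \<Rightarrow> prog \<Rightarrow> nat \<times> nat list \<times> (nat \<Rightarrow> nat) \<Rightarrow> nat \<Rightarrow>
    nat \<times> nat list \<times> (nat \<Rightarrow> nat) \<Rightarrow> bool" where
  "runs w m P \<sigma> t \<sigma>' \<longleftrightarrow> (\<exists>t' \<le> t. exec P (conf w m \<sigma>) t' (conf w m \<sigma>'))"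

definition shift :: "nat \<Rightarrow> move \<Rightarrow> prog" where
  "shift k d = Act (\<lambda>s. map (\<lambda>i. (s ! i, if i = k then d else Stay)) [0..<length s])"

definition emit :: "nat \<Rightarrow> prog" where
  "emit b = Act (\<lambda>s. map (\<lambda>i. if i = 1 then (b, Move_Right) else (s ! i, Stay)) [0..<length s])"

lemma acts_ok_shift: "acts_ok k (shift i d)"
  by (auto simp: shift_def) (meson lessThan_iff nth_mem subsetD)

lemma acts_ok_emit: "b < 5 \<Longrightarrow> acts_ok k (emit b)"
  by (auto simp: emit_def split: if_splits) (meson lessThan_iff nth_mem subsetD)

lemma exec_shift:
  "exec (shift k d) ts 1
     (map (\<lambda>i. if i = k then (fst (ts ! i), move_head d (snd (ts ! i))) else ts ! i) [0..<length ts])"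
proof -
  have "map2 act (map (\<lambda>i. (reads ts ! i, if i = k then d else Stay)) [0..<length (reads ts)]) ts =
     map (\<lambda>i. if i = k then (fst (ts ! i), move_head d (snd (ts ! i))) else ts ! i) [0..<length ts]"
  proof (rule nth_equalityI)
    fix i assume "i < length (map2 act (map (\<lambda>i. (reads ts ! i, if i = k then d else Stay)) [0..<length (reads ts)]) ts)"
    then have i: "i < length ts" by (simp add: reads_def)
    obtain c h where "ts ! i = (c, h)" by (cases "ts ! i")
    with i show "map2 act (map (\<lambda>i. (reads ts ! i, if i = k then d else Stay)) [0..<length (reads ts)]) ts ! i =
       map (\<lambda>i. if i = k then (fst (ts ! i), move_head d (snd (ts ! i))) else ts ! i) [0..<length ts] ! i"
      by (auto simp: reads_def)
  qed (simp add: reads_def)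
  with exec_Act[of "\<lambda>s. map (\<lambda>i. (s ! i, if i = k then d else Stay)) [0..<length s]" ts]
  show ?thesis unfolding shift_def by simp
qed

lemma exec_emit:
  assumes "1 < length ts"
  shows "exec (emit b) ts 1 (ts[1 := ((fst (ts ! 1))(snd (ts ! 1) := b), Suc (snd (ts ! 1)))])"
proof -
  have "map2 act (map (\<lambda>i. if i = 1 then (b, Move_Right) else (reads ts ! i, Stay)) [0..<length (reads ts)]) ts =
     ts[1 := ((fst (ts ! 1))(snd (ts ! 1) := b), Suc (snd (ts ! 1)))]"
  proof (rule nth_equalityI)
    fix i assume "i < length (map2 act (map (\<lambda>i. if i = 1 then (b, Move_Right) else (reads ts ! i, Stay)) [0..<length (reads ts)]) ts)"
    then have i: "i < length ts" by (simp add: reads_def)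
    obtain c h where "ts ! i = (c, h)" by (cases "ts ! i")
    with i show "map2 act (map (\<lambda>i. if i = 1 then (b, Move_Right) else (reads ts ! i, Stay)) [0..<length (reads ts)]) ts ! i =
       ts[1 := ((fst (ts ! 1))(snd (ts ! 1) := b), Suc (snd (ts ! 1)))] ! i"
      by (auto simp: reads_def nth_list_update)
  qed (simp add: reads_def)
  with exec_Act[of "\<lambda>s. map (\<lambda>i. if i = 1 then (b, Move_Right) else (s ! i, Stay)) [0..<length s]" ts]
  show ?thesis unfolding emit_def by simp
qed

lemma length_conf [simp]: "length (conf w m \<sigma>) = m + 2"
  by (cases \<sigma>) (auto simp: conf_def)

lemma conf_nth [simp]:
  "conf w m (h, out, r) ! 0 = (contents w, h)"
  "conf w m (h, out, r) ! Suc 0 = (contents out, Suc (length out))"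
  "k < m \<Longrightarrow> conf w m (h, out, r) ! Suc (Suc k) = (contents [], r k)"
  by (auto simp: conf_def)

lemma conf_eqI:
  assumes "length ts = m + 2" "ts ! 0 = (contents w, h)"
    "ts ! Suc 0 = (contents out, Suc (length out))"
    "\<And>k. k < m \<Longrightarrow> ts ! Suc (Suc k) = (contents [], r k)"
  shows "ts = conf w m (h, out, r)"
proof (rule nth_equalityI)
  show "length ts = length (conf w m (h, out, r))" using assms by simp
  fix i assume i: "i < length ts"
  consider "i = 0" | "i = Suc 0" | k where "i = Suc (Suc k)"
    by (metis nat.exhaust)
  then show "ts ! i = conf w m (h, out, r) ! i"
    using assms i by cases auto
qed

lemma reads_conf [simp]:
  "reads (conf w m (h, out, r)) ! 0 = contents w h"
  "k < m \<Longrightarrow> reads (conf w m (h, out, r)) ! Suc (Suc k) = (if r k = 0 then 1 else 0)"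
  by (auto simp: reads_def nth_map contents_def)

lemma runs_weaken: "runs w m P \<sigma> t \<sigma>' \<Longrightarrow> t \<le> t' \<Longrightarrow> runs w m P \<sigma> t' \<sigma>'"
  unfolding runs_def by (meson order_trans)

lemma runs_Seq:
  "runs w m P \<sigma> s \<tau> \<Longrightarrow> runs w m Q \<tau> t \<upsilon> \<Longrightarrow> runs w m (Seq P Q) \<sigma> (s + t) \<upsilon>"
  unfolding runs_def by (meson add_mono exec_Seq)

lemma runs_Cond:
  assumes "c (reads (conf w m \<sigma>)) \<Longrightarrow> runs w m P \<sigma> t \<tau>"
    "\<not> c (reads (conf w m \<sigma>)) \<Longrightarrow> runs w m Q \<sigma> t \<tau>"
  shows "runs w m (Cond c P Q) \<sigma> (Suc t) \<tau>"
  using assms unfolding runs_def by (meson Suc_le_mono exec_CondT exec_CondF)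

text \<open>The invariant is a sequence \<open>f\<close> of states, one before each round, so every
  use supplies an explicit closed form and the number of rounds.\<close>

lemma runs_Loop:
  assumes "\<And>j. j < n \<Longrightarrow> c (reads (conf w m (f j)))"
    "\<And>j. j < n \<Longrightarrow> runs w m P (f j) T (f (Suc j))"
    "\<not> c (reads (conf w m (f n)))"
  shows "runs w m (Loop c P) (f 0) (n * Suc T + 1) (f n)"
  using assms
proof (induction n arbitrary: f)
  case 0
  then show ?case unfolding runs_def using exec_LoopF[of c "conf w m (f 0)" P] by auto
next
  case (Suc n)
  have "runs w m (Loop c P) (f (Suc 0)) (n * Suc T + 1) (f (Suc n))"
    using Suc.IH[of "\<lambda>j. f (Suc j)"] Suc.prems by simp
  then obtain t where t: "t \<le> n * Suc T + 1" "exec (Loop c P) (conf w m (f (Suc 0))) t (conf w m (f (Suc n)))"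
    unfolding runs_def by blast
  obtain s where s: "s \<le> T" "exec P (conf w m (f 0)) s (conf w m (f (Suc 0)))"
    using Suc.prems(2)[of 0] unfolding runs_def by blast
  have "exec (Loop c P) (conf w m (f 0)) (Suc (s + t)) (conf w m (f (Suc n)))"
    using exec_LoopT[OF _ s(2) t(2)] Suc.prems(1)[of 0] by simp
  moreover have "Suc (s + t) \<le> Suc n * Suc T + 1" using s(1) t(1) by simp
  ultimately show ?case unfolding runs_def by blast
qed

lemma runs_shift_input: "runs w m (shift 0 d) (h, out, r) 1 (move_head d h, out, r)"
proof -
  have "map (\<lambda>i. if i = 0 then (fst (conf w m (h, out, r) ! i), move_head d (snd (conf w m (h, out, r) ! i)))
      else conf w m (h, out, r) ! i) [0..<length (conf w m (h, out, r))] = conf w m (move_head d h, out, r)"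
    by (rule conf_eqI) (auto simp del: upt_Suc)
  then show ?thesis
    using exec_shift[of 0 d "conf w m (h, out, r)"] unfolding runs_def by auto
qed

lemma runs_shift:
  assumes "k < m"
  shows "runs w m (shift (Suc (Suc k)) d) (h, out, r) 1 (h, out, r(k := move_head d (r k)))"
proof -
  have "map (\<lambda>i. if i = Suc (Suc k) then (fst (conf w m (h, out, r) ! i), move_head d (snd (conf w m (h, out, r) ! i)))
      else conf w m (h, out, r) ! i) [0..<length (conf w m (h, out, r))] = conf w m (h, out, r(k := move_head d (r k)))"
    using assms by (intro conf_eqI) (auto simp del: upt_Suc)
  then show ?thesis
    using exec_shift[of "Suc (Suc k)" d "conf w m (h, out, r)"] unfolding runs_def by auto
qed

lemma contents_snoc: "(contents w)(Suc (length w) := b) = contents (w @ [b])"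
  by (auto simp: contents_def nth_append fun_eq_iff)

lemma runs_emit: "runs w m (emit b) (h, out, r) 1 (h, out @ [b], r)"
proof -
  let ?ts = "conf w m (h, out, r)"
  have "?ts[1 := ((fst (?ts ! 1))(snd (?ts ! 1) := b), Suc (snd (?ts ! 1)))] = conf w m (h, out @ [b], r)"
    by (rule conf_eqI) (auto simp: contents_snoc)
  then show ?thesis
    using exec_emit[of ?ts b] unfolding runs_def by auto
qed

text \<open>On a register tape only cell 0 carries the symbol 1, so reading 1 means that the
  register is 0.\<close>

definition nz :: "nat \<Rightarrow> nat list \<Rightarrow> bool" where
  "nz k s \<longleftrightarrow> s ! Suc (Suc k) \<noteq> 1"

lemma nz_conf [simp]: "k < m \<Longrightarrow> nz k (reads (conf w m (h, out, r))) \<longleftrightarrow> r k \<noteq> 0"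
  by (simp add: nz_def)

definition incr :: "nat \<Rightarrow> prog" where "incr k = shift (Suc (Suc k)) Move_Right"
text \<open>A head on cell 0 does not move further left, hence this is truncated subtraction of
  1.\<close>

definition decr :: "nat \<Rightarrow> prog" where "decr k = shift (Suc (Suc k)) Move_Left"

lemma runs_incr: "k < m \<Longrightarrow> runs w m (incr k) (h, out, r) 1 (h, out, r(k := Suc (r k)))"
  using runs_shift[of k m w Move_Right] by (simp add: incr_def)

lemma runs_decr: "k < m \<Longrightarrow> runs w m (decr k) (h, out, r) 1 (h, out, r(k := r k - 1))"
  using runs_shift[of k m w Move_Left] by (simp add: decr_def)

lemma runs_incr': "k < m \<Longrightarrow> r' = r(k := Suc (r k)) \<Longrightarrow> runs w m (incr k) (h, out, r) 1 (h, out, r')"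
  using runs_incr by simp

lemma runs_decr': "k < m \<Longrightarrow> r' = r(k := r k - 1) \<Longrightarrow> runs w m (decr k) (h, out, r) 1 (h, out, r')"
  using runs_decr by simp

definition clear :: "nat \<Rightarrow> prog" where "clear a = Loop (nz a) (decr a)"
definition mover :: "nat \<Rightarrow> nat \<Rightarrow> prog" where "mover a b = Loop (nz a) (Seq (decr a) (incr b))"
text \<open>A register can only be copied by emptying it: \<open>v\<close> is drained into both
  \<open>a\<close> and the scratch register \<open>c\<close>, and \<open>c\<close> is then moved
  back to restore \<open>v\<close>.\<close>

definition addv :: "nat \<Rightarrow> nat \<Rightarrow> nat \<Rightarrow> prog" where
  "addv v a c = Seq (Loop (nz v) (Seq (decr v) (Seq (incr a) (incr c)))) (mover c v)"

lemma runs_clear: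
  assumes "a < m" "r a \<le> n"
  shows "runs w m (clear a) (h, out, r) (n * 2 + 1) (h, out, r(a := 0))"
proof -
  have "runs w m (clear a) ((\<lambda>j. (h, out, r(a := r a - j))) 0) (r a * Suc 1 + 1) ((\<lambda>j. (h, out, r(a := r a - j))) (r a))"
    unfolding clear_def
  proof (rule runs_Loop)
    fix j assume "j < r a"
    show "runs w m (decr a) (h, out, r(a := r a - j)) 1 (h, out, r(a := r a - Suc j))"
      using runs_decr[OF assms(1), of w h out "r(a := r a - j)"] by simp
  qed (use assms in auto)
  then show ?thesis using assms by (auto elim!: runs_weaken)
qed

lemma runs_mover:
  assumes "a < m" "b < m" "a \<noteq> b" "r a \<le> n"
  shows "runs w m (mover a b) (h, out, r) (n * 3 + 1) (h, out, r(a := 0, b := r b + r a))"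
proof -
  let ?f = "\<lambda>j. (h, out, r(a := r a - j, b := r b + j))"
  have "runs w m (mover a b) (?f 0) (r a * Suc 2 + 1) (?f (r a))"
    unfolding mover_def
  proof (rule runs_Loop)
    fix j assume "j < r a"
    have "runs w m (Seq (decr a) (incr b)) (?f j) (1 + 1) (?f (Suc j))"
    proof (rule runs_Seq)
      show "runs w m (decr a) (?f j) 1 (h, out, r(a := r a - Suc j, b := r b + j))"
        by (rule runs_decr') (use assms in \<open>auto simp: fun_eq_iff\<close>)
      show "runs w m (incr b) (h, out, r(a := r a - Suc j, b := r b + j)) 1 (?f (Suc j))"
        by (rule runs_incr') (use assms in \<open>auto simp: fun_eq_iff\<close>)
    qed
    then show "runs w m (Seq (decr a) (incr b)) (?f j) 2 (?f (Suc j))" by (simp add: numeral_2_eq_2)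
  qed (use assms in auto)
  moreover have "?f 0 = (h, out, r)" by auto
  ultimately show ?thesis using assms by (auto elim!: runs_weaken)
qed

lemma runs_addv:
  assumes "v < m" "a < m" "c < m" "v \<noteq> a" "v \<noteq> c" "a \<noteq> c" "r v \<le> n" "r c = 0"
  shows "runs w m (addv v a c) (h, out, r) (n * 4 + 1 + (n * 3 + 1)) (h, out, r(a := r a + r v))"
proof -
  let ?f = "\<lambda>j. (h, out, r(v := r v - j, a := r a + j, c := j))"
  have "runs w m (Loop (nz v) (Seq (decr v) (Seq (incr a) (incr c)))) (?f 0) (r v * Suc 3 + 1) (?f (r v))"
  proof (rule runs_Loop)
    fix j assume "j < r v"
    have "runs w m (Seq (decr v) (Seq (incr a) (incr c))) (?f j) (1 + (1 + 1))
      (h, out, r(v := r v - Suc j, a := r a + Suc j, c := Suc j))"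
    proof (intro runs_Seq)
      show "runs w m (decr v) (?f j) 1 (h, out, r(v := r v - Suc j, a := r a + j, c := j))"
        by (rule runs_decr') (use assms in \<open>auto simp: fun_eq_iff\<close>)
      show "runs w m (incr a) (h, out, r(v := r v - Suc j, a := r a + j, c := j)) 1
          (h, out, r(v := r v - Suc j, a := r a + Suc j, c := j))"
        by (rule runs_incr') (use assms in \<open>auto simp: fun_eq_iff\<close>)
      show "runs w m (incr c) (h, out, r(v := r v - Suc j, a := r a + Suc j, c := j)) 1
          (h, out, r(v := r v - Suc j, a := r a + Suc j, c := Suc j))"
        by (rule runs_incr') (use assms in \<open>auto simp: fun_eq_iff\<close>)
    qed
    then show "runs w m (Seq (decr v) (Seq (incr a) (incr c))) (?f j) 3 (?f (Suc j))"
      by (simp add: numeral_3_eq_3)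
  qed (use assms in auto)
  moreover have "?f 0 = (h, out, r)" using assms by (auto simp: fun_eq_iff)
  moreover have "?f (r v) = (h, out, r(v := 0, a := r a + r v, c := r v))" by simp
  ultimately have 1: "runs w m (Loop (nz v) (Seq (decr v) (Seq (incr a) (incr c)))) (h, out, r) (n * 4 + 1)
     (h, out, r(v := 0, a := r a + r v, c := r v))"
    using assms by (auto elim!: runs_weaken)
  have "runs w m (mover c v) (h, out, r(v := 0, a := r a + r v, c := r v)) (n * 3 + 1)
    (h, out, (r(v := 0, a := r a + r v, c := r v))(c := 0, v := (r(v := 0, a := r a + r v, c := r v)) v + (r(v := 0, a := r a + r v, c := r v)) c))"
    by (rule runs_mover) (use assms in auto)
  also have "(r(v := 0, a := r a + r v, c := r v))(c := 0, v := (r(v := 0, a := r a + r v, c := r v)) v + (r(v := 0, a := r a + r v, c := r v)) c)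
     = r(a := r a + r v)"
    using assms by (auto simp: fun_eq_iff)
  finally show ?thesis unfolding addv_def by (rule runs_Seq[OF 1])
qed


section \<open>Bounded arithmetic expressions\<close>

text \<open>Subtraction is truncated and the bounded sum is the only binder. Products, tests,
  connectives, quantifiers, quotients and let-bindings are all derived from these six constructors,
  so the compiler treats nothing else.\<close>

datatype ex = One | Var nat | In ex | Add ex ex | Sub ex ex | Sum nat ex ex

fun eval :: "ex \<Rightarrow> nat list \<Rightarrow> (nat \<Rightarrow> nat) \<Rightarrow> nat" where
  "eval One w r = 1"
| "eval (Var v) w r = r v"
| "eval (In a) w r = contents w (eval a w r)"
| "eval (Add a b) w r = eval a w r + eval b w r"
| "eval (Sub a b) w r = eval a w r - eval b w r"
| "eval (Sum v a b) w r = (\<Sum>i<eval a w r. eval b w (r(v := i)))"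

fun vars :: "ex \<Rightarrow> nat set" where
  "vars One = {}"
| "vars (Var v) = {v}"
| "vars (In a) = vars a"
| "vars (Add a b) = vars a \<union> vars b"
| "vars (Sub a b) = vars a \<union> vars b"
| "vars (Sum v a b) = insert v (vars a \<union> vars b)"

lemma finite_vars [simp]: "finite (vars e)"
  by (induction e) auto

lemma eval_cong: "(\<And>v. v \<in> vars e \<Longrightarrow> r v = r' v) \<Longrightarrow> eval e w r = eval e w r'"
proof (induction e arbitrary: r r')
  case (Add a b)
  have "eval a w r = eval a w r'" by (rule Add.IH) (use Add.prems in simp)
  moreover have "eval b w r = eval b w r'" by (rule Add.IH) (use Add.prems in simp)
  ultimately show ?case by simp
next
  case (Sub a b)
  have "eval a w r = eval a w r'" by (rule Sub.IH) (use Sub.prems in simp)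
  moreover have "eval b w r = eval b w r'" by (rule Sub.IH) (use Sub.prems in simp)
  ultimately show ?case by simp
next
  case (In a)
  have "eval a w r = eval a w r'" by (rule In.IH) (use In.prems in simp)
  then show ?case by simp
next
  case (Sum v a b)
  have "eval a w r = eval a w r'" by (rule Sum.IH) (use Sum.prems in simp)
  moreover have "eval b w (r(v := i)) = eval b w (r'(v := i))" for i
    by (rule Sum.IH) (use Sum.prems in simp)
  ultimately show ?case by simp
qed simp_all

definition add_symbol :: "nat \<Rightarrow> prog" where
  "add_symbol t = Seq (Cond (\<lambda>s. s ! 0 \<in> {1, 3}) (incr t) (Act idle))
    (Cond (\<lambda>s. s ! 0 \<in> {2, 3}) (Seq (incr t) (incr t))
      (Cond (\<lambda>s. s ! 0 = 4) (Seq (Seq (incr t) (incr t)) (Seq (incr t) (incr t))) (Act idle)))"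

text \<open>The value is added to register \<open>t\<close>, not stored in it: \<open>Add\<close>
  becomes mere sequencing and \<open>Sum\<close> accumulates in place. Registers below
  \<open>t\<close> hold variables and pending intermediate values, those above \<open>t\<close> are
  scratch, zero before and after. \<open>In\<close> turns a value into a head position and rewinds;
  \<open>Sum\<close> parks the old value of its variable in \<open>t + 2\<close>.\<close>

fun cmp :: "ex \<Rightarrow> nat \<Rightarrow> prog" where
  "cmp One t = incr t"
| "cmp (Var v) t = addv v t (t + 1)"
| "cmp (In a) t = Seq (cmp a (t + 1)) (Seq (Loop (nz (t + 1)) (Seq (decr (t + 1)) (shift 0 Move_Right)))
    (Seq (add_symbol t) (Loop (\<lambda>s. s ! 0 \<noteq> 1) (shift 0 Move_Left))))"
| "cmp (Add a b) t = Seq (cmp a t) (cmp b t)"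
| "cmp (Sub a b) t = Seq (cmp a (t + 1)) (Seq (cmp b (t + 2))
    (Seq (Loop (nz (t + 2)) (Seq (decr (t + 2)) (decr (t + 1)))) (mover (t + 1) t)))"
| "cmp (Sum v a b) t = Seq (cmp a (t + 1)) (Seq (mover v (t + 2))
    (Seq (Loop (nz (t + 1)) (Seq (decr (t + 1)) (Seq (cmp b (t + 3)) (Seq (mover (t + 3) t) (incr v)))))
      (Seq (clear v) (mover (t + 2) v))))"

fun need :: "ex \<Rightarrow> nat" where
  "need One = 0"
| "need (Var v) = 1"
| "need (In a) = need a + 1"
| "need (Add a b) = need a + need b"
| "need (Sub a b) = need a + need b + 2"
| "need (Sum v a b) = need a + need b + 3"

text \<open>Bounds for values, and in \<open>tb\<close> for running times, when all variables are at
  most \<open>B\<close>. Inside a sum the summation variable may exceed \<open>B\<close> but stays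
  below the limit; \<open>B + vb a B\<close> covers both.\<close>

fun vb :: "ex \<Rightarrow> nat \<Rightarrow> nat" where
  "vb One B = 1"
| "vb (Var v) B = B"
| "vb (In a) B = 4"
| "vb (Add a b) B = vb a B + vb b B"
| "vb (Sub a b) B = vb a B"
| "vb (Sum v a b) B = vb a B * vb b (B + vb a B)"

fun tb :: "ex \<Rightarrow> nat \<Rightarrow> nat" where
  "tb One B = 1"
| "tb (Var v) B = B * 4 + 1 + (B * 3 + 1)"
| "tb (In a) B = tb a B + ((vb a B * 3 + 1) + (9 + (vb a B * 2 + 1)))"
| "tb (Add a b) B = tb a B + tb b B"
| "tb (Sub a b) B = tb a B + (tb b B + ((vb b B * 3 + 1) + (vb a B * 3 + 1)))"
| "tb (Sum v a b) B = tb a B + ((B * 3 + 1) +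
    ((vb a B * Suc (1 + (tb b (B + vb a B) + ((vb b (B + vb a B) * 3 + 1) + 1))) + 1) +
      ((vb a B * 2 + 1) + (B * 3 + 1))))"

lemma contents_le:
  assumes "set w \<subseteq> {2, 3, 4}"
  shows "contents w i \<le> 4"
proof (cases "0 < i \<and> i \<le> length w")
  case True
  then have "w ! (i - 1) \<in> set w" by (intro nth_mem) auto
  with assms True show ?thesis by (auto simp: contents_def)
qed (auto simp: contents_def)

text \<open>The end marker is unique, so moving left until 1 is read rewinds the input head to cell
  0.\<close>

lemma contents_eq_1:
  assumes "set w \<subseteq> {2, 3, 4}"
  shows "contents w i = 1 \<longleftrightarrow> i = 0"
proof (cases "0 < i \<and> i \<le> length w")
  case True
  then have "w ! (i - 1) \<in> set w" by (intro nth_mem) auto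
  with assms True show ?thesis by (auto simp: contents_def)
qed (auto simp: contents_def)

lemma eval_le_vb:
  assumes "set w \<subseteq> {2, 3, 4}" "\<And>v. v \<in> vars e \<Longrightarrow> r v \<le> B"
  shows "eval e w r \<le> vb e B"
  using assms(2)
proof (induction e arbitrary: r B)
  case (Add a b)
  then have "eval a w r \<le> vb a B" "eval b w r \<le> vb b B" by auto
  then show ?case by simp
next
  case (Sub a b)
  then have "eval a w r \<le> vb a B" by auto
  then show ?case by simp
next
  case (Sum v a b)
  have a: "eval a w r \<le> vb a B" using Sum.prems by (intro Sum.IH) auto
  have "(\<Sum>i<eval a w r. eval b w (r(v := i))) \<le> (\<Sum>i<eval a w r. vb b (B + vb a B))"
    using Sum.prems a by (intro sum_mono Sum.IH) (auto simp: trans_le_add1)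
  also have "\<dots> \<le> vb a B * vb b (B + vb a B)" using a by simp
  finally show ?case by simp
qed (use contents_le[OF assms(1)] in auto)

lemma runs_idle: "runs w m (Act idle) \<sigma> 1 \<sigma>"
  using exec_Act[of idle "conf w m \<sigma>"] unfolding runs_def by (auto simp: map2_act_idle)

lemma runs_add_symbol:
  assumes "t < m" "contents w h \<le> 4"
  shows "runs w m (add_symbol t) (h, out, r) 9 (h, out, r(t := r t + contents w h))"
proof -
  let ?c = "contents w h"
  have two: "runs w m (Seq (incr t) (incr t)) (h, out, q) (1 + 1) (h, out, q(t := q t + 2))" for q
    by (rule runs_Seq; rule runs_incr[OF assms(1), THEN runs_weaken] runs_incr'[OF assms(1)]) (auto simp: fun_eq_iff)
  have four: "runs w m (Seq (Seq (incr t) (incr t)) (Seq (incr t) (incr t))) (h, out, q) ((1 + 1) + (1 + 1)) (h, out, q(t := q t + 4))" for q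
    proof -
    have "q(t := q t + 4) = (q(t := q t + 2))(t := (q(t := q t + 2)) t + 2)" by (auto simp: fun_eq_iff)
    then show ?thesis using runs_Seq[OF two[of q] two] by simp
  qed
  let ?q = "r(t := r t + (if ?c \<in> {1, 3} then 1 else 0))"
  have 1: "runs w m (Cond (\<lambda>s. s ! 0 \<in> {1, 3}) (incr t) (Act idle)) (h, out, r) (Suc 1) (h, out, ?q)"
    by (rule runs_Cond) (use runs_incr[OF assms(1)] runs_idle in auto)
  have 2: "runs w m (Cond (\<lambda>s. s ! 0 = 4) (Seq (Seq (incr t) (incr t)) (Seq (incr t) (incr t))) (Act idle))
     (h, out, q) (Suc 4) (h, out, q(t := q t + (if ?c = 4 then 4 else 0)))" for q
    by (rule runs_Cond) (use four[of q, THEN runs_weaken, of 4] runs_idle[THEN runs_weaken, of 4] in auto)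
  have 3: "runs w m (Cond (\<lambda>s. s ! 0 \<in> {2, 3}) (Seq (incr t) (incr t))
      (Cond (\<lambda>s. s ! 0 = 4) (Seq (Seq (incr t) (incr t)) (Seq (incr t) (incr t))) (Act idle)))
     (h, out, q) (Suc (Suc 4)) (h, out, q(t := q t + (if ?c \<in> {2, 3} then 2 else if ?c = 4 then 4 else 0)))" for q
    by (rule runs_Cond) (use two[THEN runs_weaken, of "Suc 4"] 2[of q] in auto)
  have "?c = 0 \<or> ?c = 1 \<or> ?c = 2 \<or> ?c = 3 \<or> ?c = 4" using assms(2) by linarith
  then have "?q(t := ?q t + (if ?c \<in> {2, 3} then 2 else if ?c = 4 then 4 else 0)) = r(t := r t + ?c)"
    by auto
  with runs_Seq[OF 1 3[of ?q]] show ?thesis unfolding add_symbol_def by (auto elim: runs_weaken)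
qed

lemma runs_rewind:
  assumes "set w \<subseteq> {2, 3, 4}" "h \<le> n"
  shows "runs w m (Loop (\<lambda>s. s ! 0 \<noteq> 1) (shift 0 Move_Left)) (h, out, r) (n * 2 + 1) (0, out, r)"
proof -
  have "runs w m (Loop (\<lambda>s. s ! 0 \<noteq> 1) (shift 0 Move_Left)) ((\<lambda>j. (h - j, out, r)) 0) (h * Suc 1 + 1) ((\<lambda>j. (h - j, out, r)) h)"
    proof (rule runs_Loop)
    fix j assume "j < h"
    show "runs w m (shift 0 Move_Left) (h - j, out, r) 1 (h - Suc j, out, r)"
      using runs_shift_input[of w m Move_Left "h - j"] by simp
  qed (use contents_eq_1[OF assms(1)] in auto)
  then show ?thesis using assms by (auto elim!: runs_weaken)
qed

lemma runs_mover':
  assumes "a < m" "b < m" "a \<noteq> b" "r a \<le> n" "r' = r(a := 0, b := r b + r a)"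
  shows "runs w m (mover a b) (h, out, r) (n * 3 + 1) (h, out, r')"
  using runs_mover[where r = r, OF assms(1-4)] assms(5) by simp

lemma runs_clear':
  assumes "a < m" "r a \<le> n" "r' = r(a := 0)"
  shows "runs w m (clear a) (h, out, r) (n * 2 + 1) (h, out, r')"
  using runs_clear[where r = r, OF assms(1-2)] assms(3) by simp

text \<open>Value and final registers enter through equations. An induction hypothesis can thus be
  used in an environment that already stores intermediate results, while the value is still stated
  in the original one; \<open>eval_cong\<close> bridges the two.\<close>

lemma runs_cmp:
  assumes "set w \<subseteq> {2, 3, 4}"
  shows "\<lbrakk>\<And>v. v \<in> vars e \<Longrightarrow> v < t; \<And>i. i > t \<Longrightarrow> r i = 0; t + need e < m; \<And>v. v \<in> vars e \<Longrightarrow> r v \<le> B;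
     x = eval e w r; r' = r(t := r t + x)\<rbrakk>
     \<Longrightarrow> runs w m (cmp e t) (0, out, r) (tb e B) (0, out, r')"
proof (induction e arbitrary: t r B x r')
  case One
  have "r' = r(t := Suc (r t))" unfolding One.prems(5,6) by simp
  then show ?case unfolding cmp.simps tb.simps by (rule runs_incr'[rotated]) (use One.prems(3) in simp)
next
  case (Var v)
  have "runs w m (addv v t (t + 1)) (0, out, r) (B * 4 + 1 + (B * 3 + 1)) (0, out, r(t := r t + r v))"
    by (rule runs_addv) (use Var.prems(1-4) in auto)
  moreover have "r' = r(t := r t + r v)" unfolding Var.prems(6) Var.prems(5) by simp
  ultimately show ?case by (simp only: cmp.simps tb.simps)
next
  case (In a)
  let ?A = "eval a w r" and ?f = "\<lambda>j. (j, out, r(t + 1 := eval a w r - j))"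
  have A: "?A \<le> vb a B" by (rule eval_le_vb[OF assms]) (use In.prems(1-4) in auto)
  have 1: "runs w m (cmp a (t + 1)) (0, out, r) (tb a B) (?f 0)"
    by (rule In.IH[where x = ?A]) (use In.prems(1-4) in \<open>auto simp: less_Suc_eq\<close>)
  have 2: "runs w m (Loop (nz (t + 1)) (Seq (decr (t + 1)) (shift 0 Move_Right))) (?f 0) (vb a B * 3 + 1) (?f ?A)"
  proof (rule runs_weaken[OF runs_Loop[where f = ?f and n = ?A and T = "1 + 1"]])
    fix j assume "j < ?A"
    show "runs w m (Seq (decr (t + 1)) (shift 0 Move_Right)) (?f j) (1 + 1) (?f (Suc j))"
    proof (rule runs_Seq)
      show "runs w m (decr (t + 1)) (?f j) 1 (j, out, r(t + 1 := ?A - Suc j))"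
        by (rule runs_decr') (use In.prems(1-4) in auto)
      show "runs w m (shift 0 Move_Right) (j, out, r(t + 1 := ?A - Suc j)) 1 (?f (Suc j))"
        using runs_shift_input[of w m Move_Right j] by simp
    qed
  qed (use A In.prems(1-4) in auto)
  have f: "?f ?A = (?A, out, r)" using In.prems(2)[of "t + 1"] by (auto simp: fun_eq_iff)
  have 3: "runs w m (add_symbol t) (?A, out, r) 9 (?A, out, r')"
    unfolding In.prems(5,6) eval.simps
    by (rule runs_add_symbol) (use contents_le[OF assms] In.prems(1-4) in auto)
  have 4: "runs w m (Loop (\<lambda>s. s ! 0 \<noteq> 1) (shift 0 Move_Left)) (?A, out, r') (vb a B * 2 + 1) (0, out, r')"
    by (rule runs_rewind[OF assms A])
  show ?case unfolding cmp.simps tb.simps by (rule runs_Seq[OF 1 runs_Seq[OF 2[unfolded f] runs_Seq[OF 3 4]]])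
next
  case (Add a b)
  have b: "eval b w (r(t := r t + eval a w r)) = eval b w r"
    by (rule eval_cong) (use Add.prems(1) in auto)
  have 1: "runs w m (cmp a t) (0, out, r) (tb a B) (0, out, r(t := r t + eval a w r))"
    by (rule Add.IH(1)) (use Add.prems(1-4) in auto)
  have 2: "runs w m (cmp b t) (0, out, r(t := r t + eval a w r)) (tb b B) (0, out, r')"
  proof (rule Add.IH(2)[OF _ _ _ _ b[symmetric]])
    show "r' = (r(t := r t + eval a w r))(t := (r(t := r t + eval a w r)) t + eval b w r)"
      unfolding Add.prems(5,6) by (simp add: add.assoc)
  qed (use Add.prems(1-4) in auto)
  show ?case unfolding cmp.simps tb.simps by (rule runs_Seq[OF 1 2])
next
  case (Sub a b)
  let ?A = "eval a w r" and ?C = "eval b w r"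
  \<comment> \<open>Both operands are counted down together, so after \<open>?C\<close> rounds
    register \<open>t + 1\<close> holds the truncated difference.\<close>
  let ?f = "\<lambda>j. (0, out, r(t + 1 := ?A - j, t + 2 := ?C - j))"
  have A: "?A \<le> vb a B" by (rule eval_le_vb[OF assms]) (use Sub.prems(1-4) in auto)
  have C: "?C \<le> vb b B" by (rule eval_le_vb[OF assms]) (use Sub.prems(1-4) in auto)
  have b: "eval b w (r(t + 1 := ?A)) = ?C"
    by (rule eval_cong) (use Sub.prems(1) in fastforce)
  have 1: "runs w m (cmp a (t + 1)) (0, out, r) (tb a B) (0, out, r(t + 1 := ?A))"
    by (rule Sub.IH(1)) (use Sub.prems(1-4) in \<open>auto simp: less_Suc_eq\<close>)
  have 2: "runs w m (cmp b (t + 2)) (0, out, r(t + 1 := ?A)) (tb b B) (?f 0)"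
  proof (rule Sub.IH(2)[OF _ _ _ _ b[symmetric]])
    show "r(t + 1 := ?A - 0, t + 2 := ?C - 0) = (r(t + 1 := ?A))(t + 2 := (r(t + 1 := ?A)) (t + 2) + ?C)"
      using Sub.prems(2)[of "t + 2"] by simp
    fix v assume "v \<in> vars b"
    then show "v < t + 2" "(r(t + 1 := ?A)) v \<le> B" using Sub.prems(1,4)[of v] by auto
  qed (use Sub.prems(2,3) in auto)
  have 3: "runs w m (Loop (nz (t + 2)) (Seq (decr (t + 2)) (decr (t + 1)))) (?f 0) (vb b B * 3 + 1) (?f ?C)"
  proof (rule runs_weaken[OF runs_Loop[where f = ?f and n = ?C and T = "1 + 1"]])
    fix j assume "j < ?C"
    show "runs w m (Seq (decr (t + 2)) (decr (t + 1))) (?f j) (1 + 1) (?f (Suc j))"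
    proof (rule runs_Seq)
      show "runs w m (decr (t + 2)) (?f j) 1 (0, out, r(t + 1 := ?A - j, t + 2 := ?C - Suc j))"
        by (rule runs_decr') (use Sub.prems(1-4) in auto)
      show "runs w m (decr (t + 1)) (0, out, r(t + 1 := ?A - j, t + 2 := ?C - Suc j)) 1 (?f (Suc j))"
        by (rule runs_decr') (use Sub.prems(1-4) in \<open>auto simp: fun_eq_iff\<close>)
    qed
  qed (use C Sub.prems(1-4) in auto)
  have 4: "runs w m (mover (t + 1) t) (?f ?C) (vb a B * 3 + 1) (0, out, r')"
  proof (rule runs_mover')
    show "r' = (r(t + 1 := ?A - ?C, t + 2 := ?C - ?C))(t + 1 := 0, t := (r(t + 1 := ?A - ?C, t + 2 := ?C - ?C)) t + (r(t + 1 := ?A - ?C, t + 2 := ?C - ?C)) (t + 1))"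
      unfolding Sub.prems(5,6) eval.simps using Sub.prems(2)[of "t + 1"] Sub.prems(2)[of "t + 2"] by (simp add: fun_eq_iff)
  qed (use A Sub.prems(3) in auto)
  show ?case unfolding cmp.simps tb.simps by (rule runs_Seq[OF 1 runs_Seq[OF 2 runs_Seq[OF 3 4]]])
next
  case (Sum v a b)
  let ?A = "eval a w r" and ?B = "B + vb a B"
  define S where "S j = (\<Sum>i<j. eval b w (r(v := i)))" for j
  \<comment> \<open>The registers before round \<open>j\<close>: remaining rounds in
    \<open>t + 1\<close>, the summation variable equal to \<open>j\<close>, its former value in
    \<open>t + 2\<close>, and the partial sum added to \<open>t\<close>.\<close>
  define f where "f j = r(t + 1 := ?A - j, v := j, t + 2 := r v, t := r t + S j)" for j
  have A: "?A \<le> vb a B" by (rule eval_le_vb[OF assms]) (use Sum.prems(1-4) in auto)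
  have v: "v < t" using Sum.prems(1-4) by auto
  have 1: "runs w m (cmp a (t + 1)) (0, out, r) (tb a B) (0, out, r(t + 1 := ?A))"
    by (rule Sum.IH(1)) (use Sum.prems(1-4) in \<open>auto simp: less_Suc_eq\<close>)
  have 2: "runs w m (mover v (t + 2)) (0, out, r(t + 1 := ?A)) (B * 3 + 1) (0, out, f 0)"
  proof (rule runs_mover')
    show "f 0 = (r(t + 1 := ?A))(v := 0, t + 2 := (r(t + 1 := ?A)) (t + 2) + (r(t + 1 := ?A)) v)"
      using v Sum.prems(2)[of "t + 2"] by (simp add: f_def S_def fun_eq_iff)
  qed (use Sum.prems(3,4) v in auto)
  have 3: "runs w m (Loop (nz (t + 1)) (Seq (decr (t + 1)) (Seq (cmp b (t + 3)) (Seq (mover (t + 3) t) (incr v)))))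
     ((\<lambda>j. (0, out, f j)) 0) (vb a B * Suc (1 + (tb b ?B + ((vb b ?B * 3 + 1) + 1))) + 1) ((\<lambda>j. (0, out, f j)) ?A)"
  proof (rule runs_weaken[OF runs_Loop[where f = "\<lambda>j. (0, out, f j)" and n = ?A and T = "1 + (tb b ?B + ((vb b ?B * 3 + 1) + 1))"]])
    fix j assume j: "j < ?A"
    let ?r1 = "(f j)(t + 1 := ?A - Suc j)" and ?v = "eval b w (r(v := j))"
    have ev: "eval b w ?r1 = ?v"
      by (rule eval_cong) (use Sum.prems(1) in \<open>fastforce simp: f_def\<close>)
    have le: "?v \<le> vb b ?B"
      by (rule eval_le_vb[OF assms]) (use Sum.prems(1-4) j A in \<open>auto simp: trans_le_add1\<close>)
    show "runs w m (Seq (decr (t + 1)) (Seq (cmp b (t + 3)) (Seq (mover (t + 3) t) (incr v))))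
       (0, out, f j) (1 + (tb b ?B + ((vb b ?B * 3 + 1) + 1))) (0, out, f (Suc j))"
    proof (intro runs_Seq)
      show "runs w m (decr (t + 1)) (0, out, f j) 1 (0, out, ?r1)"
        by (rule runs_decr') (use Sum.prems(3) v in \<open>simp_all add: f_def\<close>)
      show "runs w m (cmp b (t + 3)) (0, out, ?r1) (tb b ?B) (0, out, ?r1(t + 3 := ?v))"
      proof (rule Sum.IH(2)[OF _ _ _ _ ev[symmetric]])
        show "?r1(t + 3 := ?v) = ?r1(t + 3 := ?r1 (t + 3) + ?v)"
          using v Sum.prems(2)[of "t + 3"] by (simp add: f_def)
        fix u assume "u \<in> vars b"
        then show "u < t + 3" "?r1 u \<le> ?B"
          using Sum.prems(1,4)[of u] j A by (auto simp: f_def trans_le_add1)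
      qed (use Sum.prems(2,3) v in \<open>auto simp: f_def\<close>)
      show "runs w m (mover (t + 3) t) (0, out, ?r1(t + 3 := ?v)) (vb b ?B * 3 + 1)
          (0, out, (f (Suc j))(v := j))"
      proof (rule runs_mover')
        show "(f (Suc j))(v := j) = (?r1(t + 3 := ?v))(t + 3 := 0, t := (?r1(t + 3 := ?v)) t + (?r1(t + 3 := ?v)) (t + 3))"
          using v Sum.prems(2)[of "t + 3"] by (simp add: f_def S_def fun_eq_iff)
      qed (use Sum.prems(3) le in auto)
      show "runs w m (incr v) (0, out, (f (Suc j))(v := j)) 1 (0, out, f (Suc j))"
        by (rule runs_incr') (use Sum.prems(3) v in \<open>simp_all add: fun_eq_iff f_def\<close>)
    qed
  qed (use A Sum.prems(3) v in \<open>auto simp: f_def simp del: mult_Suc_right\<close>)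
  have 4: "runs w m (clear v) (0, out, f ?A) (vb a B * 2 + 1) (0, out, (f ?A)(v := 0))"
    by (rule runs_clear') (use Sum.prems(3) v A in \<open>simp_all add: f_def\<close>)
  have 5: "runs w m (mover (t + 2) v) (0, out, (f ?A)(v := 0)) (B * 3 + 1) (0, out, r')"
  proof (rule runs_mover')
    show "r' = (f ?A)(v := 0, t + 2 := 0, v := ((f ?A)(v := 0)) v + ((f ?A)(v := 0)) (t + 2))"
      unfolding Sum.prems(5,6) eval.simps
      using v Sum.prems(2)[of "t + 1"] Sum.prems(2)[of "t + 2"] by (simp add: f_def S_def fun_eq_iff)
  qed (use Sum.prems(3,4) v in \<open>simp_all add: f_def\<close>)
  show ?case unfolding cmp.simps tb.simps
    by (rule runs_Seq[OF 1 runs_Seq[OF 2 runs_Seq[OF 3 runs_Seq[OF 4 5]]]])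
qed


section \<open>Polynomial growth of the bounds\<close>

definition polybd :: "(nat \<Rightarrow> nat) \<Rightarrow> bool" where
  "polybd f \<longleftrightarrow> (\<exists>p :: nat poly. \<forall>n. f n \<le> poly p n)"

text \<open>Natural coefficients make polynomials monotone; bounds can therefore be substituted into
  each other and enlarged along with their argument.\<close>

lemma poly_nat_mono: "x \<le> y \<Longrightarrow> poly (p :: nat poly) x \<le> poly p y"
  by (induction p) (auto intro!: add_mono mult_mono)

lemma polybd_const: "polybd (\<lambda>n. c)"
  unfolding polybd_def by (rule exI[of _ "[:c:]"]) simp

lemma polybd_id: "polybd (\<lambda>n. n)"
  unfolding polybd_def by (rule exI[of _ "[:0, 1:]"]) simp

lemma polybd_add:
  assumes "polybd f" "polybd g"
  shows "polybd (\<lambda>n. f n + g n)"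
proof -
  obtain p q where "\<forall>n. f n \<le> poly p n" "\<forall>n. g n \<le> poly q n"
    using assms unfolding polybd_def by blast
  then have "\<forall>n. f n + g n \<le> poly (p + q) n" by (simp add: add_mono)
  then show ?thesis unfolding polybd_def by blast
qed

lemma polybd_mult:
  assumes "polybd f" "polybd g"
  shows "polybd (\<lambda>n. f n * g n)"
proof -
  obtain p q where "\<forall>n. f n \<le> poly p n" "\<forall>n. g n \<le> poly q n"
    using assms unfolding polybd_def by blast
  then have "\<forall>n. f n * g n \<le> poly (p * q) n" by (simp add: mult_mono)
  then show ?thesis unfolding polybd_def by blast
qed

lemma polybd_compose:
  assumes "polybd f" "polybd g"
  shows "polybd (\<lambda>n. f (g n))"
proof -
  obtain p q where p: "\<forall>n. f n \<le> poly p n" and q: "\<forall>n. g n \<le> poly q n"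
    using assms unfolding polybd_def by blast
  have "f (g n) \<le> poly (pcompose p q) n" for n
    using p[rule_format, of "g n"] poly_nat_mono[OF q[rule_format, of n], of p]
    by (simp add: poly_pcompose)
  then show ?thesis unfolding polybd_def by blast
qed

lemma polybd_Suc: "polybd f \<Longrightarrow> polybd (\<lambda>n. Suc (f n))"
  using polybd_add[OF _ polybd_const[of 1]] by simp

lemmas polybd_intros = polybd_const polybd_id polybd_Suc polybd_add polybd_mult

lemma polybd_vb: "polybd (vb e)"
proof (induction e)
  case One
  have "vb One = (\<lambda>B. 1)" by (simp add: fun_eq_iff)
  then show ?case by (simp only:) (intro polybd_intros)
next
  case (Var v)
  have "vb (Var v) = (\<lambda>B. B)" by (simp add: fun_eq_iff)
  then show ?case by (simp only:) (intro polybd_intros)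
next
  case (In a)
  have "vb (In a) = (\<lambda>B. 4)" by (simp add: fun_eq_iff)
  then show ?case by (simp only:) (intro polybd_intros)
next
  case (Add a b)
  have "vb (Add a b) = (\<lambda>B. vb a B + vb b B)" by (simp add: fun_eq_iff)
  then show ?case by (simp only:) (intro polybd_intros Add.IH)
next
  case (Sub a b)
  have "vb (Sub a b) = vb a" by (simp add: fun_eq_iff)
  then show ?case using Sub.IH by simp
next
  case (Sum v a b)
  have "polybd (\<lambda>B. vb b (B + vb a B))"
    by (rule polybd_compose[OF Sum.IH(2)]) (intro polybd_intros Sum.IH)
  moreover have "vb (Sum v a b) = (\<lambda>B. vb a B * vb b (B + vb a B))" by (simp add: fun_eq_iff)
  ultimately show ?case by (simp only:) (intro polybd_intros Sum.IH)
qed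

lemma polybd_tb: "polybd (tb e)"
proof (induction e)
  case One
  have "tb One = (\<lambda>B. 1)" by (simp add: fun_eq_iff)
  then show ?case by (simp only:) (intro polybd_intros)
next
  case (Var v)
  have "tb (Var v) = (\<lambda>B. B * 4 + 1 + (B * 3 + 1))" by (simp add: fun_eq_iff)
  then show ?case by (simp only:) (intro polybd_intros)
next
  case (In a)
  have "tb (In a) = (\<lambda>B. tb a B + ((vb a B * 3 + 1) + (9 + (vb a B * 2 + 1))))" by (simp add: fun_eq_iff)
  then show ?case by (simp only:) (intro polybd_intros polybd_vb In.IH)
next
  case (Add a b)
  have "tb (Add a b) = (\<lambda>B. tb a B + tb b B)" by (simp add: fun_eq_iff)
  then show ?case by (simp only:) (intro polybd_intros Add.IH)
next
  case (Sub a b)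
  have "tb (Sub a b) = (\<lambda>B. tb a B + (tb b B + ((vb b B * 3 + 1) + (vb a B * 3 + 1))))" by (simp add: fun_eq_iff)
  then show ?case by (simp only:) (intro polybd_intros polybd_vb Sub.IH)
next
  case (Sum v a b)
  have *: "polybd (\<lambda>B. B + vb a B)" by (intro polybd_intros polybd_vb)
  have "polybd (\<lambda>B. tb b (B + vb a B))" "polybd (\<lambda>B. vb b (B + vb a B))"
    by (rule polybd_compose[OF Sum.IH(2) *], rule polybd_compose[OF polybd_vb *])
  moreover have "tb (Sum v a b) = (\<lambda>B. tb a B + ((B * 3 + 1) +
    ((vb a B * Suc (1 + (tb b (B + vb a B) + ((vb b (B + vb a B) * 3 + 1) + 1))) + 1) +
      ((vb a B * 2 + 1) + (B * 3 + 1)))))" by (simp add: fun_eq_iff)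
  ultimately show ?case by (simp only:) (intro polybd_intros polybd_vb Sum.IH)
qed

section \<open>Functions computable in polynomial time\<close>

text \<open>Register 0 holds the input length and register 1 the index of the output bit under
  computation; all other variables start at 0.\<close>

definition env :: "nat list \<Rightarrow> nat \<Rightarrow> nat \<Rightarrow> nat" where
  "env w i = (\<lambda>_. 0)(0 := length w, 1 := i)"

text \<open>Every output bit is computed afresh from its index, so nothing but registers has to be
  stored between bits.\<close>

definition out_bits :: "ex \<Rightarrow> ex \<Rightarrow> nat list \<Rightarrow> bool list" where
  "out_bits el eb w = map (\<lambda>i. eval eb w (env w i) \<noteq> 0) [0..<eval el w (env w 0)]"

definition length_prog :: prog where
  "length_prog = Seq (shift 0 Move_Right)
     (Seq (Loop (\<lambda>s. s ! 0 \<noteq> 0) (Seq (shift 0 Move_Right) (incr 0)))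
       (Loop (\<lambda>s. s ! 0 \<noteq> 1) (shift 0 Move_Left)))"

text \<open>Register \<open>c\<close> counts the bits still to be written, register 1 those already
  written. The value goes to \<open>c + 1\<close>, which is cleared because \<open>cmp\<close>
  expects zero scratch registers in the next round.\<close>

definition emit_prog :: "ex \<Rightarrow> nat \<Rightarrow> prog" where
  "emit_prog eb c = Seq (decr c) (Seq (cmp eb (c + 1))
     (Seq (Cond (nz (c + 1)) (emit 3) (emit 2)) (Seq (clear (c + 1)) (incr 1))))"

definition main_prog :: "ex \<Rightarrow> ex \<Rightarrow> nat \<Rightarrow> prog" where
  "main_prog el eb c = Seq length_prog (Seq (cmp el c) (Loop (nz c) (emit_prog eb c)))"

lemma runs_length_prog:
  assumes "set w \<subseteq> {2, 3, 4}" "0 < m"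
  shows "runs w m length_prog (0, [], \<lambda>_. 0) (1 + ((length w * 3 + 1) + (Suc (length w) * 2 + 1)))
    (0, [], env w 0)"
proof -
  let ?f = "\<lambda>j. (Suc j, [], (\<lambda>_. 0)(0 := j))"
  have 1: "runs w m (shift 0 Move_Right) (0, [], \<lambda>_. 0) 1 (?f 0)"
    using runs_shift_input[of w m Move_Right 0 "[]" "\<lambda>_. 0"] by (simp add: fun_upd_idem)
  have nonblank: "contents w (Suc j) \<noteq> 0" if "j < length w" for j
    using subsetD[OF assms(1) nth_mem[OF that]] that by (auto simp: contents_def)
  have 2: "runs w m (Loop (\<lambda>s. s ! 0 \<noteq> 0) (Seq (shift 0 Move_Right) (incr 0))) (?f 0)
      (length w * Suc (1 + 1) + 1) (?f (length w))"
  proof (rule runs_Loop[where f = ?f and n = "length w" and T = "1 + 1"])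
    fix j
    show "runs w m (Seq (shift 0 Move_Right) (incr 0)) (?f j) (1 + 1) (?f (Suc j))"
    proof (rule runs_Seq)
      show "runs w m (shift 0 Move_Right) (?f j) 1 (Suc (Suc j), [], (\<lambda>_. 0)(0 := j))"
        using runs_shift_input[of w m Move_Right "Suc j"] by simp
      show "runs w m (incr 0) (Suc (Suc j), [], (\<lambda>_. 0)(0 := j)) 1 (?f (Suc j))"
        by (rule runs_incr') (use assms in auto)
    qed
  qed (use nonblank in \<open>auto simp: contents_def\<close>)
  have 3: "runs w m (Loop (\<lambda>s. s ! 0 \<noteq> 1) (shift 0 Move_Left)) (?f (length w)) (Suc (length w) * 2 + 1)
      (0, [], (\<lambda>_. 0)(0 := length w))"
    by (rule runs_rewind[OF assms(1)]) simp
  have "env w 0 = (\<lambda>_. 0)(0 := length w)" by (auto simp: env_def)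
  with runs_Seq[OF 1 runs_Seq[OF 2 3]] show ?thesis unfolding length_prog_def
    by (auto elim!: runs_weaken)
qed

lemma runs_emit_prog:
  assumes w: "set w \<subseteq> {2, 3, 4}"
    and "vars eb \<subseteq> {..<c}" "1 < c" "c + need eb + 1 < m" "length w \<le> B" "i \<le> B"
  shows "runs w m (emit_prog eb c) (0, out, (env w i)(c := Suc n))
    (1 + (tb eb B + (2 + ((vb eb B * 2 + 1) + 1))))
    (0, out @ [if eval eb w (env w i) \<noteq> 0 then 3 else 2], (env w (Suc i))(c := n))"
proof -
  let ?v = "eval eb w (env w i)" and ?b = "if eval eb w (env w i) \<noteq> 0 then 3 else 2"
  let ?r = "(env w i)(c := n)"
  have ev: "eval eb w ?r = ?v" by (rule eval_cong) (use assms in auto)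
  have le: "?v \<le> vb eb B"
    by (rule eval_le_vb[OF w]) (use assms in \<open>auto simp: env_def\<close>)
  have 1: "runs w m (decr c) (0, out, (env w i)(c := Suc n)) 1 (0, out, ?r)"
    by (rule runs_decr') (use assms in auto)
  have 2: "runs w m (cmp eb (c + 1)) (0, out, ?r) (tb eb B) (0, out, ?r(c + 1 := ?v))"
  proof (rule runs_cmp[OF w _ _ _ _ ev[symmetric]])
    fix v assume "v \<in> vars eb"
    then show "v < c + 1" "?r v \<le> B" using assms by (auto simp: env_def)
  qed (use assms in \<open>auto simp: env_def\<close>)
  have 3: "runs w m (Cond (nz (c + 1)) (emit 3) (emit 2)) (0, out, ?r(c + 1 := ?v)) (Suc 1)
      (0, out @ [?b], ?r(c + 1 := ?v))"
    by (rule runs_Cond) (use assms runs_emit in auto)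
  have 4: "runs w m (clear (c + 1)) (0, out @ [?b], ?r(c + 1 := ?v)) (vb eb B * 2 + 1) (0, out @ [?b], ?r)"
    by (rule runs_clear') (use assms le in \<open>auto simp: fun_eq_iff env_def\<close>)
  have 5: "runs w m (incr 1) (0, out @ [?b], ?r) 1 (0, out @ [?b], (env w (Suc i))(c := n))"
    by (rule runs_incr') (use assms in \<open>auto simp: fun_eq_iff env_def\<close>)
  show ?thesis unfolding emit_prog_def
    using runs_Seq[OF 1 runs_Seq[OF 2 runs_Seq[OF 3 runs_Seq[OF 4 5]]]]
    by (simp only: Suc_1)
qed

definition main_time :: "ex \<Rightarrow> ex \<Rightarrow> nat \<Rightarrow> nat" where
  "main_time el eb B = (1 + ((B * 3 + 1) + (Suc B * 2 + 1))) +
     (tb el B + (vb el B * Suc (1 + (tb eb (B + vb el B) + (2 + ((vb eb (B + vb el B) * 2 + 1) + 1)))) + 1))"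

lemma polybd_main_time: "polybd (main_time el eb)"
proof -
  have *: "polybd (\<lambda>B. B + vb el B)" by (intro polybd_intros polybd_vb)
  have "polybd (\<lambda>B. tb eb (B + vb el B))" "polybd (\<lambda>B. vb eb (B + vb el B))"
    by (rule polybd_compose[OF polybd_tb *], rule polybd_compose[OF polybd_vb *])
  then have "polybd (\<lambda>B. main_time el eb B)"
    unfolding main_time_def by (intro polybd_intros polybd_vb polybd_tb)
  then show ?thesis .
qed

lemma runs_main_prog:
  assumes w: "set w \<subseteq> {2, 3, 4}"
    and "vars el \<subseteq> {..<c}" "vars eb \<subseteq> {..<c}" "1 < c" "c + need el + need eb + 1 < m"
  shows "\<exists>r. runs w m (main_prog el eb c) (0, [], \<lambda>_. 0) (main_time el eb (length w))
    (0, bits (out_bits el eb w), r)"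
proof -
  let ?n = "length w" and ?L = "eval el w (env w 0)"
  let ?B = "?n + vb el ?n"
  let ?f = "\<lambda>j. (0, map (\<lambda>i. if eval eb w (env w i) \<noteq> 0 then 3 else 2) [0..<j], (env w j)(c := ?L - j))"
  have L: "?L \<le> vb el ?n"
    by (rule eval_le_vb[OF w]) (use assms in \<open>auto simp: env_def\<close>)
  have 1: "runs w m length_prog (0, [], \<lambda>_. 0) (1 + ((length w * 3 + 1) + (Suc (length w) * 2 + 1))) (0, [], env w 0)"
    by (rule runs_length_prog) (use assms in auto)
  have 2: "runs w m (cmp el c) (0, [], env w 0) (tb el ?n) (0, [], (env w 0)(c := ?L))"
    by (rule runs_cmp[OF w _ _ _ _ refl]) (use assms in \<open>auto simp: env_def\<close>)
  have 3: "runs w m (Loop (nz c) (emit_prog eb c)) (?f 0)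
     (?L * Suc (1 + (tb eb ?B + (2 + ((vb eb ?B * 2 + 1) + 1)))) + 1) (?f ?L)"
  proof (rule runs_Loop[where f = ?f and n = ?L and T = "1 + (tb eb ?B + (2 + ((vb eb ?B * 2 + 1) + 1)))"])
    fix j assume j: "j < ?L"
    then have "?L - j = Suc (?L - Suc j)" by simp
    with runs_emit_prog[OF w, of eb c m ?B j "map (\<lambda>i. if eval eb w (env w i) \<noteq> 0 then 3 else 2) [0..<j]" "?L - Suc j"] assms L j
    show "runs w m (emit_prog eb c) (?f j) (1 + (tb eb ?B + (2 + ((vb eb ?B * 2 + 1) + 1)))) (?f (Suc j))"
      by simp
  qed (use assms in auto)
  have "?L * Suc (1 + (tb eb ?B + (2 + ((vb eb ?B * 2 + 1) + 1)))) + 1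
      \<le> vb el ?n * Suc (1 + (tb eb ?B + (2 + ((vb eb ?B * 2 + 1) + 1)))) + 1"
    using L by (intro add_mono mult_mono) auto
  then have 4: "runs w m (Loop (nz c) (emit_prog eb c)) (0, [], (env w 0)(c := ?L))
     (vb el ?n * Suc (1 + (tb eb ?B + (2 + ((vb eb ?B * 2 + 1) + 1)))) + 1) (?f ?L)"
    using runs_weaken[OF 3] by simp
  have "map (\<lambda>i. if eval eb w (env w i) \<noteq> 0 then 3 else 2) [0..<?L] = bits (out_bits el eb w)"
    by (simp add: bits_def out_bits_def)
  with runs_Seq[OF 1 runs_Seq[OF 2 4]] show ?thesis
    unfolding main_prog_def main_time_def by auto
qed

lemma acts_ok_incr: "acts_ok k (incr i)" "acts_ok k (decr i)"
  by (simp_all only: incr_def decr_def acts_ok_shift)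

lemma acts_ok_idle: "acts_ok k (Act idle)"
  by (simp add: idle_ok)

lemma acts_ok_cmp: "acts_ok k (cmp e t)"
proof (induction e arbitrary: t)
qed (simp_all add: acts_ok_incr acts_ok_shift acts_ok_idle addv_def mover_def clear_def add_symbol_def
    del: acts_ok.simps(1))

lemma acts_ok_main: "acts_ok k (Seq (shift 1 Move_Right) (main_prog el eb c))"
  by (simp add: acts_ok_incr acts_ok_shift acts_ok_emit acts_ok_cmp main_prog_def length_prog_def emit_prog_def clear_def
    del: acts_ok.simps(1))

theorem out_bits_computable:
  "\<exists>M (p :: nat poly). tm_wf M \<and> (\<forall>w. set w \<subseteq> {2, 3, 4} \<longrightarrow>
     outputs_within M w (bits (out_bits el eb w)) (poly p (length w)))"
proof -
  \<comment> \<open>All variables lie below \<open>c\<close>. Inserting 0 and adding 2 also keeps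
    \<open>c\<close> apart from registers 0 and 1, which hold length and index.\<close>
  define c where "c = Suc (Suc (Max (insert 0 (vars el \<union> vars eb))))"
  define m where "m = c + need el + need eb + 2"
  define P where "P = Seq (shift 1 Move_Right) (main_prog el eb c)"
  define M where "M = prog_tm (m + 2) P"
  obtain p where p: "\<And>n. main_time el eb n \<le> poly p n"
    using polybd_main_time unfolding polybd_def by blast
  have vars: "v < c" if "v \<in> vars el \<union> vars eb" for v
  proof -
    have "v \<le> Max (insert 0 (vars el \<union> vars eb))" using that by (intro Max_ge) auto
    then show ?thesis by (simp add: c_def)
  qed
  have "tm_wf M" unfolding M_def P_def by (rule prog_tm_wf[OF acts_ok_main]) simp
  moreover have "outputs_within M w (bits (out_bits el eb w)) (poly (p + 1) (length w))" if w: "set w \<subseteq> {2, 3, 4}" for w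
  proof -
    obtain r where "runs w m (main_prog el eb c) (0, [], \<lambda>_. 0) (main_time el eb (length w)) (0, bits (out_bits el eb w), r)"
      using runs_main_prog[OF w, of el c eb m] vars by (auto simp: m_def c_def)
    then obtain t where t: "t \<le> main_time el eb (length w)"
      "exec (main_prog el eb c) (conf w m (0, [], \<lambda>_. 0)) t (conf w m (0, bits (out_bits el eb w), r))"
      unfolding runs_def by blast
    \<comment> \<open>Initially the output head stands on the end marker. One step moves it to the
      first blank cell, as \<open>conf\<close> demands; it is the summand 1 in the time
      bound.\<close>
    let ?ts = "(contents w, 0) # replicate (m + 1) (contents [], 0)"
    have ts: "map (\<lambda>i. if i = 1 then (fst (?ts ! i), move_head Move_Right (snd (?ts ! i))) else ?ts ! i) [0..<length ?ts]
       = conf w m (0, [], \<lambda>_. 0)"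
      by (rule conf_eqI) (auto simp del: upt_Suc replicate_Suc)
    have "exec (shift 1 Move_Right) ?ts 1 (conf w m (0, [], \<lambda>_. 0))"
      using exec_shift[of 1 Move_Right ?ts] unfolding ts .
    then have "exec P ?ts (1 + t) (conf w m (0, bits (out_bits el eb w), r))"
      unfolding P_def by (rule exec_Seq[OF _ t(2)])
    then have "(step M ^^ (1 + t)) (init M w) = (sz P, conf w m (0, bits (out_bits el eb w), r))"
      unfolding M_def using exec_step[of P ?ts "1 + t" _ "m + 2"] by (simp add: init_def prog_tm_def)
    moreover have "states M = sz P" by (simp add: M_def prog_tm_def)
    moreover have "1 + t \<le> poly (p + 1) (length w)" using t(1) p[of "length w"] by simp
    ultimately show ?thesis unfolding outputs_within_def
      by (intro exI[of _ "1 + t"]) simp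
  qed
  ultimately show ?thesis by blast
qed

section \<open>Derived operations\<close>

definition fresh :: "ex \<Rightarrow> ex \<Rightarrow> nat" where
  "fresh a b = Suc (Max (insert 0 (vars a \<union> vars b)))"

lemma eval_fresh [simp]:
  "eval a w (r(fresh a b := i)) = eval a w r" "eval b w (r(fresh a b := i)) = eval b w r"
proof -
  have "v < fresh a b" if "v \<in> vars a \<union> vars b" for v
    unfolding fresh_def less_Suc_eq_le using that by (intro Max_ge) auto
  then show "eval a w (r(fresh a b := i)) = eval a w r" "eval b w (r(fresh a b := i)) = eval b w r"
    by (intro eval_cong; force)+
qed

definition holds :: "ex \<Rightarrow> nat list \<Rightarrow> (nat \<Rightarrow> nat) \<Rightarrow> bool" where
  "holds e w r \<longleftrightarrow> eval e w r \<noteq> 0"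

definition Zero :: ex where "Zero = Sub One One"

fun Num :: "nat \<Rightarrow> ex" where
  "Num 0 = Zero"
| "Num (Suc n) = Add (Num n) One"

definition Mul :: "ex \<Rightarrow> ex \<Rightarrow> ex" where "Mul a b = Sum (fresh a b) a b"
definition Less :: "ex \<Rightarrow> ex \<Rightarrow> ex" where "Less a b = Sub b a"
definition Not :: "ex \<Rightarrow> ex" where "Not a = Sub One a"
definition Eq :: "ex \<Rightarrow> ex \<Rightarrow> ex" where "Eq a b = Sub One (Add (Sub a b) (Sub b a))"
definition And :: "ex \<Rightarrow> ex \<Rightarrow> ex" where "And a b = Mul a b"
definition Or :: "ex \<Rightarrow> ex \<Rightarrow> ex" where "Or a b = Add a b"
definition Imp :: "ex \<Rightarrow> ex \<Rightarrow> ex" where "Imp a b = Or (Not a) b"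
definition All :: "nat \<Rightarrow> ex \<Rightarrow> ex \<Rightarrow> ex" where "All v a b = Not (Sum v a (Not b))"
definition Exi :: "nat \<Rightarrow> ex \<Rightarrow> ex \<Rightarrow> ex" where "Exi v a b = Sum v a b"
text \<open>Normalises to 0 or 1. Compound formulas may evaluate to larger numbers, which would
  spoil a count of truth values by \<open>Sum\<close>.\<close>

definition Truth :: "ex \<Rightarrow> ex" where "Truth a = Not (Not a)"
text \<open>The quotient is the number of \<open>i < a\<close> with (i + 1) * b \<le> a; for
  positive \<open>b\<close> no larger \<open>i\<close> can qualify.\<close>

definition Div :: "ex \<Rightarrow> ex \<Rightarrow> ex" where
  "Div a b = Sum (fresh a b) a (Not (Less a (Mul (Add (Var (fresh a b)) One) b)))"
definition Mod :: "ex \<Rightarrow> ex \<Rightarrow> ex" where "Mod a b = Sub a (Mul b (Div a b))"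
text \<open>A let-binding as a sum: among the values of \<open>v\<close> up to \<open>a\<close>,
  only the one equal to \<open>a\<close> contributes.\<close>

definition Bind :: "nat \<Rightarrow> ex \<Rightarrow> ex \<Rightarrow> ex" where
  "Bind v a b = Sum v (Add a One) (Mul (Eq (Var v) a) b)"
definition Ors :: "ex list \<Rightarrow> ex" where "Ors es = foldr Or es Zero"
definition Pol :: "nat poly \<Rightarrow> ex \<Rightarrow> ex" where
  "Pol p e = foldr (\<lambda>c acc. Add (Num c) (Mul e acc)) (coeffs p) Zero"

lemma eval_Zero [simp]: "eval Zero w r = 0"
  by (simp add: Zero_def)

lemma eval_Num [simp]: "eval (Num n) w r = n"
  by (induction n) auto

lemma eval_Mul [simp]: "eval (Mul a b) w r = eval a w r * eval b w r"
  by (simp add: Mul_def)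

lemma eval_Eq [simp]: "eval (Eq a b) w r = of_bool (eval a w r = eval b w r)"
  by (simp add: Eq_def)

lemma holds_simps [simp]:
  "holds (Less a b) w r \<longleftrightarrow> eval a w r < eval b w r"
  "holds (Not a) w r \<longleftrightarrow> \<not> holds a w r"
  "holds (Eq a b) w r \<longleftrightarrow> eval a w r = eval b w r"
  "holds (And a b) w r \<longleftrightarrow> holds a w r \<and> holds b w r"
  "holds (Or a b) w r \<longleftrightarrow> holds a w r \<or> holds b w r"
  "holds (Imp a b) w r \<longleftrightarrow> (holds a w r \<longrightarrow> holds b w r)"
  "holds (All v a b) w r \<longleftrightarrow> (\<forall>i < eval a w r. holds b w (r(v := i)))"
  "holds (Exi v a b) w r \<longleftrightarrow> (\<exists>i < eval a w r. holds b w (r(v := i)))"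
  "holds (Ors es) w r \<longleftrightarrow> (\<exists>e \<in> set es. holds e w r)"
  "holds Zero w r \<longleftrightarrow> False"
  "holds One w r \<longleftrightarrow> True"
proof -
  show "holds (All v a b) w r \<longleftrightarrow> (\<forall>i < eval a w r. holds b w (r(v := i)))"
    by (auto simp: holds_def All_def Not_def not_le sum_eq_0_iff Suc_le_eq)
  show "holds (Ors es) w r \<longleftrightarrow> (\<exists>e \<in> set es. holds e w r)"
    by (induction es) (auto simp: holds_def Ors_def Or_def)
qed (auto simp: holds_def Less_def Not_def And_def Or_def Imp_def Exi_def)

lemma eval_Not: "eval (Not a) w r = of_bool (\<not> holds a w r)"
  by (auto simp: Not_def holds_def)

lemma eval_Truth [simp]: "eval (Truth a) w r = of_bool (holds a w r)"
  by (simp add: Truth_def eval_Not)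

lemma eval_Div [simp]:
  assumes "0 < eval b w r"
  shows "eval (Div a b) w r = eval a w r div eval b w r"
proof -
  let ?a = "eval a w r" and ?b = "eval b w r"
  have "eval (Div a b) w r = (\<Sum>i<?a. of_bool (Suc i * ?b \<le> ?a))"
    by (simp add: Div_def eval_Not not_less)
  also have "\<dots> = card {i. i < ?a \<and> Suc i * ?b \<le> ?a}"
    by (simp add: sum.If_cases Collect_conj_eq lessThan_def of_bool_def)
  also have "{i. i < ?a \<and> Suc i * ?b \<le> ?a} = {..<?a div ?b}"
  proof (intro equalityI subsetI)
    fix i assume "i \<in> {i. i < ?a \<and> Suc i * ?b \<le> ?a}"
    then show "i \<in> {..<?a div ?b}"
      using assms by (simp add: less_eq_div_iff_mult_less_eq flip: Suc_le_eq)
  next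
    fix i assume "i \<in> {..<?a div ?b}"
    then have i: "Suc i * ?b \<le> ?a"
      using assms by (simp add: less_eq_div_iff_mult_less_eq flip: Suc_le_eq)
    moreover have "Suc i * 1 \<le> Suc i * ?b" using assms by (intro mult_le_mono2) simp
    ultimately show "i \<in> {i. i < ?a \<and> Suc i * ?b \<le> ?a}" by simp
  qed
  finally show ?thesis by simp
qed

lemma eval_Mod [simp]: "0 < eval b w r \<Longrightarrow> eval (Mod a b) w r = eval a w r mod eval b w r"
  by (simp add: Mod_def minus_mult_div_eq_mod)

lemma eval_Bind [simp]:
  assumes "\<And>i. eval a w (r(v := i)) = eval a w r"
  shows "eval (Bind v a b) w r = eval b w (r(v := eval a w r))"
proof -
  have "eval (Bind v a b) w r = (\<Sum>i<Suc (eval a w r). if i = eval a w r then eval b w (r(v := i)) else 0)"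
    unfolding Bind_def by (simp add: assms of_bool_def if_distrib[of "\<lambda>x. x * _"] cong: if_cong)
  also have "\<dots> = eval b w (r(v := eval a w r))" by (simp add: sum.delta)
  finally show ?thesis .
qed

lemma holds_Bind [simp]:
  assumes "\<And>i. eval a w (r(v := i)) = eval a w r"
  shows "holds (Bind v a b) w r \<longleftrightarrow> holds b w (r(v := eval a w r))"
  using assms by (simp add: holds_def)

lemma eval_Pol [simp]: "eval (Pol p e) w r = poly p (eval e w r)"
proof -
  have "eval (foldr (\<lambda>c acc. Add (Num c) (Mul e acc)) cs Zero) w r = poly (Poly cs) (eval e w r)" for cs
    by (induction cs) auto
  from this[of "coeffs p"] show ?thesis by (simp add: Pol_def)
qed

theorem poly_time_out_bits:
  "poly_time (\<lambda>x. out_bits el eb (bits x))"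
proof -
  obtain M p where M: "tm_wf M" "\<And>w. set w \<subseteq> {2, 3, 4} \<Longrightarrow>
     outputs_within M w (bits (out_bits el eb w)) (poly p (length w))"
    using out_bits_computable[of el eb] by blast
  have "set (bits x) \<subseteq> {2, 3, 4}" "length (bits x) = length x" for x by (auto simp: bits_def)
  then show ?thesis unfolding poly_time_def using M by metis
qed

theorem poly_time_verifier_holds:
  "poly_time_verifier (\<lambda>x y. holds e (bits x @ [4] @ bits y) (env (bits x @ [4] @ bits y) 0))"
proof -
  obtain M p where M: "tm_wf M" "\<And>w. set w \<subseteq> {2, 3, 4} \<Longrightarrow>
     outputs_within M w (bits (out_bits One e w)) (poly p (length w))"
    using out_bits_computable[of One e] by blast
  have w: "set (bits x @ [4] @ bits y) \<subseteq> {2, 3, 4}" for x y by (auto simp: bits_def)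
  have o: "out_bits One e w = [holds e w (env w 0)]" for w by (simp add: out_bits_def holds_def)
  \<comment> \<open>The separator makes the tape word one symbol longer than both inputs together,
    hence the substitution of 1 + n.\<close>
  have "poly p (length (bits x @ [4] @ bits y)) = poly (pcompose p [:1, 1:]) (length x + length y)" for x y
    by (simp add: bits_def poly_pcompose add.commute)
  with M(2)[OF w] have "outputs_within M (bits x @ [4] @ bits y)
      (bits [holds e (bits x @ [4] @ bits y) (env (bits x @ [4] @ bits y) 0)])
      (poly (pcompose p [:1, 1:]) (length x + length y))" for x y
    unfolding o by metis
  then show ?thesis unfolding poly_time_verifier_def using M(1) by blast
qed

section \<open>Alliances spanned by a tree\<close>

lemma deg_Un:
  assumes "finite X" "finite Y" "X \<inter> Y = {}"
  shows "deg E (X \<union> Y) v = deg E X v + deg E Y v"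
proof -
  have "{w \<in> X \<union> Y. {v, w} \<in> E} = {w \<in> X. {v, w} \<in> E} \<union> {w \<in> Y. {v, w} \<in> E}" by auto
  then show ?thesis using assms unfolding deg_def by (simp add: card_Un_disjoint disjoint_iff)
qed

lemma deg_pos_iff: "finite X \<Longrightarrow> 0 < deg E X v \<longleftrightarrow> (\<exists>w \<in> X. {v, w} \<in> E)"
  unfolding deg_def by (auto simp: card_gt_0_iff)

text \<open>Eliminates the outside degree through deg V = deg A + deg (V - A). In this form the
  condition at a fixed vertex is monotone in \<open>A\<close>, which underlies the greedy and the
  subset arguments.\<close>

lemma defensive_alliance_iff:
  assumes "finite V"
  shows "defensive_alliance V E A \<longleftrightarrow> A \<subseteq> V \<and> (\<forall>v \<in> A. deg E V v \<le> 2 * deg E A v + 1)"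
proof -
  have "deg E V v = deg E A v + deg E (V - A) v" if "A \<subseteq> V" for v
    using deg_Un[of A "V - A" E v] that assms by (auto simp: finite_subset Un_absorb1)
  then show ?thesis unfolding defensive_alliance_def by fastforce
qed

text \<open>\<open>degU\<close> fixes thresholds: a vertex of total degree 2d or 2d + 1 needs d
  neighbours in the alliance, and d is its tree degree, plus one on the groups \<open>S\<close>. By
  \<open>degL\<close> a literal needs one neighbour. \<open>rk\<close> makes the parent relation
  well-founded, and as \<open>root\<close> is no group, every group has a parent that it can
  lose.\<close>

locale alliance_tree =
  fixes V :: "'a set" and E :: "'a set set" and U L S :: "'a set"
    and par :: "'a \<Rightarrow> 'a" and root :: 'a and rk :: "'a \<Rightarrow> nat"
  assumes finite_V: "finite V"
    and U_V: "U \<subseteq> V" and L_V: "L \<subseteq> V" and U_L: "U \<inter> L = {}" and S_U: "S \<subseteq> U"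
    and root: "root \<in> U" "root \<notin> S"
    and par: "\<And>u. u \<in> U \<Longrightarrow> u \<noteq> root \<Longrightarrow> par u \<in> U \<and> rk (par u) < rk u"
    and UU: "\<And>u w. u \<in> U \<Longrightarrow> w \<in> U \<Longrightarrow>
      {u, w} \<in> E \<longleftrightarrow> u \<noteq> root \<and> w = par u \<or> w \<noteq> root \<and> u = par w"
    and LL: "\<And>x y. x \<in> L \<Longrightarrow> y \<in> L \<Longrightarrow> {x, y} \<notin> E"
    and UL: "\<And>u x. u \<in> U \<Longrightarrow> u \<notin> S \<Longrightarrow> x \<in> L \<Longrightarrow> {u, x} \<notin> E"
    and degL: "\<And>x. x \<in> L \<Longrightarrow> 2 \<le> deg E V x \<and> deg E V x \<le> 3"
    and nbL: "\<And>x. x \<in> L \<Longrightarrow> \<exists>u \<in> U. {u, x} \<in> E"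
    and degU: "\<And>u. u \<in> U \<Longrightarrow> deg E V u \<in>
      {2 * (deg E U u + of_bool (u \<in> S)), 2 * (deg E U u + of_bool (u \<in> S)) + 1}"
begin

lemma finite_sub [simp]: "A \<subseteq> V \<Longrightarrow> finite A"
  using finite_V finite_subset by blast

lemma deg_split:
  assumes "U \<subseteq> A" "A \<subseteq> U \<union> L"
  shows "deg E A u = deg E U u + deg E (A \<inter> L) u"
proof -
  have "A = U \<union> (A \<inter> L)" using assms by blast
  then show ?thesis using deg_Un[of U "A \<inter> L" E u] U_V L_V U_L
    by (metis (no_types, lifting) Int_assoc finite_sub inf.coboundedI2 inf_bot_right inf_commute)
qed

text \<open>With one literal per group, every tree vertex sits exactly at its threshold in
  \<open>A\<close>. A sub-alliance containing it must contain all its neighbours in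
  \<open>A\<close>; following parents up to the root and children down again yields the whole tree
  and then every chosen literal.\<close>

lemma minimal_if_exact:
  assumes A: "U \<subseteq> A" "A \<subseteq> U \<union> L" and exact: "\<And>u. u \<in> S \<Longrightarrow> deg E (A \<inter> L) u = 1"
  shows "globally_minimal V E A"
proof -
  have AV: "A \<subseteq> V" using A U_V L_V by blast
  have none: "deg E (A \<inter> L) u = 0" if "u \<in> U" "u \<notin> S" for u
    using UL[OF that] L_V unfolding deg_def by (auto simp: card_eq_0_iff)
  have degA: "deg E A u = deg E U u + of_bool (u \<in> S)" if "u \<in> U" for u
    using deg_split[OF A, of u] exact[of u] none[OF that] by (cases "u \<in> S") auto
  have "defensive_alliance V E A"
    unfolding defensive_alliance_iff[OF finite_V]
  proof (intro conjI ballI)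
    fix v assume "v \<in> A"
    show "deg E V v \<le> 2 * deg E A v + 1"
    proof (cases "v \<in> U")
      case True
      then show ?thesis using degU[of v] degA[of v] by auto
    next
      case False
      then have v: "v \<in> L" using \<open>v \<in> A\<close> A by blast
      then have "0 < deg E A v"
        using nbL[OF v] A AV by (auto simp: deg_pos_iff insert_commute)
      then show ?thesis using degL[OF v] by linarith
    qed
  qed (rule AV)
  moreover have "B = A" if B: "B \<subseteq> A" "B \<noteq> {}" "defensive_alliance V E B" for B
  proof -
    have B_V: "B \<subseteq> V" using B AV by blast
    have dB: "deg E V v \<le> 2 * deg E B v + 1" if "v \<in> B" for v
      using B(3) that unfolding defensive_alliance_iff[OF finite_V] by blast
    have tight: "w \<in> B" if "u \<in> B" "u \<in> U" "w \<in> A" "{u, w} \<in> E" for u w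
    proof (rule ccontr)
      assume "w \<notin> B"
      then have "{w \<in> B. {u, w} \<in> E} \<subset> {w \<in> A. {u, w} \<in> E}" using that B by blast
      moreover have "finite {w \<in> A. {u, w} \<in> E}" using AV by simp
      ultimately have "deg E B u < deg E A u" unfolding deg_def by (rule psubset_card_mono[rotated])
      then show False using dB[OF that(1)] degA[OF that(2)] degU[OF that(2)] by auto
    qed
    have up: "root \<in> B" if "u \<in> B" "u \<in> U" for u
      using that
    proof (induction "rk u" arbitrary: u rule: less_induct)
      case less
      show ?case
      proof (cases "u = root")
        case False
        then have "par u \<in> U" "rk (par u) < rk u" "{u, par u} \<in> E"
          using par[OF less.prems(2)] UU less.prems by auto
        then show ?thesis using less A tight[OF less.prems] by blast
      qed (use less in simp)
    qed
    obtain b where b: "b \<in> B" using B by blast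
    \<comment> \<open>Literals are independent and need a neighbour, so \<open>B\<close> cannot
      consist of literals alone.\<close>
    have "\<exists>u. u \<in> B \<and> u \<in> U"
    proof (cases "b \<in> U")
      case False
      then have "b \<in> L" using b B A by blast
      then have "0 < deg E B b" using dB[OF b] degL[of b] by linarith
      then obtain w where w: "w \<in> B" "{b, w} \<in> E" using B_V by (auto simp: deg_pos_iff)
      then have "w \<notin> L" using LL \<open>b \<in> L\<close> by blast
      then show ?thesis using w B A by blast
    qed (use b in blast)
    then have root_B: "root \<in> B" using up by blast
    have down: "u \<in> B" if "u \<in> U" for u
      using that
    proof (induction "rk u" arbitrary: u rule: less_induct)
      case less
      show ?case
      proof (cases "u = root")
        case False
        then have p: "par u \<in> U" "rk (par u) < rk u" "{par u, u} \<in> E"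
          using par[OF less.prems] UU less.prems by auto
        then have "par u \<in> B" using less by blast
        then show ?thesis using tight[of "par u" u] p A less.prems by blast
      qed (use root_B in simp)
    qed
    have "x \<in> B" if "x \<in> A" for x
    proof (cases "x \<in> U")
      case False
      then have "x \<in> L" using that A by blast
      then obtain u where "u \<in> U" "{u, x} \<in> E" using nbL by blast
      then show ?thesis using tight[of u x] down that by blast
    qed (rule down)
    then show ?thesis using B by blast
  qed
  moreover have "A \<noteq> {}" using A root by blast
  ultimately show ?thesis unfolding globally_minimal_def by blast
qed

definition subtree :: "'a \<Rightarrow> 'a set" where
  "subtree u = {w \<in> U. (\<lambda>a b. a \<in> U \<and> a \<noteq> root \<and> b = par a)\<^sup>*\<^sup>* w u}"

text \<open>If a group vertex \<open>u\<close> sees two chosen literals, it no longer needs its parent, so its subtree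
  is an alliance on its own.\<close>

lemma exact_if_minimal:
  assumes A: "U \<subseteq> A" "A \<subseteq> U \<union> L" and min: "globally_minimal V E A" and u: "u \<in> S"
  shows "deg E (A \<inter> L) u = 1"
proof -
  have AV: "A \<subseteq> V" using A U_V L_V by blast
  have dA: "deg E V v \<le> 2 * deg E A v + 1" if "v \<in> A" for v
    using min that unfolding globally_minimal_def defensive_alliance_iff[OF finite_V] by blast
  have uU: "u \<in> U" using u S_U by blast
  \<comment> \<open>The alliance condition alone gives this half: without a literal the group is one
    below its threshold.\<close>
  have "deg E (A \<inter> L) u \<ge> 1"
    using dA[of u] degU[OF uU] u uU A deg_split[OF A, of u] by auto
  moreover have False if two: "deg E (A \<inter> L) u \<ge> 2"
  proof -
    let ?T = "subtree u"
    \<comment> \<open>The subtree with the chosen literals that it touches. The only neighbour in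
      \<open>A\<close> that a tree vertex of \<open>B\<close> loses is the parent of
      \<open>u\<close>, and the second literal compensates for it.\<close>
    define B where "B = ?T \<union> {x \<in> A \<inter> L. \<exists>w \<in> ?T. {w, x} \<in> E}"
    have TU: "?T \<subseteq> U" unfolding subtree_def by blast
    have uT: "u \<in> ?T" using uU unfolding subtree_def by blast
    have root_T: "root \<notin> ?T"
    proof
      assume "root \<in> ?T"
      then have "(\<lambda>a b. a \<in> U \<and> a \<noteq> root \<and> b = par a)\<^sup>*\<^sup>* root u" unfolding subtree_def by blast
      then have "u = root" by (cases rule: converse_rtranclpE) auto
      then show False using u root by blast
    qed
    have child: "w \<in> ?T" if "w \<in> U" "w \<noteq> root" "par w \<in> ?T" for w
      using that unfolding subtree_def by (auto intro: converse_rtranclp_into_rtranclp)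
    have parent: "par w \<in> ?T" if "w \<in> ?T" "w \<noteq> u" for w
    proof -
      have "(\<lambda>a b. a \<in> U \<and> a \<noteq> root \<and> b = par a)\<^sup>*\<^sup>* w u" using that unfolding subtree_def by blast
      then show ?thesis
        using that par unfolding subtree_def by (cases rule: converse_rtranclpE) auto
    qed
    have BA: "B \<subseteq> A" unfolding B_def using TU A by blast
    have nbU: "w' \<in> B" if "w \<in> ?T" "w' \<in> A" "{w, w'} \<in> E" "w \<noteq> u \<or> w' \<noteq> par u" for w w'
    proof (cases "w' \<in> U")
      case True
      then have "w \<noteq> root \<and> w' = par w \<or> w' \<noteq> root \<and> w = par w'" using UU[of w w'] that TU by blast
      then have "w' \<in> ?T" using parent[of w] child[of w'] that True by blast
      then show ?thesis unfolding B_def by blast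
    next
      case False
      then show ?thesis using that A unfolding B_def by blast
    qed
    have "defensive_alliance V E B"
      unfolding defensive_alliance_iff[OF finite_V]
    proof (intro conjI ballI)
      show "B \<subseteq> V" using BA AV by blast
      fix v assume v: "v \<in> B"
      consider "v = u" | "v \<in> ?T" "v \<noteq> u" | "v \<in> L" "\<exists>w \<in> ?T. {w, v} \<in> E"
        using v unfolding B_def by blast
      then show "deg E V v \<le> 2 * deg E B v + 1"
      proof cases
        case 1
        have "{w \<in> A. {u, w} \<in> E} \<subseteq> insert (par u) {w \<in> B. {u, w} \<in> E}"
          using nbU[OF uT] by blast
        moreover have "finite {w \<in> B. {u, w} \<in> E}" using BA AV by simp
        ultimately have "card {w \<in> A. {u, w} \<in> E} \<le> card (insert (par u) {w \<in> B. {u, w} \<in> E})"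
          by (intro card_mono) auto
        also have "\<dots> \<le> Suc (card {w \<in> B. {u, w} \<in> E})"
          using BA AV by (simp add: card_insert_if)
        finally have "deg E A u \<le> Suc (deg E B u)" unfolding deg_def .
        then show ?thesis using two deg_split[OF A, of u] degU[OF uU] u 1 by auto
      next
        case 2
        have "{w \<in> A. {v, w} \<in> E} \<subseteq> {w \<in> B. {v, w} \<in> E}" using nbU[OF 2(1)] 2(2) by blast
        then have "deg E A v \<le> deg E B v"
          unfolding deg_def using BA AV by (intro card_mono) auto
        then show ?thesis using dA[of v] v BA by fastforce
      next
        case 3
        then have "0 < deg E B v"
          using BA AV by (subst deg_pos_iff) (auto simp: B_def insert_commute)
        then show ?thesis using degL[OF 3(1)] by linarith
      qed
    qed
    moreover have "B \<noteq> {}" using uT unfolding B_def by blast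
    moreover have "root \<notin> B" using root_T root U_L unfolding B_def by blast
    then have "B \<subset> A" using BA A root by blast
    ultimately show False using min unfolding globally_minimal_def by blast
  qed
  ultimately show ?thesis by (cases "deg E (A \<inter> L) u \<ge> 2") auto
qed

lemma globally_minimal_iff_exact:
  assumes "U \<subseteq> A" "A \<subseteq> U \<union> L"
  shows "globally_minimal V E A \<longleftrightarrow> (\<forall>u \<in> S. deg E (A \<inter> L) u = 1)"
  using minimal_if_exact[OF assms] exact_if_minimal[OF assms] by blast

end

section \<open>Membership in NP\<close>

text \<open>Addresses a flattened matrix by quotient and remainder, the form in which formulas
  access the adjacency matrix.\<close>

lemma concat_map_map:
  "concat (map (\<lambda>i. map (\<lambda>j. f i j) [0..<n]) [0..<m]) = map (\<lambda>k. f (k div n) (k mod n)) [0..<m * n]"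
proof (induction m)
  case (Suc m)
  have "map (\<lambda>k. f (k div n) (k mod n)) [m * n..<m * n + n] = map (\<lambda>j. f m j) [0..<n]"
    by (rule nth_equalityI) auto
  moreover have "[0..<Suc m * n] = [0..<m * n] @ [m * n..<m * n + n]"
    using upt_add_eq_append[of 0 "m * n" n] by (simp add: add.commute)
  ultimately show ?case using Suc by simp
qed simp

text \<open>Random access to the encoding: the verifier reads and the reduction writes single bits,
  so a function of the position replaces the list.\<close>

definition encode_bit :: "nat \<Rightarrow> nat set set \<Rightarrow> nat set \<Rightarrow> nat set \<Rightarrow> nat \<Rightarrow> bool" where
  "encode_bit n E U N b =
     (if b < n then True else if b = n then False
      else if b < n + 1 + n * n then {(b - (n + 1)) div n, (b - (n + 1)) mod n} \<in> E
      else if b < n + 1 + n * n + n then b - (n + 1 + n * n) \<in> U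
      else b - (n + 1 + n * n + n) \<in> N)"

lemma encode_conv:
  "encode n E U N = map (encode_bit n E U N) [0..<n + 1 + n * n + n + n]"
proof -
  have split: "map f [0..<a + b] = map f [0..<a] @ map (\<lambda>i. f (a + i)) [0..<b]" for f :: "nat \<Rightarrow> bool" and a b
    by (rule nth_equalityI) (auto simp: nth_append)
  have "map (encode_bit n E U N) [0..<n] = replicate n True"
    by (rule nth_equalityI) (auto simp: encode_bit_def)
  moreover have "map (\<lambda>i. encode_bit n E U N (n + i)) [0..<1] = [False]"
    by (simp add: encode_bit_def)
  moreover have "map (\<lambda>i. encode_bit n E U N (n + 1 + i)) [0..<n * n] = map (\<lambda>k. {k div n, k mod n} \<in> E) [0..<n * n]"
    by (rule nth_equalityI) (auto simp: encode_bit_def)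
  moreover have "map (\<lambda>i. encode_bit n E U N (n + 1 + n * n + i)) [0..<n] = map (\<lambda>i. i \<in> U) [0..<n]"
    by (rule nth_equalityI) (auto simp: encode_bit_def)
  moreover have "map (\<lambda>i. encode_bit n E U N (n + 1 + n * n + n + i)) [0..<n] = map (\<lambda>i. i \<in> N) [0..<n]"
    by (rule nth_equalityI) (auto simp: encode_bit_def)
  ultimately show ?thesis
    unfolding encode_def split concat_map_map by simp
qed

lemma length_encode: "length (encode n E U N) = n + 1 + n * n + n + n"
  by (simp add: encode_conv)

lemma nth_encode: "i < n + 1 + n * n + n + n \<Longrightarrow> encode n E U N ! i = encode_bit n E U N i"
  unfolding encode_conv by (subst nth_map) (simp_all del: upt_Suc)

text \<open>
  A certificate consists of the alliance \<open>a\<close> and, for each of its vertices \<open>u\<close>, of a sequence of sets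
  \<open>z u 0\<close>, \dots, \<open>z u n\<close> that starts above \<open>a - {u}\<close>, ends with the empty set and only
  drops vertices that cannot belong to an alliance inside the current set.
\<close>

definition certifies :: "nat \<Rightarrow> (nat \<Rightarrow> nat \<Rightarrow> bool) \<Rightarrow> (nat \<Rightarrow> bool) \<Rightarrow> (nat \<Rightarrow> bool) \<Rightarrow> (nat \<Rightarrow> bool) \<Rightarrow>
    (nat \<Rightarrow> nat \<Rightarrow> nat \<Rightarrow> bool) \<Rightarrow> bool" where
  "certifies n adj U N a z \<longleftrightarrow>
     (\<forall>u < n. \<forall>v < n. adj u v \<longrightarrow> adj v u \<and> u \<noteq> v) \<and>
     (\<exists>u < n. a u) \<and> (\<forall>u < n. (U u \<longrightarrow> a u) \<and> (N u \<longrightarrow> \<not> a u)) \<and>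
     (\<forall>u < n. a u \<longrightarrow> (\<Sum>t<n. of_bool (adj u t)) < 2 * (\<Sum>t<n. of_bool (adj u t \<and> a t)) + (2::nat)) \<and>
     (\<forall>u < n. a u \<longrightarrow> (\<forall>v < n. a v \<and> v \<noteq> u \<longrightarrow> z u 0 v) \<and> (\<forall>v < n. \<not> z u n v) \<and>
        (\<forall>k < n. \<forall>v < n. z u k v \<and> \<not> z u (k + 1) v \<longrightarrow>
           2 * (\<Sum>t<n. of_bool (adj v t \<and> z u k t)) + (1::nat) < (\<Sum>t<n. of_bool (adj v t))))"

lemma certifiesD:
  assumes "certifies n adj U N a z"
  shows "\<lbrakk>u < n; v < n; adj u v\<rbrakk> \<Longrightarrow> adj v u" "\<lbrakk>u < n; v < n; adj u v\<rbrakk> \<Longrightarrow> u \<noteq> v"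
    "\<exists>u < n. a u" "\<lbrakk>u < n; U u\<rbrakk> \<Longrightarrow> a u" "\<lbrakk>u < n; N u\<rbrakk> \<Longrightarrow> \<not> a u"
    "\<lbrakk>u < n; a u\<rbrakk> \<Longrightarrow> (\<Sum>t<n. of_bool (adj u t)) < 2 * (\<Sum>t<n. of_bool (adj u t \<and> a t)) + (2::nat)"
    "\<lbrakk>u < n; a u; v < n; a v; v \<noteq> u\<rbrakk> \<Longrightarrow> z u 0 v" "\<lbrakk>u < n; a u; v < n\<rbrakk> \<Longrightarrow> \<not> z u n v"
    "\<lbrakk>u < n; a u; k < n; v < n; z u k v; \<not> z u (k + 1) v\<rbrakk> \<Longrightarrow>
       2 * (\<Sum>t<n. of_bool (adj v t \<and> z u k t)) + (1::nat) < (\<Sum>t<n. of_bool (adj v t))"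
proof -
  note c = assms[unfolded certifies_def]
  note c1 = conjunct1[OF c] and r1 = conjunct2[OF c]
  note c2 = conjunct1[OF r1] and r2 = conjunct2[OF r1]
  note c3 = conjunct1[OF r2] and r3 = conjunct2[OF r2]
  note c4 = conjunct1[OF r3] and c5 = conjunct2[OF r3]
  show "\<lbrakk>u < n; v < n; adj u v\<rbrakk> \<Longrightarrow> adj v u" "\<lbrakk>u < n; v < n; adj u v\<rbrakk> \<Longrightarrow> u \<noteq> v"
    "\<exists>u < n. a u" "\<lbrakk>u < n; U u\<rbrakk> \<Longrightarrow> a u" "\<lbrakk>u < n; N u\<rbrakk> \<Longrightarrow> \<not> a u"
    using c1 c2 c3 by blast+
  show "\<lbrakk>u < n; a u\<rbrakk> \<Longrightarrow> (\<Sum>t<n. of_bool (adj u t)) < 2 * (\<Sum>t<n. of_bool (adj u t \<and> a t)) + (2::nat)"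
    by (rule c4[rule_format])
  show "\<lbrakk>u < n; a u; v < n; a v; v \<noteq> u\<rbrakk> \<Longrightarrow> z u 0 v"
    by (rule conjunct1[OF c5[rule_format], rule_format]) auto
  show "\<lbrakk>u < n; a u; v < n\<rbrakk> \<Longrightarrow> \<not> z u n v"
    by (rule conjunct1[OF conjunct2[OF c5[rule_format]], rule_format])
  show "\<lbrakk>u < n; a u; k < n; v < n; z u k v; \<not> z u (k + 1) v\<rbrakk> \<Longrightarrow>
       2 * (\<Sum>t<n. of_bool (adj v t \<and> z u k t)) + (1::nat) < (\<Sum>t<n. of_bool (adj v t))"
    by (rule conjunct2[OF conjunct2[OF c5[rule_format]], rule_format]) auto
qed

text \<open>Only arguments in range matter, so predicates read off the tape can be exchanged for the
  graph, the sets and the stages with which they agree there.\<close>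

lemma certifies_cong:
  assumes c: "certifies n adj U N a z"
    and adj: "\<And>u v. u < n \<Longrightarrow> v < n \<Longrightarrow> adj' u v \<longleftrightarrow> adj u v"
    and U: "\<And>u. u < n \<Longrightarrow> U' u \<longleftrightarrow> U u" and N: "\<And>u. u < n \<Longrightarrow> N' u \<longleftrightarrow> N u"
    and a: "\<And>u. u < n \<Longrightarrow> a' u \<longleftrightarrow> a u"
    and z: "\<And>u k v. u < n \<Longrightarrow> k \<le> n \<Longrightarrow> v < n \<Longrightarrow> z' u k v \<longleftrightarrow> z u k v"
  shows "certifies n adj' U' N' a' z'"
proof -
  have s: "(\<Sum>t<n. of_bool (adj' u t)) = (\<Sum>t<n. of_bool (adj u t) :: nat)"
    "(\<Sum>t<n. of_bool (adj' u t \<and> a' t)) = (\<Sum>t<n. of_bool (adj u t \<and> a t) :: nat)" if "u < n" for u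
    by (rule sum.cong; use that adj a in simp)+
  have sz: "(\<Sum>t<n. of_bool (adj' v t \<and> z' u k t)) = (\<Sum>t<n. of_bool (adj v t \<and> z u k t) :: nat)"
    if "u < n" "v < n" "k \<le> n" for u v k
    by (rule sum.cong; use that adj z in simp)
  note d = certifiesD[OF c]
  show ?thesis
    unfolding certifies_def
  proof (intro conjI allI impI; (elim conjE)?)
    fix u v assume "u < n" "v < n" "adj' u v"
    then show "adj' v u" "u \<noteq> v" using d(1,2) adj by blast+
  next
    show "\<exists>u<n. a' u" using d(3) a by blast
  next
    fix u assume u: "u < n"
    show "U' u \<Longrightarrow> a' u" "N' u \<Longrightarrow> \<not> a' u" using d(4,5) u U N a by blast+
    assume "a' u"
    then have au: "a u" using a u by blast
    show "(\<Sum>t<n. of_bool (adj' u t)) < 2 * (\<Sum>t<n. of_bool (adj' u t \<and> a' t)) + (2::nat)"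
      unfolding s[OF u] by (rule d(6)[OF u au])
    fix v assume v: "v < n"
    show "a' v \<Longrightarrow> v \<noteq> u \<Longrightarrow> z' u 0 v" "\<not> z' u n v" using d(7)[OF u au v] d(8)[OF u au v] a v z u by auto
    fix k assume k: "k < n" and "z' u k v" "\<not> z' u (k + 1) v"
    then have "z u k v" "\<not> z u (k + 1) v" using z u v by auto
    then show "2 * (\<Sum>t<n. of_bool (adj' v t \<and> z' u k t)) + (1::nat) < (\<Sum>t<n. of_bool (adj' v t))"
      using d(9)[OF u au k v] unfolding s[OF v] sz[OF u v less_imp_le[OF k]] by blast
  qed
qed

lemma card_sum: "card ({..<n::nat} \<inter> {t. P t}) = (\<Sum>t<n. of_bool (P t))"
proof -
  have "(\<Sum>t<n. of_bool (P t)) = (\<Sum>t \<in> {..<n} \<inter> {t. P t}. 1 :: nat)"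
    by (rule sum.mono_neutral_cong_right) auto
  then show ?thesis by simp
qed

lemma deg_sum:
  assumes "X \<subseteq> {0..<n :: nat}"
  shows "deg E X v = (\<Sum>t<n. of_bool ({v, t} \<in> E \<and> t \<in> X))"
proof -
  have "{t \<in> X. {v, t} \<in> E} = {..<n} \<inter> {t. {v, t} \<in> E \<and> t \<in> X}" using assms by auto
  then show ?thesis unfolding deg_def card_sum[symmetric] by (simp only:)
qed

text \<open>A smaller non-empty alliance \<open>B\<close> misses some \<open>u\<close> of
  \<open>A\<close>. By induction \<open>B\<close> stays inside every stage \<open>z u k\<close>: a
  dropped vertex has too few neighbours even in the larger set \<open>z u k\<close>. The last stage
  is empty, a contradiction.\<close>

lemma globally_minimal_if_certifies:
  assumes cert: "certifies n (\<lambda>u v. {u, v} \<in> E) U N a z"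
  defines "A \<equiv> {u. u < n \<and> a u}"
  shows "globally_minimal {0..<n} E A"
proof -
  have dA: "deg E A u = (\<Sum>t<n. of_bool ({u, t} \<in> E \<and> a t))" for u
  proof -
    have "deg E A u = (\<Sum>t<n. of_bool ({u, t} \<in> E \<and> t \<in> A))"
      by (rule deg_sum) (auto simp: A_def)
    also have "\<dots> = (\<Sum>t<n. of_bool ({u, t} \<in> E \<and> a t))"
      by (intro sum.cong) (auto simp: A_def)
    finally show ?thesis .
  qed
  have dV: "deg E {0..<n} u = (\<Sum>t<n. of_bool ({u, t} \<in> E))" for u
  proof -
    have "deg E {0..<n} u = (\<Sum>t<n. of_bool ({u, t} \<in> E \<and> t \<in> {0..<n}))"
      by (rule deg_sum) simp
    also have "\<dots> = (\<Sum>t<n. of_bool ({u, t} \<in> E))" by (intro sum.cong) auto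
    finally show ?thesis .
  qed
  have "A \<noteq> {}" using certifiesD(3)[OF cert] unfolding A_def by blast
  moreover have "defensive_alliance {0..<n} E A"
    unfolding defensive_alliance_iff[OF finite_atLeastLessThan] dA dV
    using certifiesD(6)[OF cert] unfolding A_def by fastforce
  moreover have False if B: "B \<subset> A" "B \<noteq> {}" "defensive_alliance {0..<n} E B" for B
  proof -
    obtain u where u: "u \<in> A" "u \<notin> B" using B(1) by blast
    have z: "\<forall>v < n. a v \<and> v \<noteq> u \<longrightarrow> z u 0 v" "\<forall>v < n. \<not> z u n v"
      "\<And>k v. k < n \<Longrightarrow> v < n \<Longrightarrow> z u k v \<Longrightarrow> \<not> z u (k + 1) v \<Longrightarrow>
         2 * (\<Sum>t<n. of_bool ({v, t} \<in> E \<and> z u k t)) + (1::nat) < (\<Sum>t<n. of_bool ({v, t} \<in> E))"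
      using certifiesD(7-9)[OF cert, of u] u(1) unfolding A_def by blast+
    have Bn: "B \<subseteq> {0..<n}" using B(1) A_def by auto
    have "\<forall>v \<in> B. z u k v" if "k \<le> n" for k
      using that
    proof (induction k)
      case 0
      then show ?case using z(1) u B(1) by (auto simp: A_def)
    next
      case (Suc k)
      show ?case
      proof (rule ballI, rule ccontr)
        fix v assume v: "v \<in> B" "\<not> z u (Suc k) v"
        then have "2 * (\<Sum>t<n. of_bool ({v, t} \<in> E \<and> z u k t)) + (1::nat) < deg E {0..<n} v"
          using z(3)[of k v] Suc Bn unfolding dV by auto
        moreover have "deg E B v \<le> (\<Sum>t<n. of_bool ({v, t} \<in> E \<and> z u k t))"
          unfolding deg_sum[OF Bn] using Suc by (intro sum_mono) auto
        moreover have "deg E {0..<n} v \<le> 2 * deg E B v + 1"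
          using B(3) v(1) unfolding defensive_alliance_iff[OF finite_atLeastLessThan] by blast
        ultimately show False by linarith
      qed
    qed
    then show False using z(2) B(2) Bn by fastforce
  qed
  ultimately show ?thesis unfolding globally_minimal_def by blast
qed

lemma certifies_if_globally_minimal:
  assumes gm: "globally_minimal {0..<n} E A" and "U \<subseteq> A" "N \<inter> A = {}" and E: "simple_graph {0..<n} E"
  shows "\<exists>z. certifies n (\<lambda>u v. {u, v} \<in> E) (\<lambda>u. u \<in> U) (\<lambda>u. u \<in> N) (\<lambda>u. u \<in> A) z"
proof -
  have An: "A \<subseteq> {0..<n}" and A0: "A \<noteq> {}" and dA: "\<And>v. v \<in> A \<Longrightarrow> deg E {0..<n} v \<le> 2 * deg E A v + 1"
    using gm unfolding globally_minimal_def defensive_alliance_iff[OF finite_atLeastLessThan] by blast+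
  have dV: "deg E {0..<n} u = (\<Sum>t<n. of_bool ({u, t} \<in> E))" for u
  proof -
    have "deg E {0..<n} u = (\<Sum>t<n. of_bool ({u, t} \<in> E \<and> t \<in> {0..<n}))"
      by (rule deg_sum) simp
    also have "\<dots> = (\<Sum>t<n. of_bool ({u, t} \<in> E))" by (intro sum.cong) auto
    finally show ?thesis .
  qed
  \<comment> \<open>The greedy removal: each stage discards at once all vertices that violate the
    condition within the current set.\<close>
  define Z where "Z u = rec_nat (A - {u}) (\<lambda>k S. {v \<in> S. deg E {0..<n} v \<le> 2 * deg E S v + 1})" for u
  have Z0: "Z u 0 = A - {u}" and ZS: "Z u (Suc k) = {v \<in> Z u k. deg E {0..<n} v \<le> 2 * deg E (Z u k) v + 1}" for u k
    by (simp_all add: Z_def)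
  have ZA: "Z u k \<subseteq> A - {u}" for u k
    by (induction k) (auto simp: Z0 ZS)
  have Zn: "Z u k \<subseteq> {0..<n}" for u k using ZA[of u k] An by blast
  \<comment> \<open>A non-empty stage always shrinks, for a stationary one would be an alliance
    without \<open>u\<close>. As stage 0 has fewer than \<open>n\<close> vertices, \<open>n\<close>
    stages suffice.\<close>
  have card: "Z u k = {} \<or> card (Z u k) + k < n" if "u \<in> A" for u k
  proof (induction k)
    case 0
    have "card (A - {u}) < card A" using that An by (intro psubset_card_mono) (auto intro: finite_subset)
    also have "card A \<le> n" using card_mono[OF _ An] by simp
    finally show ?case by (simp add: Z0)
  next
    case (Suc k)
    show ?case
    proof (cases "Z u (Suc k) = Z u k")
      case True
      have "Z u k = {}"
      proof (rule ccontr)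
        assume "Z u k \<noteq> {}"
        moreover have "defensive_alliance {0..<n} E (Z u k)"
          unfolding defensive_alliance_iff[OF finite_atLeastLessThan] using Zn[of u k] True ZS[of u k] by blast
        moreover have "Z u k \<subset> A" using ZA[of u k] that by blast
        ultimately show False using gm unfolding globally_minimal_def by blast
      qed
      then show ?thesis using True by simp
    next
      case False
      then have "Z u (Suc k) \<subset> Z u k" unfolding ZS by blast
      then have "card (Z u (Suc k)) < card (Z u k)"
        using Zn[of u k] by (intro psubset_card_mono) (auto intro: finite_subset)
      moreover have "Z u k \<noteq> {}" using \<open>Z u (Suc k) \<subset> Z u k\<close> by blast
      ultimately show ?thesis using Suc by linarith
    qed
  qed
  have "Z u n = {}" if "u \<in> A" for u using card[OF that, of n] by simp
  moreover have "2 * (\<Sum>t<n. of_bool ({v, t} \<in> E \<and> t \<in> Z u k)) + (1::nat) < (\<Sum>t<n. of_bool ({v, t} \<in> E))"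
    if "v \<in> Z u k" "v \<notin> Z u (Suc k)" for u k v
    using that unfolding ZS dV[symmetric] deg_sum[OF Zn, symmetric] by auto
  moreover have "{u, v} \<in> E \<longrightarrow> {v, u} \<in> E \<and> u \<noteq> v" for u v
    using E unfolding simple_graph_def by (auto simp: insert_commute)
  moreover have "(\<Sum>t<n. of_bool ({u, t} \<in> E)) < 2 * (\<Sum>t<n. of_bool ({u, t} \<in> E \<and> t \<in> A)) + (2::nat)" if "u \<in> A" for u
    using dA[OF that] unfolding dV deg_sum[OF An] by simp
  moreover have "\<exists>u < n. u \<in> A" using A0 An by auto
  ultimately have "certifies n (\<lambda>u v. {u, v} \<in> E) (\<lambda>u. u \<in> U) (\<lambda>u. u \<in> N) (\<lambda>u. u \<in> A) (\<lambda>u k v. v \<in> Z u k)"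
    unfolding certifies_def using assms(2,3) Z0 by auto
  then show ?thesis by blast
qed

section \<open>The formula that checks a certificate\<close>

definition Bit :: "ex \<Rightarrow> ex" where
  "Bit e = Eq (In e) (Num 3)"

abbreviation (input) "Nn \<equiv> Var 2"

definition Size :: ex where
  "Size = Add (Add (Add (Add Nn One) (Mul Nn Nn)) Nn) Nn"

definition Adj :: "ex \<Rightarrow> ex \<Rightarrow> ex" where
  "Adj a b = Bit (Add (Add (Add Nn (Num 2)) (Mul a Nn)) b)"

definition In_U :: "ex \<Rightarrow> ex" where
  "In_U a = Bit (Add (Add (Add Nn (Num 2)) (Mul Nn Nn)) a)"

definition In_N :: "ex \<Rightarrow> ex" where
  "In_N a = Bit (Add (Add (Add (Add Nn (Num 2)) (Mul Nn Nn)) Nn) a)"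

text \<open>The word starts on cell 1, so the encoding fills the cells up to \<open>Size\<close>,
  the separator is on \<open>Size + 1\<close> and the certificate starts on
  \<open>Size + 2\<close>.\<close>

definition In_A :: "ex \<Rightarrow> ex" where
  "In_A a = Bit (Add (Add Size (Num 2)) a)"

text \<open>A table indexed by \<open>u\<close>, \<open>k\<close>, \<open>v\<close>; the factor
  \<open>n + 1\<close> arises because stages are numbered from 0 to \<open>n\<close>.\<close>

definition In_Z :: "ex \<Rightarrow> ex \<Rightarrow> ex \<Rightarrow> ex" where
  "In_Z u k v = Bit (Add (Add (Add (Add Size (Num 2)) Nn) (Mul (Add (Mul u (Add Nn One)) k) Nn)) v)"

text \<open>A transcription of \<open>certifies\<close> with \<open>n\<close> guessed as the value
  of variable 2. The unary prefix and the separator on cell \<open>Size + 1\<close> tie the guess to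
  the actual first input.\<close>

definition Check :: ex where
  "Check = Exi 2 (Add (Var 0) One)
    (And (And (All 3 Nn (Bit (Add One (Var 3)))) (And (Eq (In (Add Nn One)) (Num 2)) (Eq (In (Add Size One)) (Num 4))))
    (And (All 3 Nn (All 4 Nn (Imp (Adj (Var 3) (Var 4)) (And (Adj (Var 4) (Var 3)) (Not (Eq (Var 3) (Var 4)))))))
    (And (Exi 3 Nn (In_A (Var 3)))
    (And (All 3 Nn (And (Imp (In_U (Var 3)) (In_A (Var 3))) (Imp (In_N (Var 3)) (Not (In_A (Var 3))))))
    (And (All 3 Nn (Imp (In_A (Var 3))
       (Less (Sum 6 Nn (Truth (Adj (Var 3) (Var 6))))
         (Add (Mul (Num 2) (Sum 6 Nn (Truth (And (Adj (Var 3) (Var 6)) (In_A (Var 6)))))) (Num 2)))))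
    (All 3 Nn (Imp (In_A (Var 3))
      (And (All 4 Nn (Imp (And (In_A (Var 4)) (Not (Eq (Var 4) (Var 3)))) (In_Z (Var 3) Zero (Var 4))))
      (And (All 4 Nn (Not (In_Z (Var 3) Nn (Var 4))))
      (All 5 Nn (All 4 Nn (Imp (And (In_Z (Var 3) (Var 5) (Var 4)) (Not (In_Z (Var 3) (Add (Var 5) One) (Var 4))))
        (Less (Add (Mul (Num 2) (Sum 6 Nn (Truth (And (Adj (Var 4) (Var 6)) (In_Z (Var 3) (Var 5) (Var 6)))))) One)
          (Sum 6 Nn (Truth (Adj (Var 4) (Var 6)))))))))))))))))"

definition size_of :: "nat \<Rightarrow> nat" where
  "size_of n = n + 1 + n * n + n + n"

definition checked :: "(nat \<Rightarrow> nat) \<Rightarrow> nat \<Rightarrow> bool" where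
  "checked c n \<longleftrightarrow> (\<forall>i < n. c (1 + i) = 3) \<and> c (n + 1) = 2 \<and> c (size_of n + 1) = 4 \<and>
     certifies n (\<lambda>u v. c (n + 2 + u * n + v) = 3) (\<lambda>u. c (n + 2 + n * n + u) = 3)
       (\<lambda>u. c (n + 2 + n * n + n + u) = 3) (\<lambda>u. c (size_of n + 2 + u) = 3)
       (\<lambda>u k v. c (size_of n + 2 + n + (u * (n + 1) + k) * n + v) = 3)"

lemma holds_Check: "holds Check w r \<longleftrightarrow> (\<exists>n < r 0 + 1. checked (contents w) n)"
  unfolding Check_def checked_def certifies_def
  by (simp add: Bit_def Adj_def In_U_def In_N_def In_A_def In_Z_def Size_def size_of_def ac_simps)


lemma contents_word:
  fixes x y :: "bool list"
  defines "c \<equiv> contents (bits x @ [4] @ bits y)"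
  shows "i < length x \<Longrightarrow> c (i + 1) = (if x ! i then 3 else 2)"
    "j < length y \<Longrightarrow> c (length x + 2 + j) = (if y ! j then 3 else 2)"
    "c p = 4 \<longleftrightarrow> p = length x + 1"
proof -
  have w: "(bits x @ [4] @ bits y) ! i = (if i < length x then if x ! i then 3 else 2 else if i = length x then 4 else
     if y ! (i - length x - 1) then 3 else 2)" if "i < length x + 1 + length y" for i
    using that by (auto simp: bits_def nth_append nth_Cons')
  show "i < length x \<Longrightarrow> c (i + 1) = (if x ! i then 3 else 2)"
    using w[of i] by (simp add: c_def contents_def bits_def)
  show "j < length y \<Longrightarrow> c (length x + 2 + j) = (if y ! j then 3 else 2)"
    using w[of "length x + 1 + j"] by (simp add: c_def contents_def bits_def)
  show "c p = 4 \<longleftrightarrow> p = length x + 1"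
    using w[of "p - 1"] by (auto simp: c_def contents_def bits_def)
qed

lemma checked_encode:
  assumes v: "valid_input n E U N" and gm: "ext_gm_defensive_alliance {0..<n} E U N"
  shows "\<exists>y. length y \<le> n + n * (n + 1) * n \<and>
    checked (contents (bits (encode n E U N) @ [4] @ bits y)) n"
proof -
  obtain A where A: "A \<subseteq> {0..<n} - N" "U \<subseteq> A" "globally_minimal {0..<n} E A"
    using gm unfolding ext_gm_defensive_alliance_def by blast
  obtain z where z: "certifies n (\<lambda>u v. {u, v} \<in> E) (\<lambda>u. u \<in> U) (\<lambda>u. u \<in> N) (\<lambda>u. u \<in> A) z"
    using certifies_if_globally_minimal[OF A(3,2)] A(1) v unfolding valid_input_def by blast
  define y where "y = map (\<lambda>j. if j < n then j \<in> A
      else z ((j - n) div n div (n + 1)) ((j - n) div n mod (n + 1)) ((j - n) mod n)) [0..<n + n * (n + 1) * n]"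
  let ?x = "encode n E U N"
  let ?c = "contents (bits ?x @ [4] @ bits y)"
  have len: "length ?x = size_of n" by (simp add: length_encode size_of_def)
  have x: "?c (i + 1) = (if encode_bit n E U N i then 3 else 2)" if "i < size_of n" for i
    using contents_word(1)[of i ?x y] that nth_encode[of i n E U N] by (simp add: len size_of_def)
  have adj: "?c (n + 2 + u * n + v) = 3 \<longleftrightarrow> {u, v} \<in> E" if "u < n" "v < n" for u v
  proof -
    have "u * n + v + 1 \<le> (u + 1) * n" using that by simp
    also have "\<dots> \<le> n * n" using that by (intro mult_le_mono1) simp
    finally have b: "u * n + v < n * n" by simp
    have "n + 2 + u * n + v = (n + 1 + (u * n + v)) + 1" by simp
    then have "?c (n + 2 + u * n + v) = (if encode_bit n E U N (n + 1 + (u * n + v)) then 3 else 2)"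
      using x[of "n + 1 + (u * n + v)"] b by (simp only: size_of_def)
    also have "encode_bit n E U N (n + 1 + (u * n + v)) \<longleftrightarrow> {u, v} \<in> E"
      using b that by (simp add: encode_bit_def)
    finally show ?thesis by simp
  qed
  have U: "?c (n + 2 + n * n + u) = 3 \<longleftrightarrow> u \<in> U" if "u < n" for u
    using x[of "n + 1 + n * n + u"] that by (simp add: size_of_def encode_bit_def)
  have N: "?c (n + 2 + n * n + n + u) = 3 \<longleftrightarrow> u \<in> N" if "u < n" for u
    using x[of "n + 1 + n * n + n + u"] that by (simp add: size_of_def encode_bit_def)
  have a: "?c (size_of n + 2 + u) = 3 \<longleftrightarrow> u \<in> A" if "u < n" for u
    using contents_word(2)[of u y ?x] that unfolding len by (simp add: y_def)
  have zz: "?c (size_of n + 2 + n + (u * (n + 1) + k) * n + v) = 3 \<longleftrightarrow> z u k v" if "u < n" "k \<le> n" "v < n" for u k v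
  proof -
    have "u * (n + 1) + k + 1 \<le> (u + 1) * (n + 1)" using that by simp
    also have "\<dots> \<le> n * (n + 1)" using that by (intro mult_le_mono1) simp
    finally have "(u * (n + 1) + k + 1) * n \<le> n * (n + 1) * n" by (rule mult_le_mono1)
    then have b: "(u * (n + 1) + k) * n + v < n * (n + 1) * n" using that by simp
    have gen: "(a * c + b) div c = a" "(a * c + b) mod c = b" if "b < c" for a b c :: nat
      using that by simp_all
    let ?j = "n + ((u * (n + 1) + k) * n + v)"
    have "y ! ?j = z u k v"
    proof -
      have "(?j - n) div n = u * (n + 1) + k" "(?j - n) mod n = v"
        using gen[OF that(3)] by simp_all
      moreover have "(u * (n + 1) + k) div (n + 1) = u" "(u * (n + 1) + k) mod (n + 1) = k"
        using gen[of k "n + 1"] that by simp_all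
      ultimately show ?thesis using b unfolding y_def by (simp del: mult_Suc_right add_mult_distrib distrib_right)
    qed
    then show ?thesis
      using contents_word(2)[of ?j y ?x] b unfolding len by (simp add: y_def add.assoc)
  qed
  have "checked ?c n"
    unfolding checked_def
  proof (intro conjI allI impI)
    show "?c (1 + i) = 3" if "i < n" for i
      using x[of i] that by (simp add: size_of_def encode_bit_def)
    show "?c (n + 1) = 2" using x[of n] by (simp add: size_of_def encode_bit_def)
    show "?c (size_of n + 1) = 4" using contents_word(3)[of ?x y] len by simp
    show "certifies n (\<lambda>u v. ?c (n + 2 + u * n + v) = 3) (\<lambda>u. ?c (n + 2 + n * n + u) = 3)
       (\<lambda>u. ?c (n + 2 + n * n + n + u) = 3) (\<lambda>u. ?c (size_of n + 2 + u) = 3)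
       (\<lambda>u k v. ?c (size_of n + 2 + n + (u * (n + 1) + k) * n + v) = 3)"
      by (rule certifies_cong[OF z]) (rule adj U N a zz; assumption)+
  qed
  moreover have "length y \<le> n + n * (n + 1) * n" by (simp add: y_def)
  ultimately show ?thesis by blast
qed

lemma encode_if_checked:
  assumes ch: "checked (contents (bits x @ [4] @ bits y)) n"
  shows "x \<in> Ext_GM_Defensive_Alliance"
proof -
  let ?c = "contents (bits x @ [4] @ bits y)"
  note c = ch[unfolded checked_def]
  \<comment> \<open>The symbol 4 occurs only once in the word, so finding it on cell
    \<open>size_of n + 1\<close> determines the length of \<open>x\<close>.\<close>
  have len: "length x = size_of n" using c contents_word(3)[of x y] by auto
  have x: "x ! i \<longleftrightarrow> ?c (i + 1) = 3" if "i < size_of n" for i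
    using contents_word(1)[of i x y] that len by simp
  define adj where "adj u v \<longleftrightarrow> ?c (n + 2 + u * n + v) = 3" for u v
  have cert: "certifies n adj (\<lambda>u. ?c (n + 2 + n * n + u) = 3)
       (\<lambda>u. ?c (n + 2 + n * n + n + u) = 3) (\<lambda>u. ?c (size_of n + 2 + u) = 3)
       (\<lambda>u k v. ?c (size_of n + 2 + n + (u * (n + 1) + k) * n + v) = 3)"
    using c unfolding adj_def by blast
  \<comment> \<open>The graph is read off the tape. The tests for symmetry and for loops ensure that
    it is simple and that its adjacency matrix is the one in \<open>x\<close>.\<close>
  define E where "E = {{u, v} | u v. u < n \<and> v < n \<and> adj u v}"
  define U where "U = {u. u < n \<and> ?c (n + 2 + n * n + u) = 3}"
  define N where "N = {u. u < n \<and> ?c (n + 2 + n * n + n + u) = 3}"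
  have sym: "adj v u" "u \<noteq> v" if "u < n" "v < n" "adj u v" for u v
    using certifiesD(1,2)[OF cert that] by blast+
  have E: "{u, v} \<in> E \<longleftrightarrow> adj u v" if "u < n" "v < n" for u v
    using that sym unfolding E_def by (auto simp: doubleton_eq_iff)
  have valid: "valid_input n E U N"
    unfolding valid_input_def simple_graph_def
  proof (intro conjI ballI)
    fix e assume "e \<in> E"
    then obtain u v where "e = {u, v}" "u < n" "v < n" "u \<noteq> v" using sym(2) unfolding E_def by blast
    then show "e \<subseteq> {0..<n}" "card e = 2" by auto
  qed (auto simp: U_def N_def)
  have "x = encode n E U N"
  proof (rule nth_equalityI)
    show "length x = length (encode n E U N)" by (simp add: len length_encode size_of_def)
    fix i assume "i < length x"
    then have i: "i < size_of n" by (simp add: len)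
    then have "encode n E U N ! i \<longleftrightarrow> encode_bit n E U N i" by (simp add: nth_encode size_of_def)
    also have "\<dots> \<longleftrightarrow> x ! i"
    proof -
      consider "i < n" | "i = n" | k where "i = n + 1 + k" "k < n * n" | u where "i = n + 1 + n * n + u" "u < n"
        | u where "i = n + 1 + n * n + n + u" "u < n"
      proof -
        have "i < n \<or> i = n \<or> (i = n + 1 + (i - (n + 1)) \<and> i - (n + 1) < n * n) \<or>
           (i = n + 1 + n * n + (i - (n + 1 + n * n)) \<and> i - (n + 1 + n * n) < n) \<or>
           (i = n + 1 + n * n + n + (i - (n + 1 + n * n + n)) \<and> i - (n + 1 + n * n + n) < n)"
          using i unfolding size_of_def by linarith
        then show ?thesis using that by blast
      qed
      then show ?thesis
      proof cases
        case 1
        then show ?thesis using x[OF i] c by (simp add: encode_bit_def)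
      next
        case 2
        then show ?thesis using x[OF i] c by (simp add: encode_bit_def)
      next
        case (3 k)
        have n: "0 < n" using 3(2) by (cases n) auto
        have k: "k div n < n" "k mod n < n" using 3(2) n by (auto simp: less_mult_imp_div_less)
        have "n + 2 + k div n * n + k mod n = i + 1" using 3(1) div_mult_mod_eq[of k n] by linarith
        then have "x ! i \<longleftrightarrow> adj (k div n) (k mod n)" using x[OF i] unfolding adj_def by simp
        then show ?thesis using 3 E[OF k] by (simp add: encode_bit_def)
      next
        case (4 u)
        have "n + 2 + n * n + u = i + 1" using 4(1) by simp
        then show ?thesis using x[OF i] 4 by (simp add: encode_bit_def U_def)
      next
        case (5 u)
        have "n + 2 + n * n + n + u = i + 1" using 5(1) by simp
        then show ?thesis using x[OF i] 5 by (simp add: encode_bit_def N_def)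
      qed
    qed
    finally show "x ! i = encode n E U N ! i" by simp
  qed
  moreover have "ext_gm_defensive_alliance {0..<n} E U N"
  proof -
    let ?A = "{u. u < n \<and> ?c (size_of n + 2 + u) = 3}"
    have "certifies n (\<lambda>u v. {u, v} \<in> E) (\<lambda>u. ?c (n + 2 + n * n + u) = 3)
       (\<lambda>u. ?c (n + 2 + n * n + n + u) = 3) (\<lambda>u. ?c (size_of n + 2 + u) = 3)
       (\<lambda>u k v. ?c (size_of n + 2 + n + (u * (n + 1) + k) * n + v) = 3)"
      by (rule certifies_cong[OF cert]) (auto simp: E)
    then have "globally_minimal {0..<n} E ?A" by (rule globally_minimal_if_certifies)
    moreover have "U \<subseteq> ?A" "?A \<subseteq> {0..<n} - N"
      using certifiesD(4,5)[OF cert] unfolding U_def N_def by auto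
    ultimately show ?thesis unfolding ext_gm_defensive_alliance_def by blast
  qed
  ultimately show ?thesis unfolding Ext_GM_Defensive_Alliance_def using valid by blast
qed

theorem Ext_GM_in_NP: "Ext_GM_Defensive_Alliance \<in> NP"
proof -
  let ?R = "\<lambda>x y. holds Check (bits x @ [4] @ bits y) (env (bits x @ [4] @ bits y) 0)"
  let ?p = "[:0, 1, 1, 1:] :: nat poly"
  have R: "?R x y \<longleftrightarrow> (\<exists>n < length (bits x @ [4] @ bits y) + 1. checked (contents (bits x @ [4] @ bits y)) n)" for x y
    unfolding holds_Check by (simp add: env_def)
  have "x \<in> Ext_GM_Defensive_Alliance \<longleftrightarrow> (\<exists>y. length y \<le> poly ?p (length x) \<and> ?R x y)" for x
  proof
    assume "x \<in> Ext_GM_Defensive_Alliance"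
    then obtain n E U N where x: "x = encode n E U N" "valid_input n E U N" "ext_gm_defensive_alliance {0..<n} E U N"
      unfolding Ext_GM_Defensive_Alliance_def by blast
    obtain y where y: "length y \<le> n + n * (n + 1) * n" "checked (contents (bits x @ [4] @ bits y)) n"
      using checked_encode[OF x(2,3)] x(1) by blast
    have n: "n \<le> length x" using x(1) by (simp add: length_encode)
    have "n + n * (n + 1) * n \<le> poly ?p n" by (simp add: algebra_simps)
    also have "\<dots> \<le> poly ?p (length x)" by (rule poly_nat_mono[OF n])
    finally have "length y \<le> poly ?p (length x)" using y(1) by simp
    moreover have "?R x y" unfolding R using y(2) n by (intro exI[of _ n]) (simp add: bits_def)
    ultimately show "\<exists>y. length y \<le> poly ?p (length x) \<and> ?R x y" by blast
  next
    assume "\<exists>y. length y \<le> poly ?p (length x) \<and> ?R x y"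
    then show "x \<in> Ext_GM_Defensive_Alliance" unfolding R using encode_if_checked by blast
  qed
  then show ?thesis unfolding NP_def using poly_time_verifier_holds[of Check] by blast
qed

section \<open>Computations as clauses\<close>

text \<open>
  Propositional variables \<open>(\<kappa>, t, p)\<close>: at time \<open>t\<close> the head of tape \<open>a\<close> is at \<open>p\<close>, cell \<open>p\<close> of tape
  \<open>a\<close> contains \<open>s\<close>, the state is \<open>q\<close>, and tape \<open>a\<close> reads \<open>s\<close>, writes \<open>s\<close> or moves its head by \<open>m\<close>
  (the last four at \<open>p = 0\<close>).
\<close>

datatype kind = Head nat | Cell nat nat | State nat | Read nat nat | Write nat nat | Move nat move

type_synonym lit = "bool \<times> kind \<times> ex \<times> ex"
text \<open>A guard and a clause whose times and positions are expressions in \<open>t\<close>,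
  \<open>p\<close> and an auxiliary position. A fixed finite list of schemes thus describes tableaus
  of every size, and incidence of clauses and variables becomes arithmetic.\<close>

type_synonym scheme = "ex \<times> lit list"

abbreviation (input) "nE \<equiv> Var 0"
abbreviation (input) "TE \<equiv> Var 2"
abbreviation (input) "PE \<equiv> Var 3"
abbreviation (input) "SE \<equiv> Var 4"
abbreviation (input) "tE \<equiv> Var 10"
abbreviation (input) "pE \<equiv> Var 11"
abbreviation (input) "oE \<equiv> Var 12"
abbreviation (input) "tE' \<equiv> Add tE One"

text \<open>A literal whose time or position falls outside the tableau counts as false.\<close>

definition scheme_sat :: "nat list \<Rightarrow> (nat \<Rightarrow> nat) \<Rightarrow> nat \<Rightarrow> nat \<Rightarrow> (kind \<Rightarrow> nat \<Rightarrow> nat \<Rightarrow> bool) \<Rightarrow> scheme \<Rightarrow> bool" where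
  "scheme_sat w r T S \<alpha> c \<longleftrightarrow> (\<forall>t \<le> T. \<forall>p < S. \<forall>o' < S. holds (fst c) w (r(10 := t, 11 := p, 12 := o')) \<longrightarrow>
     (\<exists>(s, \<kappa>, te, pe) \<in> set (snd c).
        eval te w (r(10 := t, 11 := p, 12 := o')) \<le> T \<and> eval pe w (r(10 := t, 11 := p, 12 := o')) < S \<and>
        \<alpha> \<kappa> (eval te w (r(10 := t, 11 := p, 12 := o'))) (eval pe w (r(10 := t, 11 := p, 12 := o'))) = s))"

text \<open>The halting state idles, as in \<open>step\<close>, so the clauses carry a halted
  configuration on to time \<open>T\<close>.\<close>

definition tm_delta :: "tm \<Rightarrow> nat \<Rightarrow> nat list \<Rightarrow> nat \<times> (nat \<times> move) list" where
  "tm_delta M q s = (if states M \<le> q then (q, idle s) else delta M q s)"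

definition start_schemes :: "tm \<Rightarrow> scheme list" where
  "start_schemes M =
     [(Eq tE Zero, [(True, State 0, tE, Zero)])] @
     map (\<lambda>a. (Eq tE Zero, [(True, Head a, tE, Zero)])) [0..<tapes M] @
     map (\<lambda>a. (And (Eq tE Zero) (Eq pE Zero), [(True, Cell a 1, tE, pE)])) [1..<tapes M] @
     map (\<lambda>a. (And (Eq tE Zero) (Less Zero pE), [(True, Cell a 0, tE, pE)])) [1..<tapes M]"

text \<open>Behind the separator there are \<open>P\<close> cells that may hold a bit or a blank,
  with blanks only at the end: a satisfying assignment guesses a certificate of length at most
  \<open>P\<close>.\<close>

definition input_schemes :: "scheme list" where
  "input_schemes =
     map (\<lambda>s. (And (Eq tE Zero) (And (Less pE (Add nE One)) (Eq (In pE) (Num s))), [(True, Cell 0 s, tE, pE)])) [0..<5] @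
     [(And (Eq tE Zero) (Eq pE (Add nE One)), [(True, Cell 0 4, tE, pE)]),
      (And (Eq tE Zero) (Less (Add (Add nE PE) One) pE), [(True, Cell 0 0, tE, pE)]),
      (And (Eq tE Zero) (And (Less (Add nE One) pE) (Less pE (Add (Add nE PE) (Num 2)))),
        [(True, Cell 0 0, tE, pE), (True, Cell 0 2, tE, pE), (True, Cell 0 3, tE, pE)]),
      (And (Eq tE Zero) (And (Less (Add nE One) pE) (Less (Add pE One) SE)),
        [(False, Cell 0 0, tE, pE), (True, Cell 0 0, tE, Add pE One)])]"

definition read_schemes :: "tm \<Rightarrow> scheme list" where
  "read_schemes M = [(One, [(False, Head a, tE, pE), (False, Cell a s, tE, pE), (True, Read a s, tE, Zero)]).
     a \<leftarrow> [0..<tapes M], s \<leftarrow> [0..<symbols M]]"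

definition conditions :: "nat \<Rightarrow> nat list \<Rightarrow> lit list" where
  "conditions q ss = (False, State q, tE, Zero) # map (\<lambda>a. (False, Read a (ss ! a), tE, Zero)) [0..<length ss]"

text \<open>The finite transition table is enumerated. The variables for reading, writing and moving
  split a step into implications, so that no clause has to mention the head positions of several
  tapes at once.\<close>

definition delta_schemes :: "tm \<Rightarrow> scheme list" where
  "delta_schemes M =
     [(Less tE TE, conditions q ss @ [(True, State (fst (tm_delta M q ss)), tE', Zero)]).
        q \<leftarrow> [0..<Suc (states M)], ss \<leftarrow> List.n_lists (tapes M) [0..<symbols M]] @
     [(Less tE TE, conditions q ss @ [(True, Write a (fst (snd (tm_delta M q ss) ! a)), tE, Zero)]).
        q \<leftarrow> [0..<Suc (states M)], ss \<leftarrow> List.n_lists (tapes M) [0..<symbols M], a \<leftarrow> [0..<tapes M]] @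
     [(Less tE TE, conditions q ss @ [(True, Move a (snd (snd (tm_delta M q ss) ! a)), tE, Zero)]).
        q \<leftarrow> [0..<Suc (states M)], ss \<leftarrow> List.n_lists (tapes M) [0..<symbols M], a \<leftarrow> [0..<tapes M]]"

fun moved_ex :: "move \<Rightarrow> ex" where
  "moved_ex Move_Left = Sub pE One"
| "moved_ex Stay = pE"
| "moved_ex Move_Right = Add pE One"

definition all_moves :: "move list" where
  "all_moves = [Move_Left, Stay, Move_Right]"

lemma set_all_moves: "set all_moves = UNIV"
proof -
  have "m \<in> set all_moves" for m by (cases m) (simp_all add: all_moves_def)
  then show ?thesis by blast
qed

definition step_schemes :: "tm \<Rightarrow> scheme list" where
  "step_schemes M =
     [(Less tE TE, [(False, Head a, tE, pE), (False, Move a m, tE, Zero), (True, Head a, tE', moved_ex m)]).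
        a \<leftarrow> [0..<tapes M], m \<leftarrow> all_moves] @
     [(Less tE TE, [(False, Head a, tE, pE), (False, Write a s, tE, Zero), (True, Cell a s, tE', pE)]).
        a \<leftarrow> [0..<tapes M], s \<leftarrow> [0..<symbols M]] @
     [(And (Less tE TE) (Not (Eq pE oE)), [(False, Head a, tE, oE), (False, Cell a s, tE, pE), (True, Cell a s, tE', pE)]).
        a \<leftarrow> [0..<tapes M], s \<leftarrow> [0..<symbols M]]"

text \<open>Symbol 3 on cell 1 of the output tape is the answer True. The wrong states and symbols
  are banned, because asserting the right ones would not exclude them.\<close>

definition end_schemes :: "tm \<Rightarrow> scheme list" where
  "end_schemes M =
     map (\<lambda>q. (Eq tE TE, [(False, State q, tE, Zero)])) [0..<states M] @
     map (\<lambda>s. (Eq tE TE, [(False, Cell 1 s, tE, One)])) (filter (\<lambda>s. s \<noteq> 3) [0..<symbols M])"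

definition schemes :: "tm \<Rightarrow> scheme list" where
  "schemes M = start_schemes M @ input_schemes @ read_schemes M @ delta_schemes M @ step_schemes M @ end_schemes M"

text \<open>\<open>S\<close> exceeds every head position reachable in \<open>T\<close> steps and
  every cell of the input together with its certificate.\<close>

locale tableau =
  fixes M :: tm and w :: "nat list" and r :: "nat \<Rightarrow> nat" and n P T S :: nat
  assumes wf: "tm_wf M" and r: "r 0 = n" "r 2 = T" "r 3 = P" "r 4 = S"
    and S: "T + n + P + 4 \<le> S" and w: "length w = n" "set w \<subseteq> {2, 3}"
begin

abbreviation "sat \<alpha> cs \<equiv> \<forall>c \<in> set cs. scheme_sat w r T S \<alpha> c"

lemma ex_S: "(\<exists>x. x < S) \<longleftrightarrow> True"
  using S by (auto intro: exI[of _ 0])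

lemma start_sat: "sat \<alpha> (start_schemes M) \<longleftrightarrow> \<alpha> (State 0) 0 0 \<and> (\<forall>a < tapes M. \<alpha> (Head a) 0 0) \<and>
    (\<forall>a < tapes M. 0 < a \<longrightarrow> (\<forall>p < S. \<alpha> (Cell a (contents [] p)) 0 p))"
proof -
  have S0: "0 < S" using S by simp
  have 1: "scheme_sat w r T S \<alpha> (Eq tE Zero, [(True, \<kappa>, tE, Zero)]) \<longleftrightarrow> \<alpha> \<kappa> 0 0" for \<kappa>
    using S0 by (auto simp: scheme_sat_def ex_S)
  have 2: "scheme_sat w r T S \<alpha> (And (Eq tE Zero) (Eq pE Zero), [(True, \<kappa>, tE, pE)]) \<longleftrightarrow> \<alpha> \<kappa> 0 0" for \<kappa>
    using S0 by (auto simp: scheme_sat_def ex_S)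
  have 3: "scheme_sat w r T S \<alpha> (And (Eq tE Zero) (Less Zero pE), [(True, \<kappa>, tE, pE)]) \<longleftrightarrow> (\<forall>p < S. 0 < p \<longrightarrow> \<alpha> \<kappa> 0 p)" for \<kappa>
    using S0 by (auto simp: scheme_sat_def ex_S)
  have 4: "(\<forall>p < S. \<alpha> (Cell a (contents [] p)) 0 p) \<longleftrightarrow> \<alpha> (Cell a 1) 0 0 \<and> (\<forall>p < S. 0 < p \<longrightarrow> \<alpha> (Cell a 0) 0 p)" for a
    using S0 by (auto simp: contents_def)
  have "sat \<alpha> (start_schemes M) \<longleftrightarrow> \<alpha> (State 0) 0 0 \<and> (\<forall>a < tapes M. \<alpha> (Head a) 0 0) \<and>
      (\<forall>a \<in> {1..<tapes M}. \<alpha> (Cell a 1) 0 0) \<and> (\<forall>a \<in> {1..<tapes M}. \<forall>p < S. 0 < p \<longrightarrow> \<alpha> (Cell a 0) 0 p)"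
    unfolding start_schemes_def set_append ball_Un set_map ball_simps(9) list.set ball_simps(5,7) 1 2 3 by auto
  then show ?thesis unfolding 4 by auto
qed

lemma input_sat: "sat \<alpha> input_schemes \<longleftrightarrow> (\<forall>p \<le> n. \<alpha> (Cell 0 (contents w p)) 0 p) \<and> \<alpha> (Cell 0 4) 0 (n + 1) \<and>
    (\<forall>p < S. n + 2 + P \<le> p \<longrightarrow> \<alpha> (Cell 0 0) 0 p) \<and>
    (\<forall>p. n + 2 \<le> p \<and> p < n + 2 + P \<longrightarrow> \<alpha> (Cell 0 0) 0 p \<or> \<alpha> (Cell 0 2) 0 p \<or> \<alpha> (Cell 0 3) 0 p) \<and>
    (\<forall>p. n + 2 \<le> p \<and> p + 1 < S \<longrightarrow> \<alpha> (Cell 0 0) 0 p \<longrightarrow> \<alpha> (Cell 0 0) 0 (p + 1))"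
proof -
  have S0: "0 < S" "n + 1 < S" using S by simp_all
  have c5: "contents w p < 5" for p
  proof -
    have "set w \<subseteq> {2, 3, 4}" using w by auto
    from contents_le[OF this, of p] show ?thesis by simp
  qed
  have 1: "(\<forall>s \<in> set [0..<5]. scheme_sat w r T S \<alpha> (And (Eq tE Zero) (And (Less pE (Add nE One)) (Eq (In pE) (Num s))), [(True, Cell 0 s, tE, pE)]))
     \<longleftrightarrow> (\<forall>p \<le> n. \<alpha> (Cell 0 (contents w p)) 0 p)"
  proof -
    have "scheme_sat w r T S \<alpha> (And (Eq tE Zero) (And (Less pE (Add nE One)) (Eq (In pE) (Num s))), [(True, Cell 0 s, tE, pE)]) \<longleftrightarrow>
       (\<forall>p \<le> n. contents w p = s \<longrightarrow> \<alpha> (Cell 0 s) 0 p)" for s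
      using S by (auto simp: scheme_sat_def r ex_S)
    then show ?thesis using c5 by auto
  qed
  have 2: "scheme_sat w r T S \<alpha> (And (Eq tE Zero) (Eq pE (Add nE One)), [(True, Cell 0 4, tE, pE)]) \<longleftrightarrow> \<alpha> (Cell 0 4) 0 (n + 1)"
    using S0 by (auto simp: scheme_sat_def r ex_S Suc_le_eq)
  have 3: "scheme_sat w r T S \<alpha> (And (Eq tE Zero) (Less (Add (Add nE PE) One) pE), [(True, Cell 0 0, tE, pE)]) \<longleftrightarrow>
     (\<forall>p < S. n + 2 + P \<le> p \<longrightarrow> \<alpha> (Cell 0 0) 0 p)"
    using S0 by (auto simp: scheme_sat_def r ex_S Suc_le_eq)
  have 4: "scheme_sat w r T S \<alpha> (And (Eq tE Zero) (And (Less (Add nE One) pE) (Less pE (Add (Add nE PE) (Num 2)))),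
        [(True, Cell 0 0, tE, pE), (True, Cell 0 2, tE, pE), (True, Cell 0 3, tE, pE)]) \<longleftrightarrow>
     (\<forall>p < S. n + 2 \<le> p \<and> p < n + 2 + P \<longrightarrow> \<alpha> (Cell 0 0) 0 p \<or> \<alpha> (Cell 0 2) 0 p \<or> \<alpha> (Cell 0 3) 0 p)"
    by (auto simp: scheme_sat_def r ex_S Suc_le_eq)
  have 6: "(\<forall>p < S. n + 2 \<le> p \<and> p < n + 2 + P \<longrightarrow> Q p) \<longleftrightarrow> (\<forall>p. n + 2 \<le> p \<and> p < n + 2 + P \<longrightarrow> Q p)" for Q
  proof -
    have "p < S" if "p < n + 2 + P" for p using that S by linarith
    then show ?thesis by blast
  qed
  have 5: "scheme_sat w r T S \<alpha> (And (Eq tE Zero) (And (Less (Add nE One) pE) (Less (Add pE One) SE)),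
        [(False, Cell 0 0, tE, pE), (True, Cell 0 0, tE, Add pE One)]) \<longleftrightarrow>
     (\<forall>p < S. n + 2 \<le> p \<and> p + 1 < S \<longrightarrow> \<alpha> (Cell 0 0) 0 p \<longrightarrow> \<alpha> (Cell 0 0) 0 (p + 1))"
  proof -
    have z: "(\<forall>t \<le> T. \<forall>p < S. \<forall>o' < S. t = 0 \<and> G p \<longrightarrow> D t p) \<longleftrightarrow> (\<forall>p < S. G p \<longrightarrow> D 0 p)" for G and D :: "nat \<Rightarrow> nat \<Rightarrow> bool"
      using S0(1) by auto
    have "scheme_sat w r T S \<alpha> (And (Eq tE Zero) (And (Less (Add nE One) pE) (Less (Add pE One) SE)),
        [(False, Cell 0 0, tE, pE), (True, Cell 0 0, tE, Add pE One)]) \<longleftrightarrow>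
      (\<forall>t \<le> T. \<forall>p < S. \<forall>o' < S. t = 0 \<and> (n + 2 \<le> p \<and> p + 1 < S) \<longrightarrow> \<alpha> (Cell 0 0) t p \<longrightarrow> \<alpha> (Cell 0 0) t (p + 1))"
      unfolding scheme_sat_def fst_conv snd_conv by (intro all_cong imp_cong refl) (simp_all add: r Suc_le_eq)
    then show ?thesis unfolding z .
  qed
  have 7: "(\<forall>p < S. n + 2 \<le> p \<and> p + 1 < S \<longrightarrow> Q p) \<longleftrightarrow> (\<forall>p. n + 2 \<le> p \<and> p + 1 < S \<longrightarrow> Q p)" for Q
  proof -
    have "p < S" if "p + 1 < S" for p using that by linarith
    then show ?thesis by blast
  qed
  show ?thesis
    unfolding input_schemes_def set_append ball_Un set_map ball_simps(9) list.set ball_simps(5,7) ball_empty 1 2 3 4 5 6 7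
    by (simp only: conj_assoc simp_thms)
qed

lemma read_sat: "sat \<alpha> (read_schemes M) \<longleftrightarrow> (\<forall>a < tapes M. \<forall>s < symbols M. \<forall>t \<le> T. \<forall>p < S.
    \<alpha> (Head a) t p \<longrightarrow> \<alpha> (Cell a s) t p \<longrightarrow> \<alpha> (Read a s) t 0)"
proof -
  have 1: "scheme_sat w r T S \<alpha> (One, [(False, Head a, tE, pE), (False, Cell a s, tE, pE), (True, Read a s, tE, Zero)]) \<longleftrightarrow>
     (\<forall>t \<le> T. \<forall>p < S. \<alpha> (Head a) t p \<longrightarrow> \<alpha> (Cell a s) t p \<longrightarrow> \<alpha> (Read a s) t 0)" for a s
    by (auto simp: scheme_sat_def ex_S)
  have "sat \<alpha> (read_schemes M) \<longleftrightarrow> (\<forall>a < tapes M. \<forall>s < symbols M. scheme_sat w r T S \<alpha>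
      (One, [(False, Head a, tE, pE), (False, Cell a s, tE, pE), (True, Read a s, tE, Zero)]))"
    by (auto simp: read_schemes_def)
  then show ?thesis unfolding 1 .
qed

definition cond :: "(kind \<Rightarrow> nat \<Rightarrow> nat \<Rightarrow> bool) \<Rightarrow> nat \<Rightarrow> nat list \<Rightarrow> nat \<Rightarrow> bool" where
  "cond \<alpha> q ss t \<longleftrightarrow> \<alpha> (State q) t 0 \<and> (\<forall>a < length ss. \<alpha> (Read a (ss ! a)) t 0)"

lemma conditions_sat:
  "scheme_sat w r T S \<alpha> (Less tE TE, conditions q ss @ [(True, \<kappa>, tE', Zero)]) \<longleftrightarrow>
     (\<forall>t < T. cond \<alpha> q ss t \<longrightarrow> \<alpha> \<kappa> (t + 1) 0)"
  "scheme_sat w r T S \<alpha> (Less tE TE, conditions q ss @ [(True, \<kappa>, tE, Zero)]) \<longleftrightarrow>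
     (\<forall>t < T. cond \<alpha> q ss t \<longrightarrow> \<alpha> \<kappa> t 0)"
proof -
  have b: "(\<exists>x \<in> set (conditions q ss @ [l]). Q x) \<longleftrightarrow> Q (False, State q, tE, Zero) \<or>
      (\<exists>a < length ss. Q (False, Read a (ss ! a), tE, Zero)) \<or> Q l" for Q l
    by (auto simp: conditions_def)
  show "scheme_sat w r T S \<alpha> (Less tE TE, conditions q ss @ [(True, \<kappa>, tE', Zero)]) \<longleftrightarrow>
     (\<forall>t < T. cond \<alpha> q ss t \<longrightarrow> \<alpha> \<kappa> (t + 1) 0)"
    unfolding scheme_sat_def snd_conv b by (auto simp: cond_def r ex_S; meson less_imp_le)
  show "scheme_sat w r T S \<alpha> (Less tE TE, conditions q ss @ [(True, \<kappa>, tE, Zero)]) \<longleftrightarrow>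
     (\<forall>t < T. cond \<alpha> q ss t \<longrightarrow> \<alpha> \<kappa> t 0)"
    unfolding scheme_sat_def snd_conv b by (auto simp: cond_def r ex_S; meson less_imp_le)
qed

lemma delta_sat: "sat \<alpha> (delta_schemes M) \<longleftrightarrow> (\<forall>q \<le> states M. \<forall>ss. length ss = tapes M \<and> set ss \<subseteq> {..<symbols M} \<longrightarrow>
    (\<forall>t < T. cond \<alpha> q ss t \<longrightarrow> \<alpha> (State (fst (tm_delta M q ss))) (t + 1) 0 \<and>
      (\<forall>a < tapes M. \<alpha> (Write a (fst (snd (tm_delta M q ss) ! a))) t 0 \<and> \<alpha> (Move a (snd (snd (tm_delta M q ss) ! a))) t 0)))"
proof -
  have L: "set (List.n_lists (tapes M) [0..<symbols M]) = {ss. length ss = tapes M \<and> set ss \<subseteq> {..<symbols M}}"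
    by (simp add: set_n_lists atLeast0LessThan)
  have q: "set [0..<Suc (states M)] = {..states M}"
    by (simp add: atLeast0LessThan lessThan_Suc_atMost del: upt_Suc)
  have "(\<forall>c \<in> set (delta_schemes M). Q c) \<longleftrightarrow> (\<forall>q \<le> states M. \<forall>ss. length ss = tapes M \<and> set ss \<subseteq> {..<symbols M} \<longrightarrow>
     Q (Less tE TE, conditions q ss @ [(True, State (fst (tm_delta M q ss)), tE', Zero)])) \<and>
     (\<forall>q \<le> states M. \<forall>ss. length ss = tapes M \<and> set ss \<subseteq> {..<symbols M} \<longrightarrow>
     (\<forall>a < tapes M. Q (Less tE TE, conditions q ss @ [(True, Write a (fst (snd (tm_delta M q ss) ! a)), tE, Zero)]))) \<and>
     (\<forall>q \<le> states M. \<forall>ss. length ss = tapes M \<and> set ss \<subseteq> {..<symbols M} \<longrightarrow>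
     (\<forall>a < tapes M. Q (Less tE TE, conditions q ss @ [(True, Move a (snd (snd (tm_delta M q ss) ! a)), tE, Zero)])))" for Q
    unfolding delta_schemes_def set_append ball_Un set_concat set_map q by (simp add: L del: upt_Suc) (simp only: Ball_def atMost_iff atLeast0LessThan lessThan_iff)
  from this[of "scheme_sat w r T S \<alpha>"] show ?thesis
    unfolding conditions_sat by blast
qed

lemma step_sat: "sat \<alpha> (step_schemes M) \<longleftrightarrow> (\<forall>a < tapes M. \<forall>t < T. \<forall>p < S.
    (\<forall>m. \<alpha> (Head a) t p \<longrightarrow> \<alpha> (Move a m) t 0 \<longrightarrow> move_head m p < S \<and> \<alpha> (Head a) (t + 1) (move_head m p)) \<and>
    (\<forall>s < symbols M. \<alpha> (Head a) t p \<longrightarrow> \<alpha> (Write a s) t 0 \<longrightarrow> \<alpha> (Cell a s) (t + 1) p) \<and>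
    (\<forall>s < symbols M. \<forall>o' < S. o' \<noteq> p \<longrightarrow> \<alpha> (Head a) t o' \<longrightarrow> \<alpha> (Cell a s) t p \<longrightarrow> \<alpha> (Cell a s) (t + 1) p))"
proof -
  have S0: "0 < S" using S by simp
  have ev: "eval (moved_ex m) w (r(10 := t, 11 := p, 12 := o')) = move_head m p" for m t p o'
    by (cases m) auto
  have 1: "scheme_sat w r T S \<alpha> (Less tE TE, [(False, Head a, tE, pE), (False, Move a m, tE, Zero), (True, Head a, tE', moved_ex m)]) \<longleftrightarrow>
     (\<forall>t < T. \<forall>p < S. \<alpha> (Head a) t p \<longrightarrow> \<alpha> (Move a m) t 0 \<longrightarrow> move_head m p < S \<and> \<alpha> (Head a) (t + 1) (move_head m p))" for a m
    by (auto simp: scheme_sat_def r ev ex_S; meson less_imp_le)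
  have 2: "scheme_sat w r T S \<alpha> (Less tE TE, [(False, Head a, tE, pE), (False, Write a s, tE, Zero), (True, Cell a s, tE', pE)]) \<longleftrightarrow>
     (\<forall>t < T. \<forall>p < S. \<alpha> (Head a) t p \<longrightarrow> \<alpha> (Write a s) t 0 \<longrightarrow> \<alpha> (Cell a s) (t + 1) p)" for a s
    by (auto simp: scheme_sat_def r ex_S; meson less_imp_le)
  have 3: "scheme_sat w r T S \<alpha> (And (Less tE TE) (Not (Eq pE oE)), [(False, Head a, tE, oE), (False, Cell a s, tE, pE), (True, Cell a s, tE', pE)]) \<longleftrightarrow>
     (\<forall>t < T. \<forall>p < S. \<forall>o' < S. o' \<noteq> p \<longrightarrow> \<alpha> (Head a) t o' \<longrightarrow> \<alpha> (Cell a s) t p \<longrightarrow> \<alpha> (Cell a s) (t + 1) p)" for a s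
    by (auto simp: scheme_sat_def r ex_S; meson less_imp_le)
  have "(\<forall>c \<in> set (step_schemes M). Q c) \<longleftrightarrow>
     (\<forall>a < tapes M. \<forall>m. Q (Less tE TE, [(False, Head a, tE, pE), (False, Move a m, tE, Zero), (True, Head a, tE', moved_ex m)])) \<and>
     (\<forall>a < tapes M. \<forall>s < symbols M. Q (Less tE TE, [(False, Head a, tE, pE), (False, Write a s, tE, Zero), (True, Cell a s, tE', pE)])) \<and>
     (\<forall>a < tapes M. \<forall>s < symbols M. Q (And (Less tE TE) (Not (Eq pE oE)), [(False, Head a, tE, oE), (False, Cell a s, tE, pE), (True, Cell a s, tE', pE)]))" for Q
    unfolding step_schemes_def set_append ball_Un set_concat set_map
    by (simp add: set_all_moves del: upt_Suc) (simp only: Ball_def atLeast0LessThan lessThan_iff)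
  note * = this[of "scheme_sat w r T S \<alpha>"]
  have swap: "(\<forall>a < A. \<forall>m. \<forall>t < T. \<forall>p < S. X a m t p) \<and> (\<forall>a < A. \<forall>s < B. \<forall>t < T. \<forall>p < S. Y a s t p) \<and>
       (\<forall>a < A. \<forall>s < B. \<forall>t < T. \<forall>p < S. Z a s t p) \<longleftrightarrow>
     (\<forall>a < A. \<forall>t < T. \<forall>p < S. (\<forall>m. X a m t p) \<and> (\<forall>s < B. Y a s t p) \<and> (\<forall>s < B. Z a s t p))"
    for A B :: nat and X :: "nat \<Rightarrow> move \<Rightarrow> nat \<Rightarrow> nat \<Rightarrow> bool" and Y Z :: "nat \<Rightarrow> nat \<Rightarrow> nat \<Rightarrow> nat \<Rightarrow> bool"
    by blast
  show ?thesis using * unfolding 1 2 3 swap .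
qed

lemma end_sat: "sat \<alpha> (end_schemes M) \<longleftrightarrow> (\<forall>q < states M. \<not> \<alpha> (State q) T 0) \<and>
    (\<forall>s < symbols M. s \<noteq> 3 \<longrightarrow> \<not> \<alpha> (Cell 1 s) T 1)"
proof -
  have S1: "0 < S" "1 < S" using S by simp_all
  have 1: "scheme_sat w r T S \<alpha> (Eq tE TE, [(False, \<kappa>, tE, Zero)]) \<longleftrightarrow> \<not> \<alpha> \<kappa> T 0" for \<kappa>
    using S1 by (auto simp: scheme_sat_def r ex_S)
  have 2: "scheme_sat w r T S \<alpha> (Eq tE TE, [(False, \<kappa>, tE, One)]) \<longleftrightarrow> \<not> \<alpha> \<kappa> T 1" for \<kappa>
    using S1 by (auto simp: scheme_sat_def r ex_S)
  show ?thesis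
    unfolding end_schemes_def set_append ball_Un set_map ball_simps(9) 1 2 by auto
qed

lemma all_schemes: "sat \<alpha> (schemes M) \<longleftrightarrow> sat \<alpha> (start_schemes M) \<and> sat \<alpha> input_schemes \<and> sat \<alpha> (read_schemes M) \<and>
    sat \<alpha> (delta_schemes M) \<and> sat \<alpha> (step_schemes M) \<and> sat \<alpha> (end_schemes M)"
  unfolding schemes_def set_append ball_Un by blast

end

section \<open>Runs of a well-formed machine as assignments\<close>

definition ok_config :: "tm \<Rightarrow> config \<Rightarrow> bool" where
  "ok_config M c \<longleftrightarrow> fst c \<le> states M \<and> length (snd c) = tapes M \<and>
     (\<forall>a < tapes M. \<forall>p. fst (snd c ! a) p < symbols M)"

lemma step_tm_delta: "step M (q, ts) = (fst (tm_delta M q (reads ts)), map2 act (snd (tm_delta M q (reads ts))) ts)"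
proof (cases "states M \<le> q")
  case False
  then show ?thesis unfolding step.simps reads_def[symmetric] tm_delta_def by (simp add: case_prod_unfold)
qed (simp add: tm_delta_def map2_act_idle)

lemma reads_ok:
  assumes "ok_config M (q, ts)"
  shows "length (reads ts) = tapes M" "set (reads ts) \<subseteq> {..<symbols M}"
    "a < tapes M \<Longrightarrow> reads ts ! a = fst (ts ! a) (snd (ts ! a))"
proof -
  have l: "length ts = tapes M" using assms by (simp add: ok_config_def)
  show n: "reads ts ! a = fst (ts ! a) (snd (ts ! a))" if "a < tapes M" for a
    using that l by (simp add: reads_def case_prod_unfold)
  show "length (reads ts) = tapes M" using l by (simp add: reads_def)
  then show "set (reads ts) \<subseteq> {..<symbols M}"
    using n assms unfolding ok_config_def by (auto simp: in_set_conv_nth)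
qed

lemma tm_delta_ok:
  assumes "tm_wf M" "q \<le> states M" "length ss = tapes M" "set ss \<subseteq> {..<symbols M}"
  shows "fst (tm_delta M q ss) \<le> states M" "length (snd (tm_delta M q ss)) = tapes M"
    "a < tapes M \<Longrightarrow> fst (snd (tm_delta M q ss) ! a) < symbols M"
proof -
  have *: "fst (tm_delta M q ss) \<le> states M \<and> length (snd (tm_delta M q ss)) = tapes M \<and>
      fst ` set (snd (tm_delta M q ss)) \<subseteq> {..<symbols M}"
  proof (cases "states M \<le> q")
    case True
    then show ?thesis using assms by (simp add: tm_delta_def idle_ok)
  next
    case False
    then have "case delta M q ss of (q', as) \<Rightarrow> q' \<le> states M \<and> length as = tapes M \<and> fst ` set as \<subseteq> {..<symbols M}"
      using assms unfolding tm_wf_def by (meson not_le)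
    then show ?thesis using False by (simp add: tm_delta_def case_prod_unfold)
  qed
  then show "fst (tm_delta M q ss) \<le> states M" "length (snd (tm_delta M q ss)) = tapes M" by blast+
  assume "a < tapes M"
  then have "snd (tm_delta M q ss) ! a \<in> set (snd (tm_delta M q ss))" using * by (intro nth_mem) simp
  then show "fst (snd (tm_delta M q ss) ! a) < symbols M" using * by auto
qed

lemma step_nth:
  assumes "tm_wf M" "ok_config M (q, ts)" "a < tapes M"
  shows "snd (step M (q, ts)) ! a = act (snd (tm_delta M q (reads ts)) ! a) (ts ! a)"
proof -
  have "length ts = tapes M" "q \<le> states M" using assms(2) by (simp_all add: ok_config_def)
  then show ?thesis
    using tm_delta_ok(2)[OF assms(1) _ reads_ok(1,2)[OF assms(2)]] assms(3)
    unfolding step_tm_delta by simp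
qed

lemma ok_step:
  assumes "tm_wf M" "ok_config M c"
  shows "ok_config M (step M c)"
proof -
  obtain q ts where c: "c = (q, ts)" by (cases c)
  note ok = assms(2)[unfolded c]
  have l: "length ts = tapes M" "q \<le> states M" using ok by (simp_all add: ok_config_def)
  note d = tm_delta_ok[OF assms(1) l(2) reads_ok(1,2)[OF ok]]
  have "fst (snd (step M (q, ts)) ! a) p < symbols M" if a: "a < tapes M" for a p
  proof -
    obtain b m where bm: "snd (tm_delta M q (reads ts)) ! a = (b, m)" by (cases "snd (tm_delta M q (reads ts)) ! a")
    obtain f h where fh: "ts ! a = (f, h)" by (cases "ts ! a")
    have "fst (ts ! a) p < symbols M" using ok a by (simp add: ok_config_def)
    then show ?thesis unfolding step_nth[OF assms(1) ok a] using d(3)[OF a] by (simp add: bm fh)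
  qed
  moreover have "fst (step M (q, ts)) \<le> states M" "length (snd (step M (q, ts))) = tapes M"
    unfolding step_tm_delta using d(1,2) l by simp_all
  ultimately show ?thesis unfolding c ok_config_def by blast
qed

locale run = tableau +
  fixes y :: "bool list"
  assumes y: "length y \<le> P"
begin

definition "input = w @ [4] @ bits y"
definition "cfg t = (step M ^^ t) (init M input)"
definition "st t = fst (cfg t)"
definition "cell t a = fst (snd (cfg t) ! a)"
definition "head t a = snd (snd (cfg t) ! a)"
definition "dl t = tm_delta M (st t) (reads (snd (cfg t)))"

lemma input_contents:
  "p \<le> n \<Longrightarrow> contents input p = contents w p" "contents input (n + 1) = 4"
  "j < length y \<Longrightarrow> contents input (n + 2 + j) = (if y ! j then 3 else 2)"
  "n + 2 + length y \<le> p \<Longrightarrow> contents input p = 0"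
  using w by (auto simp: input_def contents_def nth_append bits_def)

lemma tapes2: "2 \<le> tapes M" "5 \<le> symbols M"
  using wf by (simp_all add: tm_wf_def)

lemma start:
  "st 0 = 0" "a < tapes M \<Longrightarrow> head 0 a = 0" "cell 0 0 = contents input"
  "0 < a \<Longrightarrow> a < tapes M \<Longrightarrow> cell 0 a = contents []"
  using tapes2 by (auto simp: st_def head_def cell_def cfg_def init_def nth_Cons')

lemma ok_cfg: "ok_config M (cfg t)"
proof (induction t)
  case 0
  have "contents input p < 5" for p
    using contents_le[of input p] w(2) by (fastforce simp: input_def bits_def)
  then have "contents input p < symbols M" for p using tapes2 by (meson less_le_trans)
  then show ?case using tapes2 by (auto simp: ok_config_def cfg_def init_def nth_Cons' contents_def)
next
  case (Suc t)
  then show ?case using ok_step[OF wf Suc] by (simp add: cfg_def)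
qed

lemma ok': "ok_config M (st t, snd (cfg t))" "st t \<le> states M"
  using ok_cfg[of t] by (simp_all add: st_def ok_config_def)

lemma rd: "length (reads (snd (cfg t))) = tapes M" "set (reads (snd (cfg t))) \<subseteq> {..<symbols M}"
  "a < tapes M \<Longrightarrow> reads (snd (cfg t)) ! a = cell t a (head t a)"
  using reads_ok[OF ok'(1)[of t]] by (simp_all add: cell_def head_def)

lemma cell_less: "a < tapes M \<Longrightarrow> cell t a p < symbols M"
  using ok_cfg[of t] by (simp add: ok_config_def cell_def)

lemma next_st: "st (t + 1) = fst (dl t)"
  using step_tm_delta[of M "st t" "snd (cfg t)"] by (simp add: st_def cfg_def dl_def)

lemma next_tape:
  assumes "a < tapes M"
  shows "head (t + 1) a = move_head (snd (snd (dl t) ! a)) (head t a)"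
    "cell (t + 1) a = (cell t a)(head t a := fst (snd (dl t) ! a))"
proof -
  have "snd (cfg (t + 1)) ! a = act (snd (dl t) ! a) (snd (cfg t) ! a)"
    using step_nth[OF wf ok'(1)[of t] assms] by (simp add: st_def cfg_def dl_def)
  then show "head (t + 1) a = move_head (snd (snd (dl t) ! a)) (head t a)"
    "cell (t + 1) a = (cell t a)(head t a := fst (snd (dl t) ! a))"
    unfolding head_def cell_def
    by (metis (no_types, lifting) act.simps fst_conv snd_conv prod.collapse)+
qed

lemma dl_less: "a < tapes M \<Longrightarrow> fst (snd (dl t) ! a) < symbols M"
  unfolding dl_def by (rule tm_delta_ok(3)[OF wf ok'(2) rd(1,2)])

lemma move_head_le: "move_head m h \<le> h + 1"
  by (cases m) auto

lemma head_le: "a < tapes M \<Longrightarrow> head t a \<le> t"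
proof (induction t)
  case (Suc t)
  then show ?case using next_tape(1)[OF Suc.prems, of t] move_head_le[of "snd (snd (dl t) ! a)" "head t a"] by simp
qed (simp add: start)

definition accept :: bool where
  "accept \<longleftrightarrow> st T = states M \<and> cell T 1 1 = 3"

fun truth :: "kind \<Rightarrow> nat \<Rightarrow> nat \<Rightarrow> bool" where
  "truth (Head a) t p \<longleftrightarrow> head t a = p"
| "truth (Cell a s) t p \<longleftrightarrow> cell t a p = s"
| "truth (State q) t p \<longleftrightarrow> st t = q"
| "truth (Read a s) t p \<longleftrightarrow> cell t a (head t a) = s"
| "truth (Write a s) t p \<longleftrightarrow> fst (snd (dl t) ! a) = s"
| "truth (Move a m) t p \<longleftrightarrow> snd (snd (dl t) ! a) = m"

lemma truth_sat:
  assumes accept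
  shows "sat truth (schemes M)"
  unfolding all_schemes
proof (intro conjI)
  show "sat truth (start_schemes M)" unfolding start_sat using start by simp
  show "sat truth input_schemes"
    unfolding input_sat
  proof (intro conjI allI impI)
    show "truth (Cell 0 (contents w p)) 0 p" if "p \<le> n" for p
      using input_contents(1)[OF that] by (simp add: start)
    show "truth (Cell 0 4) 0 (n + 1)" using input_contents(2) by (simp add: start)
    show "truth (Cell 0 0) 0 p" if "n + 2 + P \<le> p" for p
      using input_contents(4)[of p] that y by (simp add: start)
    show "truth (Cell 0 0) 0 p \<or> truth (Cell 0 2) 0 p \<or> truth (Cell 0 3) 0 p" if "n + 2 \<le> p \<and> p < n + 2 + P" for p
    proof -
      have "p = n + 2 + (p - (n + 2))" using that by linarith
      then obtain j where j: "p = n + 2 + j" by blast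
      show ?thesis using input_contents(3)[of j] input_contents(4)[of p] unfolding j
        by (cases "j < length y") (auto simp: start)
    qed
    show "truth (Cell 0 0) 0 (p + 1)" if "n + 2 \<le> p \<and> p + 1 < S" "truth (Cell 0 0) 0 p" for p
    proof -
      have "p = n + 2 + (p - (n + 2))" using that by linarith
      then obtain j where j: "p = n + 2 + j" by blast
      have "contents input (n + 2 + j) = 0" using that(2) unfolding j by (simp only: truth.simps start)
      then have "\<not> j < length y" using input_contents(3)[of j] by (auto split: if_splits)
      then show ?thesis using input_contents(4)[of "p + 1"] unfolding j by (simp add: start)
    qed
  qed
  show "sat truth (read_schemes M)" unfolding read_sat by auto
  show "sat truth (delta_schemes M)"
    unfolding delta_sat
  proof (intro allI impI)
    fix q ss t assume ss: "length ss = tapes M \<and> set ss \<subseteq> {..<symbols M}" and c: "cond truth q ss t"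
    have "ss = reads (snd (cfg t))"
      by (rule nth_equalityI) (use ss c rd in \<open>auto simp: cond_def\<close>)
    moreover have "st t = q" using c by (simp add: cond_def)
    ultimately have "tm_delta M q ss = dl t" by (simp add: dl_def)
    then show "truth (State (fst (tm_delta M q ss))) (t + 1) 0 \<and>
      (\<forall>a < tapes M. truth (Write a (fst (snd (tm_delta M q ss) ! a))) t 0 \<and> truth (Move a (snd (snd (tm_delta M q ss) ! a))) t 0)"
      using next_st[of t] by simp
  qed
  show "sat truth (step_schemes M)"
    unfolding step_sat
  proof (intro allI impI conjI)
    fix a t p m assume *: "a < tapes M" "t < T" "truth (Head a) t p" "truth (Move a m) t 0"
    show "move_head m p < S" using head_le[OF *(1), of t] move_head_le[of m p] * S by simp
    show "truth (Head a) (t + 1) (move_head m p)" using next_tape(1)[OF *(1), of t] * by simp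
  next
    fix a t p s assume *: "a < tapes M" "truth (Head a) t p" "truth (Write a s) t 0"
    then show "truth (Cell a s) (t + 1) p" using next_tape(2)[OF *(1), of t] by simp
  next
    fix a t p s o' assume *: "a < tapes M" "o' \<noteq> p" "truth (Head a) t o'" "truth (Cell a s) t p"
    then show "truth (Cell a s) (t + 1) p" using next_tape(2)[OF *(1), of t] by auto
  qed
  show "sat truth (end_schemes M)" unfolding end_sat using assms by (simp add: accept_def)
qed

text \<open>
  The clauses only force the true facts to hold; an assignment may make others true as well, but the
  end clauses then still refute every wrong final state.
\<close>

lemma sat_true:
  assumes sat: "sat \<alpha> (schemes M)" and inp: "\<And>p. p < S \<Longrightarrow> \<alpha> (Cell 0 (contents input p)) 0 p"
  shows "t \<le> T \<Longrightarrow> \<alpha> (State (st t)) t 0 \<and> (\<forall>a < tapes M. \<alpha> (Head a) t (head t a) \<and> (\<forall>p < S. \<alpha> (Cell a (cell t a p)) t p))"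
proof (induction t)
  case 0
  have "\<alpha> (Cell a (cell 0 a p)) 0 p" if "a < tapes M" "p < S" for a p
    using sat inp[OF that(2)] that start(3) start(4)[of a] unfolding all_schemes start_sat by (cases "a = 0") auto
  then show ?case using sat start unfolding all_schemes start_sat by simp
next
  case (Suc t)
  then have t: "t < T" and IH: "\<alpha> (State (st t)) t 0" "\<And>a. a < tapes M \<Longrightarrow> \<alpha> (Head a) t (head t a)"
    "\<And>a p. a < tapes M \<Longrightarrow> p < S \<Longrightarrow> \<alpha> (Cell a (cell t a p)) t p" by auto
  have h: "head t a < S" if "a < tapes M" for a using head_le[OF that, of t] t S by simp
  have rdt: "\<alpha> (Read a (cell t a (head t a))) t 0" if "a < tapes M" for a
    using sat t that IH(2,3)[OF that] h[OF that] cell_less[OF that] unfolding all_schemes read_sat by (meson less_imp_le)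
  have "cond \<alpha> (st t) (reads (snd (cfg t))) t"
    unfolding cond_def using IH(1) rdt rd by simp
  then have d: "\<alpha> (State (fst (dl t))) (t + 1) 0"
    "\<And>a. a < tapes M \<Longrightarrow> \<alpha> (Write a (fst (snd (dl t) ! a))) t 0 \<and> \<alpha> (Move a (snd (snd (dl t) ! a))) t 0"
    using sat ok'(2)[of t] rd(1,2)[of t] t unfolding all_schemes delta_sat dl_def by blast+
  have step: "sat \<alpha> (step_schemes M)" using sat unfolding all_schemes by blast
  have step': "\<alpha> (Head a) t p \<Longrightarrow> \<alpha> (Move a m) t 0 \<Longrightarrow> \<alpha> (Head a) (t + 1) (move_head m p)"
    "s < symbols M \<Longrightarrow> \<alpha> (Head a) t p \<Longrightarrow> \<alpha> (Write a s) t 0 \<Longrightarrow> \<alpha> (Cell a s) (t + 1) p"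
    "s < symbols M \<Longrightarrow> o' < S \<Longrightarrow> o' \<noteq> p \<Longrightarrow> \<alpha> (Head a) t o' \<Longrightarrow> \<alpha> (Cell a s) t p \<Longrightarrow> \<alpha> (Cell a s) (t + 1) p"
    if "a < tapes M" "p < S" for a p m s o'
    using step[unfolded step_sat] t that by blast+
  have "\<alpha> (Head a) (t + 1) (head (t + 1) a)" if a: "a < tapes M" for a
    using step'(1)[OF a h[OF a] IH(2)[OF a]] d(2)[OF a] unfolding next_tape(1)[OF a] by blast
  moreover have "\<alpha> (Cell a (cell (t + 1) a p)) (t + 1) p" if a: "a < tapes M" and p: "p < S" for a p
  proof (cases "p = head t a")
    case True
    then show ?thesis
      using step'(2)[OF a p dl_less[OF a, of t]] IH(2)[OF a] d(2)[OF a] unfolding next_tape(2)[OF a] by simp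
  next
    case False
    then show ?thesis
      using step'(3)[OF a p cell_less[OF a] h[OF a]] IH(2)[OF a] IH(3)[OF a p] unfolding next_tape(2)[OF a] by simp
  qed
  ultimately show ?case using d(1) unfolding next_st[symmetric] by simp
qed

lemma sat_accept:
  assumes sat: "sat \<alpha> (schemes M)" and inp: "\<And>p. p < S \<Longrightarrow> \<alpha> (Cell 0 (contents input p)) 0 p"
  shows accept
proof -
  have fin: "\<alpha> (State (st T)) T 0" "\<alpha> (Cell 1 (cell T 1 1)) T 1"
    using sat_true[OF sat inp, of T] tapes2 S by auto
  have e: "\<forall>q < states M. \<not> \<alpha> (State q) T 0" "\<forall>s < symbols M. s \<noteq> 3 \<longrightarrow> \<not> \<alpha> (Cell 1 s) T 1"
    using sat unfolding all_schemes end_sat by blast+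
  have "st T = states M" using e(1) fin(1) ok'(2)[of T] by (meson le_neq_implies_less)
  moreover have "cell T 1 1 = 3" using e(2) fin(2) cell_less[of 1 T 1] tapes2 by auto
  ultimately show ?thesis by (simp add: accept_def)
qed

end

context tableau
begin

theorem sat_iff: "(\<exists>\<alpha>. sat \<alpha> (schemes M)) \<longleftrightarrow> (\<exists>y. length y \<le> P \<and> run.accept M w T y)"
proof
  assume "\<exists>\<alpha>. sat \<alpha> (schemes M)"
  then obtain \<alpha> where sat: "sat \<alpha> (schemes M)" by blast
  then have inp: "\<And>p. p \<le> n \<Longrightarrow> \<alpha> (Cell 0 (contents w p)) 0 p" "\<alpha> (Cell 0 4) 0 (n + 1)"
    "\<And>p. p < S \<Longrightarrow> n + 2 + P \<le> p \<Longrightarrow> \<alpha> (Cell 0 0) 0 p"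
    "\<And>p. n + 2 \<le> p \<Longrightarrow> p < n + 2 + P \<Longrightarrow> \<alpha> (Cell 0 0) 0 p \<or> \<alpha> (Cell 0 2) 0 p \<or> \<alpha> (Cell 0 3) 0 p"
    "\<And>p. n + 2 \<le> p \<Longrightarrow> p + 1 < S \<Longrightarrow> \<alpha> (Cell 0 0) 0 p \<Longrightarrow> \<alpha> (Cell 0 0) 0 (p + 1)"
    unfolding all_schemes input_sat by blast+
  \<comment> \<open>The guessed certificate ends at the first cell that is assigned a blank, or
    after \<open>P\<close> cells. A cell that is assigned both bits is read as True.\<close>
  define l where "l = (LEAST j. j = P \<or> \<alpha> (Cell 0 0) 0 (n + 2 + j))"
  define y where "y = map (\<lambda>j. \<alpha> (Cell 0 3) 0 (n + 2 + j)) [0..<l]"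
  have l: "l = P \<or> \<alpha> (Cell 0 0) 0 (n + 2 + l)" "l \<le> P"
    unfolding l_def by (rule LeastI[of _ P]; simp) (rule Least_le; simp)
  have before: "j \<noteq> P \<and> \<not> \<alpha> (Cell 0 0) 0 (n + 2 + j)" if "j < l" for j
    using not_less_Least[OF that[unfolded l_def]] by blast
  have after: "\<alpha> (Cell 0 0) 0 (n + 2 + l + i)" if "n + 2 + l + i < S" for i
    using that
  proof (induction i)
    case 0
    then show ?case using l inp(3)[of "n + 2 + l"] by auto
  next
    case (Suc i)
    then show ?case using inp(5)[of "n + 2 + l + i"] by simp
  qed
  interpret run M w r n P T S y
    by unfold_locales (simp add: y_def l)
  have "\<alpha> (Cell 0 (contents input p)) 0 p" if p: "p < S" for p
  proof -
    consider "p \<le> n" | "p = n + 1" | j where "p = n + 2 + j" "j < l" | i where "p = n + 2 + l + i"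
    proof -
      have "p \<le> n \<or> p = n + 1 \<or> (p = n + 2 + (p - (n + 2)) \<and> p - (n + 2) < l) \<or> p = n + 2 + l + (p - (n + 2 + l))"
        by linarith
      then show ?thesis using that by blast
    qed
    then show ?thesis
    proof cases
      case 1
      then show ?thesis using inp(1) input_contents(1) by simp
    next
      case 2
      then show ?thesis using inp(2) input_contents(2) by simp
    next
      case (3 j)
      have "\<alpha> (Cell 0 2) 0 p \<or> \<alpha> (Cell 0 3) 0 p" using inp(4)[of p] before[OF 3(2)] 3 l(2) by auto
      then show ?thesis using input_contents(3)[of j] 3 by (auto simp: y_def)
    next
      case (4 i)
      then show ?thesis using input_contents(4)[of p] after[of i] p by (simp add: y_def)
    qed
  qed
  then have accept by (rule sat_accept[OF sat])
  then show "\<exists>y. length y \<le> P \<and> run.accept M w T y" using y by blast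
next
  assume "\<exists>y. length y \<le> P \<and> run.accept M w T y"
  then obtain y' where y': "length y' \<le> P" "run.accept M w T y'" by blast
  interpret run M w r n P T S y'
    by unfold_locales (rule y')
  show "\<exists>\<alpha>. sat \<alpha> (schemes M)" using truth_sat[OF y'(2)] by blast
qed

end

section \<open>The cell gadget and its drawing\<close>

definition cell_edges :: "(nat \<times> nat \<times> nat \<times> nat) list" where
  "cell_edges = [
    (0,0,0,14), (0,0,0,16), (0,0,0,17), (1,0,0,15), (1,0,0,16), (1,0,0,18), (1,0,0,20), (2,0,0,16),
    (2,0,0,17), (2,0,0,18), (2,0,0,20), (2,0,0,19), (2,0,0,21), (3,0,0,23), (3,0,0,17), (3,0,0,19),
    (3,0,0,21), (4,0,0,22), (4,0,0,18), (4,0,0,19), (5,0,0,22), (6,0,0,23), (6,0,0,24), (5,0,1,14),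
    (6,1,0,15), (0,0,0,7), (8,0,0,0), (2,0,0,8), (9,0,0,2), (4,0,0,9), (10,0,0,4), (5,0,0,10),
    (11,0,0,2), (1,0,0,11), (12,0,0,4), (3,0,0,12), (13,0,0,3), (6,0,0,13), (5,0,1,7), (6,1,0,7),
    (7,0,0,25), (7,0,0,26), (8,0,0,27), (8,0,0,28), (9,0,0,29), (9,0,0,30), (10,0,0,31),
    (10,0,0,32), (11,0,0,33), (11,0,0,34), (12,0,0,35), (12,0,0,36), (13,0,0,37), (13,0,0,38),
    (0,0,0,39), (4,0,0,40), (4,0,0,41), (5,0,0,42), (5,0,0,43), (6,0,0,44), (14,0,0,45),
    (15,0,0,46), (24,0,0,47)]"

text \<open>Positions inside a box of width 26 and height 24, the horizontal and vertical periods of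
  the mesh. Integer coordinates make all crossing tests decidable by evaluation.\<close>

definition cell_points :: "(int \<times> int) list" where
  "cell_points = [
    (5,9), (11,3), (11,9), (11,15), (17,9), (23,9), (11,21), (1,6), (8,9), (14,9), (20,6), (10,6),
    (18,16), (14,18), (1,9), (11,0), (7,5), (7,13), (15,5), (15,13), (12,6), (11,12), (20,9),
    (11,18), (14,21), (0,5), (2,5), (8,8), (8,10), (14,8), (14,10), (20,5), (21,4), (9,6), (9,5),
    (19,16), (18,17), (15,18), (15,19), (4,10), (18,10), (18,6), (23,8), (23,10), (10,21), (1,10),
    (10,0), (15,21)]"

definition cross :: "int \<times> int \<Rightarrow> int \<times> int \<Rightarrow> int \<times> int \<Rightarrow> int" where
  "cross p q r = (fst q - fst p) * (snd r - snd p) - (snd q - snd p) * (fst r - fst p)"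

text \<open>Two segments from a common end \<open>m\<close> meet nowhere else if they are not
  collinear or point in opposite directions; the negative scalar product detects the latter.\<close>

definition star_ok :: "int \<times> int \<Rightarrow> int \<times> int \<Rightarrow> int \<times> int \<Rightarrow> bool" where
  "star_ok m p q \<longleftrightarrow> cross m p q \<noteq> 0 \<or>
     (fst p - fst m) * (fst q - fst m) + (snd p - snd m) * (snd q - snd m) < 0"

text \<open>A sufficient test. Segments without common end are separated by their bounding boxes, or
  both ends of one lie strictly on the same side of the line through the other.\<close>

definition seg_ok :: "int \<times> int \<Rightarrow> int \<times> int \<Rightarrow> int \<times> int \<Rightarrow> int \<times> int \<Rightarrow> bool" where
  "seg_ok p q r s \<longleftrightarrow>
     (if p = r then star_ok p q s else if p = s then star_ok p q r
      else if q = r then star_ok q p s else if q = s then star_ok q p r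
      else max (fst p) (fst q) < min (fst r) (fst s) \<or> max (fst r) (fst s) < min (fst p) (fst q) \<or>
        max (snd p) (snd q) < min (snd r) (snd s) \<or> max (snd r) (snd s) < min (snd p) (snd q) \<or>
        0 < cross p q r * cross p q s \<or> 0 < cross r s p * cross r s q)"

definition grid_point :: "int \<Rightarrow> int \<Rightarrow> nat \<Rightarrow> int \<times> int" where
  "grid_point i j l = (26 * j + fst (cell_points ! l), 24 * i + snd (cell_points ! l))"

definition cell_segments :: "((int \<times> int) \<times> (int \<times> int)) list" where
  "cell_segments = map (\<lambda>(a, di, dj, b). (grid_point 0 0 a, grid_point (int di) (int dj) b)) cell_edges"

definition move_by :: "int \<Rightarrow> int \<Rightarrow> int \<times> int \<Rightarrow> int \<times> int" where
  "move_by i j p = (fst p + 26 * j, snd p + 24 * i)"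

fun pairs_ok :: "((int \<times> int) \<times> (int \<times> int)) list \<Rightarrow> bool" where
  "pairs_ok [] \<longleftrightarrow> True"
| "pairs_ok ((p, q) # es) \<longleftrightarrow> (\<forall>(r, s) \<in> set es. seg_ok p q r s) \<and> pairs_ok es"

definition all_ok :: "((int \<times> int) \<times> (int \<times> int)) list \<Rightarrow> ((int \<times> int) \<times> (int \<times> int)) list \<Rightarrow> bool" where
  "all_ok ss ts \<longleftrightarrow> (\<forall>(p, q) \<in> set ss. \<forall>(r, s) \<in> set ts. seg_ok p q r s)"

definition moved :: "int \<Rightarrow> int \<Rightarrow> ((int \<times> int) \<times> (int \<times> int)) list" where
  "moved i j = map (\<lambda>(p, q). (move_by i j p, move_by i j q)) cell_segments"

text \<open>By periodicity it suffices to evaluate the pairs within one cell and between a cell and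
  four of its eight neighbours. The other four follow by symmetry, and cells further apart have
  disjoint boxes.\<close>

lemma near_ok: "pairs_ok cell_segments"
  by code_simp

lemma far_ok_0_1: "all_ok cell_segments (moved 0 1)"
  by code_simp

lemma far_ok_1_0: "all_ok cell_segments (moved 1 0)"
  by code_simp

lemma far_ok_1_1: "all_ok cell_segments (moved 1 1)"
  by code_simp

lemma far_ok_1_neg: "all_ok cell_segments (moved 1 (-1))"
  by code_simp

text \<open>An edge reaches at most one cell to the right or below, hence twice the periods 26 and
  24.\<close>

lemma cell_segments_box:
  "\<forall>(p, q) \<in> set cell_segments. p \<noteq> q \<and> 0 \<le> fst p \<and> fst p < 52 \<and> 0 \<le> fst q \<and> fst q < 52 \<and>
     0 \<le> snd p \<and> snd p < 48 \<and> 0 \<le> snd q \<and> snd q < 48"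
  by code_simp

lemma cell_points_box:
  "distinct cell_points" "\<forall>p \<in> set cell_points. 0 \<le> fst p \<and> fst p < 26 \<and> 0 \<le> snd p \<and> snd p < 24"
  by code_simp+

lemma length_cell_points: "length cell_points = 48"
  by code_simp

lemma cell_edges_less: "\<forall>(a, di, dj, b) \<in> set cell_edges. a < 48 \<and> b < 48 \<and> a \<noteq> b"
  by code_simp

lemma cell_covered: "\<forall>l \<in> set [0..<48]. \<exists>(a, di, dj, b) \<in> set cell_edges. di = 0 \<and> dj = 0 \<and> (a = l \<or> b = l)"
  by code_simp

section \<open>Planarity of the mesh\<close>

definition cpt :: "int \<times> int \<Rightarrow> complex" where
  "cpt p = Complex (of_int (fst p)) (of_int (snd p))"

lemma cpt_inj: "cpt p = cpt q \<longleftrightarrow> p = q"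
  by (auto simp: cpt_def prod_eq_iff)

lemma in_segment_cpt:
  assumes "z \<in> closed_segment (cpt p) (cpt q)"
  obtains u where "0 \<le> u" "u \<le> 1" "Re z = (1 - u) * of_int (fst p) + u * of_int (fst q)"
    "Im z = (1 - u) * of_int (snd p) + u * of_int (snd q)"
  using assms unfolding closed_segment_def by (auto simp: cpt_def)

definition crossr :: "int \<times> int \<Rightarrow> int \<times> int \<Rightarrow> complex \<Rightarrow> real" where
  "crossr p q z = (of_int (fst q) - of_int (fst p)) * (Im z - of_int (snd p)) -
     (of_int (snd q) - of_int (snd p)) * (Re z - of_int (fst p))"

lemma crossr_segment:
  assumes "z \<in> closed_segment (cpt p) (cpt q)"
  shows "crossr p q z = 0"
proof -
  obtain u where z: "Re z = (1 - u) * of_int (fst p) + u * of_int (fst q)"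
    "Im z = (1 - u) * of_int (snd p) + u * of_int (snd q)"
    using in_segment_cpt[OF assms] by metis
  show ?thesis unfolding crossr_def z by (simp add: algebra_simps)
qed

text \<open>The signed area is affine along the segment and has the same strict sign at both ends,
  so it vanishes nowhere in between.\<close>

lemma crossr_same_side:
  assumes "z \<in> closed_segment (cpt r) (cpt s)" "0 < cross p q r * cross p q s"
  shows "crossr p q z \<noteq> 0"
proof -
  obtain u where u: "0 \<le> u" "u \<le> 1" and z: "Re z = (1 - u) * of_int (fst r) + u * of_int (fst s)"
    "Im z = (1 - u) * of_int (snd r) + u * of_int (snd s)"
    using in_segment_cpt[OF assms(1)] by metis
  have eq: "crossr p q z = (1 - u) * of_int (cross p q r) + u * of_int (cross p q s)"
    unfolding crossr_def cross_def z by (simp add: algebra_simps)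
  have "0 < cross p q r \<and> 0 < cross p q s \<or> cross p q r < 0 \<and> cross p q s < 0"
    using assms(2) by (simp add: zero_less_mult_iff)
  then show ?thesis
  proof
    assume "0 < cross p q r \<and> 0 < cross p q s"
    then have "(0::real) < of_int (cross p q r)" "(0::real) < of_int (cross p q s)" by simp_all
    then have "0 < (1 - u) * of_int (cross p q r) + u * of_int (cross p q s)"
      using u by (cases "u = 0") (auto intro!: add_nonneg_pos mult_pos_pos mult_nonneg_nonneg)
    then show ?thesis using eq by simp
  next
    assume "cross p q r < 0 \<and> cross p q s < 0"
    then have "of_int (cross p q r) < (0::real)" "of_int (cross p q s) < (0::real)" by simp_all
    then have "(1 - u) * of_int (cross p q r) + u * of_int (cross p q s) < 0"
      using u by (cases "u = 0") (auto intro!: add_nonpos_neg mult_pos_neg mult_nonneg_nonpos)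
    then show ?thesis using eq by simp
  qed
qed

lemma star_ok_segments:
  assumes "star_ok m p q" "m \<noteq> p" "m \<noteq> q"
  shows "closed_segment (cpt m) (cpt p) \<inter> closed_segment (cpt m) (cpt q) \<subseteq> {cpt m}"
proof
  fix z assume z: "z \<in> closed_segment (cpt m) (cpt p) \<inter> closed_segment (cpt m) (cpt q)"
  obtain u where u: "0 \<le> u" and zu: "Re z = (1 - u) * of_int (fst m) + u * of_int (fst p)"
    "Im z = (1 - u) * of_int (snd m) + u * of_int (snd p)"
    using z in_segment_cpt[of z m p] by (metis IntD1)
  obtain t where t: "0 \<le> t" and zt: "Re z = (1 - t) * of_int (fst m) + t * of_int (fst q)"
    "Im z = (1 - t) * of_int (snd m) + t * of_int (snd q)"
    using z in_segment_cpt[of z m q] by (metis IntD2)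
  define a b c d :: real where "a = of_int (fst p) - of_int (fst m)" and "b = of_int (snd p) - of_int (snd m)"
    and "c = of_int (fst q) - of_int (fst m)" and "d = of_int (snd q) - of_int (snd m)"
  have 1: "u * a = t * c" using zu(1) zt(1) by (simp add: a_def c_def algebra_simps)
  have 2: "u * b = t * d" using zu(2) zt(2) by (simp add: b_def d_def algebra_simps)
  have zm: "z = cpt m" if "u = 0"
    using zu that by (auto simp: cpt_def complex_eq_iff)
  from assms(1) have "u = 0"
    unfolding star_ok_def
  proof
    assume "cross m p q \<noteq> 0"
    then have "(of_int (cross m p q) :: real) \<noteq> 0" by simp
    moreover have "of_int (cross m p q) = a * d - b * c"
      by (simp add: cross_def a_def b_def c_def d_def)
    moreover have "u * (a * d - b * c) = 0"
    proof -
      have "u * (a * d - b * c) = (u * a) * d - (u * b) * c" by algebra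
      also have "\<dots> = 0" unfolding 1 2 by algebra
      finally show ?thesis .
    qed
    ultimately show ?thesis by simp
  next
    assume "(fst p - fst m) * (fst q - fst m) + (snd p - snd m) * (snd q - snd m) < 0"
    then have "of_int ((fst p - fst m) * (fst q - fst m) + (snd p - snd m) * (snd q - snd m)) < (0::real)"
      by (simp only: of_int_less_0_iff)
    then have neg: "a * c + b * d < 0" by (simp add: a_def b_def c_def d_def)
    \<comment> \<open>Scalar product of the common point with the first direction: the left side is
      non-negative, the right side is not positive, which forces \<open>u = 0\<close>.\<close>
    have "u * (a * a + b * b) = t * (a * c + b * d)"
    proof -
      have "u * (a * a + b * b) = (u * a) * a + (u * b) * b" by algebra
      also have "\<dots> = t * (a * c + b * d)" unfolding 1 2 by algebra
      finally show ?thesis .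
    qed
    also have "\<dots> \<le> 0" using neg t by (simp add: mult_nonneg_nonpos)
    finally have "u * (a * a + b * b) \<le> 0" .
    moreover have "0 < a * a + b * b"
    proof -
      have "a \<noteq> 0 \<or> b \<noteq> 0" using assms(2) by (auto simp: a_def b_def prod_eq_iff)
      then show ?thesis by (auto simp: sum_squares_gt_zero_iff)
    qed
    ultimately show ?thesis using u by (metis less_eq_real_def linorder_not_less mult_pos_pos)
  qed
  then show "z \<in> {cpt m}" using zm by simp
qed

lemma Re_segment:
  assumes "z \<in> closed_segment (cpt p) (cpt q)"
  shows "of_int (min (fst p) (fst q)) \<le> Re z" "Re z \<le> of_int (max (fst p) (fst q))"
    "of_int (min (snd p) (snd q)) \<le> Im z" "Im z \<le> of_int (max (snd p) (snd q))"
proof -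
  obtain u where u: "0 \<le> u" "u \<le> 1" and z: "Re z = (1 - u) * of_int (fst p) + u * of_int (fst q)"
    "Im z = (1 - u) * of_int (snd p) + u * of_int (snd q)"
    using in_segment_cpt[OF assms] by metis
  have *: "min x y \<le> (1 - u) * x + u * y" "(1 - u) * x + u * y \<le> max x y" for x y :: real
    using u convex_bound_le[of x "max x y" y "1 - u" u] convex_bound_le[of "- x" "- min x y" "- y" "1 - u" u]
    by auto
  show "of_int (min (fst p) (fst q)) \<le> Re z" "Re z \<le> of_int (max (fst p) (fst q))"
    "of_int (min (snd p) (snd q)) \<le> Im z" "Im z \<le> of_int (max (snd p) (snd q))"
    unfolding z of_int_min of_int_max by (rule *)+
qed

lemma seg_ok_segments:
  assumes "seg_ok p q r s" "p \<noteq> q" "r \<noteq> s"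
  shows "closed_segment (cpt p) (cpt q) \<inter> closed_segment (cpt r) (cpt s) \<subseteq> cpt ` ({p, q} \<inter> {r, s})"
proof -
  consider "p = r" "star_ok p q s" | "p = s" "star_ok p q r" | "q = r" "star_ok q p s" | "q = s" "star_ok q p r"
    | "max (fst p) (fst q) < min (fst r) (fst s) \<or> max (fst r) (fst s) < min (fst p) (fst q) \<or>
        max (snd p) (snd q) < min (snd r) (snd s) \<or> max (snd r) (snd s) < min (snd p) (snd q)"
    | "0 < cross p q r * cross p q s" | "0 < cross r s p * cross r s q"
    using assms(1) unfolding seg_ok_def by argo
  then show ?thesis
  proof cases
    case 1
    then show ?thesis using star_ok_segments[of p q s] assms by auto
  next
    case 2
    then show ?thesis using star_ok_segments[of p q r] assms by (auto simp: closed_segment_commute)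
  next
    case 3
    then show ?thesis using star_ok_segments[of q p s] assms by (auto simp: closed_segment_commute)
  next
    case 4
    then show ?thesis using star_ok_segments[of q p r] assms by (auto simp: closed_segment_commute)
  next
    case 5
    have False if z: "z \<in> closed_segment (cpt p) (cpt q)" "z \<in> closed_segment (cpt r) (cpt s)" for z
    proof -
      have "of_int (min (fst r) (fst s)) \<le> (of_int (max (fst p) (fst q)) :: real)"
        "of_int (min (fst p) (fst q)) \<le> (of_int (max (fst r) (fst s)) :: real)"
        "of_int (min (snd r) (snd s)) \<le> (of_int (max (snd p) (snd q)) :: real)"
        "of_int (min (snd p) (snd q)) \<le> (of_int (max (snd r) (snd s)) :: real)"
        using Re_segment[OF z(1)] Re_segment[OF z(2)] by linarith+
      then show False using 5 unfolding of_int_le_iff by linarith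
    qed
    then show ?thesis by blast
  next
    case 6
    then show ?thesis using crossr_segment[of _ p q] crossr_same_side[of _ r s p q] by blast
  next
    case 7
    then show ?thesis using crossr_segment[of _ r s] crossr_same_side[of _ p q r s] by blast
  qed
qed

lemma seg_ok_move: "seg_ok (move_by i j p) (move_by i j q) (move_by i j r) (move_by i j s) = seg_ok p q r s"
proof -
  have eq: "move_by i j p = move_by i j q \<longleftrightarrow> p = q" for p q
    by (auto simp: move_by_def prod_eq_iff)
  have c: "cross (move_by i j p) (move_by i j q) (move_by i j r) = cross p q r" for p q r
    by (simp add: cross_def move_by_def)
  have st: "star_ok (move_by i j p) (move_by i j q) (move_by i j r) = star_ok p q r" for p q r
    unfolding star_ok_def c by (simp add: move_by_def)
  have m: "max (a + c) (b + c) = max a b + c" "min (a + c) (b + c) = min a b + c" for a b c :: int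
    by auto
  show ?thesis
    unfolding seg_ok_def eq c st by (simp add: move_by_def m)
qed

definition seg :: "int \<Rightarrow> int \<Rightarrow> nat \<Rightarrow> (int \<times> int) \<times> (int \<times> int)" where
  "seg i j k = (move_by i j (fst (cell_segments ! k)), move_by i j (snd (cell_segments ! k)))"

definition clean :: "(int \<times> int) \<times> (int \<times> int) \<Rightarrow> (int \<times> int) \<times> (int \<times> int) \<Rightarrow> bool" where
  "clean e f \<longleftrightarrow> closed_segment (cpt (fst e)) (cpt (snd e)) \<inter> closed_segment (cpt (fst f)) (cpt (snd f))
     \<subseteq> cpt ` ({fst e, snd e} \<inter> {fst f, snd f})"

lemma clean_sym: "clean e f \<Longrightarrow> clean f e"
  unfolding clean_def by (simp add: Int_commute)

lemma clean_if_seg_ok: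
  assumes "seg_ok (fst (seg i j k)) (snd (seg i j k)) (fst (seg i' j' k')) (snd (seg i' j' k'))"
    "k < length cell_segments" "k' < length cell_segments"
  shows "clean (seg i j k) (seg i' j' k')"
proof -
  have "fst (seg i j k) \<noteq> snd (seg i j k)" if "k < length cell_segments" for i j k
    using cell_segments_box nth_mem[OF that] by (auto simp: seg_def move_by_def prod_eq_iff case_prod_unfold)
  then show ?thesis using seg_ok_segments[OF assms(1)] assms unfolding clean_def by blast
qed

lemma pairs_ok_nth: "pairs_ok ss \<Longrightarrow> k < k' \<Longrightarrow> k' < length ss \<Longrightarrow>
    seg_ok (fst (ss ! k)) (snd (ss ! k)) (fst (ss ! k')) (snd (ss ! k'))"
proof (induction ss arbitrary: k k' rule: pairs_ok.induct)
  case (2 p q es)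
  obtain l where k': "k' = Suc l" using 2 by (cases k') auto
  show ?case
  proof (cases k)
    case 0
    have "es ! l \<in> set es" using 2 k' by simp
    with 2 have "case es ! l of (r, s) \<Rightarrow> seg_ok p q r s" by auto
    then show ?thesis using 0 k' by (simp add: case_prod_unfold)
  next
    case (Suc m)
    then show ?thesis using 2 k' by simp
  qed
qed simp

lemma all_ok_nth:
  assumes "all_ok cell_segments (moved i j)" "k < length cell_segments" "k' < length cell_segments"
  shows "seg_ok (fst (cell_segments ! k)) (snd (cell_segments ! k)) (fst (seg i j k')) (snd (seg i j k'))"
proof -
  have "seg i j k' \<in> set (moved i j)" unfolding moved_def seg_def
    using assms(3) by (auto simp: case_prod_unfold intro!: image_eqI[of _ _ "cell_segments ! k'"])
  then show ?thesis using assms nth_mem[OF assms(2)] unfolding all_ok_def by (fastforce simp: case_prod_unfold)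
qed

lemma seg_move: "seg (i + i') (j + j') k = (move_by i j (fst (seg i' j' k)), move_by i j (snd (seg i' j' k)))"
  by (simp add: seg_def move_by_def algebra_simps)

lemma seg_0: "seg 0 0 k = cell_segments ! k"
  by (simp add: seg_def move_by_def)

lemma clean_shift:
  assumes "seg_ok (fst (seg 0 0 k)) (snd (seg 0 0 k)) (fst (seg (i' - i) (j' - j) k')) (snd (seg (i' - i) (j' - j) k'))"
    "k < length cell_segments" "k' < length cell_segments"
  shows "clean (seg i j k) (seg i' j' k')"
proof (rule clean_if_seg_ok[OF _ assms(2,3)])
  have "seg i j k = (move_by i j (fst (seg 0 0 k)), move_by i j (snd (seg 0 0 k)))"
    using seg_move[of i 0 j 0 k] by simp
  moreover have "seg i' j' k' = (move_by i j (fst (seg (i' - i) (j' - j) k')), move_by i j (snd (seg (i' - i) (j' - j) k')))"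
    using seg_move[of i "i' - i" j "j' - j" k'] by simp
  ultimately show "seg_ok (fst (seg i j k)) (snd (seg i j k)) (fst (seg i' j' k')) (snd (seg i' j' k'))"
    using assms(1) by (simp add: seg_ok_move)
qed

lemma seg_box:
  assumes "k < length cell_segments" "p \<in> {fst (seg i j k), snd (seg i j k)}"
  shows "26 * j \<le> fst p" "fst p < 26 * j + 52" "24 * i \<le> snd p" "snd p < 24 * i + 48"
  using cell_segments_box nth_mem[OF assms(1)] assms(2)
  by (auto simp: seg_def move_by_def case_prod_unfold)

lemma clean_far:
  assumes k: "k < length cell_segments" "k' < length cell_segments" and far: "\<bar>i - i'\<bar> \<ge> 2 \<or> \<bar>j - j'\<bar> \<ge> 2"
  shows "clean (seg i j k) (seg i' j' k')"
proof (rule clean_if_seg_ok[OF _ k])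
  let ?p = "fst (seg i j k)" and ?q = "snd (seg i j k)" and ?r = "fst (seg i' j' k')" and ?s = "snd (seg i' j' k')"
  note b = seg_box[OF k(1), of ?p i j] seg_box[OF k(1), of ?q i j] seg_box[OF k(2), of ?r i' j'] seg_box[OF k(2), of ?s i' j']
  have "max (fst ?p) (fst ?q) < min (fst ?r) (fst ?s) \<or> max (fst ?r) (fst ?s) < min (fst ?p) (fst ?q) \<or>
        max (snd ?p) (snd ?q) < min (snd ?r) (snd ?s) \<or> max (snd ?r) (snd ?s) < min (snd ?p) (snd ?q)"
  proof -
    consider "i + 2 \<le> i'" | "i' + 2 \<le> i" | "j + 2 \<le> j'" | "j' + 2 \<le> j" using far by linarith
    then show ?thesis by cases (use b in auto)
  qed
  moreover from this have "?p \<noteq> ?r" "?p \<noteq> ?s" "?q \<noteq> ?r" "?q \<noteq> ?s" by auto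
  ultimately show "seg_ok ?p ?q ?r ?s" unfolding seg_ok_def by argo
qed

lemma clean_segs:
  assumes k: "k < length cell_segments" "k' < length cell_segments" and ne: "(i, j, k) \<noteq> (i', j', k')"
  shows "clean (seg i j k) (seg i' j' k')"
proof -
  have near: "clean (seg i j k) (seg i j k')" if "k < k'" "k' < length cell_segments" for i j k k'
    by (rule clean_shift) (use pairs_ok_nth[OF near_ok that] that in \<open>auto simp: seg_0\<close>)
  have next1: "clean (seg i j k) (seg i' j' k')"
    if "k < length cell_segments" "k' < length cell_segments" "all_ok cell_segments (moved (i' - i) (j' - j))" for i j k i' j' k'
    by (rule clean_shift) (use all_ok_nth[OF that(3) that(1,2)] that in \<open>auto simp: seg_0\<close>)
  have "i = i' \<and> j = j' \<and> k < k' \<or> i = i' \<and> j = j' \<and> k' < k \<or> (\<bar>i - i'\<bar> \<ge> 2 \<or> \<bar>j - j'\<bar> \<ge> 2)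
    \<or> i' - i = 0 \<and> j' - j = 1 \<or> i' - i = 1 \<and> j' - j = 0 \<or> i' - i = 1 \<and> j' - j = 1 \<or> i' - i = 1 \<and> j' - j = -1
    \<or> i - i' = 0 \<and> j - j' = 1 \<or> i - i' = 1 \<and> j - j' = 0 \<or> i - i' = 1 \<and> j - j' = 1 \<or> i - i' = 1 \<and> j - j' = -1"
    using ne unfolding prod.inject by presburger
  then consider "i = i'" "j = j'" "k < k'" | "i = i'" "j = j'" "k' < k" | "\<bar>i - i'\<bar> \<ge> 2 \<or> \<bar>j - j'\<bar> \<ge> 2"
    | "i' - i = 0" "j' - j = 1" | "i' - i = 1" "j' - j = 0" | "i' - i = 1" "j' - j = 1" | "i' - i = 1" "j' - j = -1"
    | "i - i' = 0" "j - j' = 1" | "i - i' = 1" "j - j' = 0" | "i - i' = 1" "j - j' = 1" | "i - i' = 1" "j - j' = -1"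
    by blast
  then show ?thesis
  proof cases
    case 1
    then show ?thesis using near k by simp
  next
    case 2
    then show ?thesis using near[of k' k i j] k clean_sym by simp
  next
    case 3
    then show ?thesis by (rule clean_far[OF k])
  qed (use next1[of k k' i' i j' j] next1[of k' k i i' j j'] clean_sym far_ok_0_1 far_ok_1_0 far_ok_1_1 far_ok_1_neg k in metis)+
qed

definition mesh_V :: "nat \<Rightarrow> nat \<Rightarrow> (nat \<times> nat \<times> nat) set" where
  "mesh_V R C = {..<R} \<times> {..<C} \<times> {..<48}"

text \<open>The only edges that depend on the position are those joining vertex 6 to vertex 7 of the
  cell below: they are used in column 0 only.\<close>

definition mesh_E :: "nat \<Rightarrow> nat \<Rightarrow> (nat \<times> nat \<times> nat) set set" where
  "mesh_E R C = {{(i, j, a), (i + di, j + dj, b)} | i j a di dj b. (a, di, dj, b) \<in> set cell_edges \<and>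
     i + di < R \<and> j + dj < C \<and> (a = 6 \<and> b = 7 \<longrightarrow> j = 0)}"

definition mpt :: "nat \<times> nat \<times> nat \<Rightarrow> int \<times> int" where
  "mpt v = (case v of (i, j, l) \<Rightarrow> grid_point (int i) (int j) l)"

lemma mpt_inj: "inj_on mpt (mesh_V R C)"
proof (rule inj_onI)
  fix v w assume vw: "v \<in> mesh_V R C" "w \<in> mesh_V R C" "mpt v = mpt w"
  obtain i j l where v: "v = (i, j, l)" by (cases v)
  obtain i' j' l' where w: "w = (i', j', l')" by (cases w)
  have l: "l < 48" "l' < 48" using vw v w by (auto simp: mesh_V_def)
  let ?p = "cell_points ! l" and ?q = "cell_points ! l'"
  have "?p \<in> set cell_points" "?q \<in> set cell_points" using l length_cell_points by auto
  then have b: "0 \<le> fst ?p" "fst ?p < 26" "0 \<le> snd ?p" "snd ?p < 24" "0 \<le> fst ?q" "fst ?q < 26" "0 \<le> snd ?q" "snd ?q < 24"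
    using cell_points_box(2) by auto
  have e: "26 * int j + fst ?p = 26 * int j' + fst ?q" "24 * int i + snd ?p = 24 * int i' + snd ?q"
    using vw(3) v w by (auto simp: mpt_def grid_point_def)
  have "int j = int j'" using e(1) b by linarith
  moreover have "int i = int i'" using e(2) b by linarith
  ultimately have "i = i'" "j = j'" "?p = ?q" using e by (auto simp: prod_eq_iff)
  moreover have "l = l'"
    using \<open>?p = ?q\<close> l length_cell_points cell_points_box(1) by (simp add: nth_eq_iff_index_eq)
  ultimately show "v = w" using v w by simp
qed

lemma mesh_E_seg:
  assumes "e \<in> mesh_E R C"
  obtains i j k u v where "k < length cell_segments" "e = {u, v}" "u \<in> mesh_V R C" "v \<in> mesh_V R C"
    "seg (int i) (int j) k = (mpt u, mpt v)" "u \<noteq> v"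
proof -
  obtain i j a di dj b where *: "(a, di, dj, b) \<in> set cell_edges" "i + di < R" "j + dj < C"
    "e = {(i, j, a), (i + di, j + dj, b)}" using assms unfolding mesh_E_def by blast
  then obtain k where k: "k < length cell_edges" "cell_edges ! k = (a, di, dj, b)" by (metis in_set_conv_nth)
  have ab: "a < 48" "b < 48" "a \<noteq> b" using cell_edges_less *(1) by auto
  show ?thesis
  proof (rule that[of k "(i, j, a)" "(i + di, j + dj, b)" i j])
    show "seg (int i) (int j) k = (mpt (i, j, a), mpt (i + di, j + dj, b))"
      using k by (simp add: seg_def cell_segments_def mpt_def grid_point_def move_by_def algebra_simps)
  qed (use * k ab in \<open>auto simp: cell_segments_def mesh_V_def\<close>)
qed

lemma mesh_edges_clean:
  assumes "{u, v} \<in> mesh_E R C" "{u', v'} \<in> mesh_E R C" "{u, v} \<noteq> {u', v'}"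
  shows "closed_segment (cpt (mpt u)) (cpt (mpt v)) \<inter> closed_segment (cpt (mpt u')) (cpt (mpt v'))
    \<subseteq> (\<lambda>w. cpt (mpt w)) ` ({u, v} \<inter> {u', v'})"
proof -
  obtain i j k x y where 1: "k < length cell_segments" "{u, v} = {x, y}" "x \<in> mesh_V R C" "y \<in> mesh_V R C"
    "seg (int i) (int j) k = (mpt x, mpt y)" using mesh_E_seg[OF assms(1)] by metis
  obtain i' j' k' x' y' where 2: "k' < length cell_segments" "{u', v'} = {x', y'}" "x' \<in> mesh_V R C" "y' \<in> mesh_V R C"
    "seg (int i') (int j') k' = (mpt x', mpt y')" using mesh_E_seg[OF assms(2)] by metis
  have "(int i, int j, k) \<noteq> (int i', int j', k')"
  proof
    assume "(int i, int j, k) = (int i', int j', k')"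
    then have "mpt x = mpt x'" "mpt y = mpt y'" using 1 2 by auto
    then have "x = x'" "y = y'" using mpt_inj[of R C] 1 2 by (auto dest: inj_onD)
    then show False using assms(3) 1 2 by simp
  qed
  then have "clean (mpt x, mpt y) (mpt x', mpt y')"
    using clean_segs[OF 1(1) 2(1)] 1(5) 2(5) by metis
  moreover have "closed_segment (cpt (mpt u)) (cpt (mpt v)) = closed_segment (cpt (mpt x)) (cpt (mpt y))"
    using 1(2) by (auto simp: doubleton_eq_iff closed_segment_commute)
  moreover have "closed_segment (cpt (mpt u')) (cpt (mpt v')) = closed_segment (cpt (mpt x')) (cpt (mpt y'))"
    using 2(2) by (auto simp: doubleton_eq_iff closed_segment_commute)
  moreover have "{mpt x, mpt y} \<inter> {mpt x', mpt y'} = mpt ` ({x, y} \<inter> {x', y'})"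
    using inj_on_image_Int[OF mpt_inj[of R C], of "{x, y}" "{x', y'}"] 1 2 by simp
  ultimately show ?thesis using 1(2) 2(2) by (simp only: clean_def fst_conv snd_conv image_image)
qed

text \<open>Every vertex is an end of some edge. An edge passing through a foreign vertex would
  therefore meet an edge ending there in a forbidden point, so the test of pairs of edges also keeps
  edges away from vertices.\<close>

lemma mesh_V_covered:
  assumes "v \<in> mesh_V R C"
  obtains u where "{u, v} \<in> mesh_E R C"
proof -
  obtain i j l where v: "v = (i, j, l)" "i < R" "j < C" "l < 48" using assms by (auto simp: mesh_V_def)
  then have "l \<in> set [0..<48]" by auto
  from bspec[OF cell_covered this] obtain a b where ab: "(a, 0, 0, b) \<in> set cell_edges" "a = l \<or> b = l"
    by auto
  have six: "(6, 0, 0, 7) \<notin> set cell_edges" by code_simp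
  have "{(i, j, a), (i + 0, j + 0, b)} \<in> mesh_E R C"
    unfolding mesh_E_def using ab(1) v six by (intro CollectI exI conjI) auto
  then show ?thesis using that[of "(i, j, a)"] that[of "(i, j, b)"] ab(2) v by (auto simp: insert_commute)
qed

theorem planar_mesh: "planar (mesh_V R C) (mesh_E R C)"
proof -
  define pt where "pt v = cpt (mpt v)" for v
  \<comment> \<open>Edges are sets; an arbitrary orientation is chosen to obtain a path.\<close>
  define ends where "ends e = (SOME p. e = {fst p, snd p})" for e :: "(nat \<times> nat \<times> nat) set"
  define \<gamma> where "\<gamma> e = linepath (pt (fst (ends e))) (pt (snd (ends e)))" for e
  have inj: "inj_on pt (mesh_V R C)"
    using mpt_inj[of R C] by (auto simp: inj_on_def pt_def cpt_inj)
  have sub: "e \<subseteq> mesh_V R C" if e: "e \<in> mesh_E R C" for e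
    by (rule mesh_E_seg[OF e]) simp
  have ends: "e = {fst (ends e), snd (ends e)}" if e: "e \<in> mesh_E R C" for e
  proof -
    obtain u v where "e = {u, v}" using mesh_E_seg[OF e] by metis
    then have "\<exists>p. e = {fst p, snd p}" by (intro exI[of _ "(u, v)"]) simp
    then show ?thesis unfolding ends_def by (rule someI_ex)
  qed
  have ne: "pt (fst (ends e)) \<noteq> pt (snd (ends e))" if e: "e \<in> mesh_E R C" for e
  proof -
    obtain u v where "e = {u, v}" "u \<noteq> v" using mesh_E_seg[OF e] by metis
    then have "fst (ends e) \<noteq> snd (ends e)" using ends[OF e] by (metis doubleton_eq_iff)
    moreover have "fst (ends e) \<in> mesh_V R C" "snd (ends e) \<in> mesh_V R C" using ends[OF e] sub[OF e] by auto
    ultimately show ?thesis using inj by (meson inj_onD)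
  qed
  have sub_image: "pt ` e \<subseteq> path_image (\<gamma> e)" if e: "e \<in> mesh_E R C" for e
  proof -
    have "pt ` e = {pt (fst (ends e)), pt (snd (ends e))}" using ends[OF e] by (metis image_insert image_empty)
    then show ?thesis by (simp add: \<gamma>_def)
  qed
  have meet: "path_image (\<gamma> e) \<inter> path_image (\<gamma> e') = pt ` (e \<inter> e')"
    if e: "e \<in> mesh_E R C" "e' \<in> mesh_E R C" "e \<noteq> e'" for e e'
  proof
    have "path_image (\<gamma> e) \<inter> path_image (\<gamma> e') \<subseteq>
        (\<lambda>w. cpt (mpt w)) ` ({fst (ends e), snd (ends e)} \<inter> {fst (ends e'), snd (ends e')})"
      unfolding \<gamma>_def pt_def path_image_linepath
      by (rule mesh_edges_clean[of _ _ R C]) (use e ends in metis)+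
    then show "path_image (\<gamma> e) \<inter> path_image (\<gamma> e') \<subseteq> pt ` (e \<inter> e')"
      using ends[OF e(1)] ends[OF e(2)] unfolding pt_def by metis
    show "pt ` (e \<inter> e') \<subseteq> path_image (\<gamma> e) \<inter> path_image (\<gamma> e')"
      using sub_image[OF e(1)] sub_image[OF e(2)] by blast
  qed
  have avoid: "path_image (\<gamma> e) \<inter> pt ` mesh_V R C = pt ` e" if e: "e \<in> mesh_E R C" for e
  proof
    show "pt ` e \<subseteq> path_image (\<gamma> e) \<inter> pt ` mesh_V R C" using sub_image[OF e] sub[OF e] by blast
    show "path_image (\<gamma> e) \<inter> pt ` mesh_V R C \<subseteq> pt ` e"
    proof
      fix z assume "z \<in> path_image (\<gamma> e) \<inter> pt ` mesh_V R C"
      then obtain v where v: "v \<in> mesh_V R C" "z = pt v" "z \<in> path_image (\<gamma> e)" by blast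
      obtain u where u: "{u, v} \<in> mesh_E R C" using mesh_V_covered[OF v(1)] .
      show "z \<in> pt ` e"
      proof (cases "{u, v} = e")
        case False
        have "pt v \<in> path_image (\<gamma> {u, v})" using sub_image[OF u] by blast
        then have "pt v \<in> pt ` (e \<inter> {u, v})" using meet[OF e u] False v by blast
        then show ?thesis using v by blast
      qed (use v in blast)
    qed
  qed
  show ?thesis
    unfolding planar_def
  proof (intro exI[of _ pt] exI[of _ \<gamma>] conjI ballI impI)
    fix e assume e: "e \<in> mesh_E R C"
    show "arc (\<gamma> e)" unfolding \<gamma>_def using ne[OF e] by (rule arc_linepath)
    have "pt ` e = {pt (fst (ends e)), pt (snd (ends e))}" using ends[OF e] by (metis image_insert image_empty)
    then show "{pathstart (\<gamma> e), pathfinish (\<gamma> e)} = pt ` e" by (simp add: \<gamma>_def)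
    show "path_image (\<gamma> e) \<inter> pt ` mesh_V R C = pt ` e" by (rule avoid[OF e])
  qed (use inj meet in auto)
qed

section \<open>The mesh encodes satisfiability\<close>

text \<open>
  Every cell belongs to a clause (row) and a variable (column). Its vertices 0 to 6 are groups, 7 to 13
  only serve to join the groups to a tree, 14 to 24 are literals and the rest are pendant vertices.
  The horizontal signal says whether the clause is already satisfied by the variables to the left, the
  vertical one is the value of the variable: literal 14 is the negated incoming horizontal and 15
  the negated incoming vertical signal, 22 and 23 are the outgoing signals, 16 to 21 are the cases
  (satisfied, true), (satisfied, false), (unsatisfied, true), (unsatisfied, false) and, for a
  variable that satisfies the clause just now, (unsatisfied, true), (unsatisfied, false). Literal 24
  is a slack variable of the bottom row.
  An entry \<open>(1 + x, 1 + y, l)\<close> of the neighbour list stands for vertex \<open>l\<close> of the cell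
  that lies \<open>x\<close> rows below and \<open>y\<close> columns to the right.
\<close>

definition cell_nbs :: "(nat \<times> nat \<times> nat) list list" where
  "cell_nbs = [
    [(1,1,14), (1,1,16), (1,1,17), (1,1,7), (1,1,8), (1,1,39)],
    [(1,1,15), (1,1,16), (1,1,18), (1,1,20), (1,1,11)],
    [(1,1,16), (1,1,17), (1,1,18), (1,1,20), (1,1,19), (1,1,21), (1,1,8), (1,1,9), (1,1,11)],
    [(1,1,23), (1,1,17), (1,1,19), (1,1,21), (1,1,12), (1,1,13)],
    [(1,1,22), (1,1,18), (1,1,19), (1,1,9), (1,1,10), (1,1,12), (1,1,40), (1,1,41)],
    [(1,1,22), (1,2,14), (1,1,10), (1,2,7), (1,1,42), (1,1,43)],
    [(1,1,23), (1,1,24), (2,1,15), (1,1,13), (2,1,7), (1,1,44)],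
    [(1,1,0), (1,0,5), (0,1,6), (1,1,25), (1,1,26)], [(1,1,0), (1,1,2), (1,1,27), (1,1,28)],
    [(1,1,2), (1,1,4), (1,1,29), (1,1,30)], [(1,1,4), (1,1,5), (1,1,31), (1,1,32)],
    [(1,1,2), (1,1,1), (1,1,33), (1,1,34)], [(1,1,4), (1,1,3), (1,1,35), (1,1,36)],
    [(1,1,3), (1,1,6), (1,1,37), (1,1,38)], [(1,1,0), (1,0,5), (1,1,45)],
    [(1,1,1), (0,1,6), (1,1,46)], [(1,1,0), (1,1,1), (1,1,2)], [(1,1,0), (1,1,2), (1,1,3)],
    [(1,1,1), (1,1,2), (1,1,4)], [(1,1,2), (1,1,3), (1,1,4)], [(1,1,1), (1,1,2)],
    [(1,1,2), (1,1,3)], [(1,1,4), (1,1,5)], [(1,1,3), (1,1,6)], [(1,1,6), (1,1,47)], [(1,1,7)],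
    [(1,1,7)], [(1,1,8)], [(1,1,8)], [(1,1,9)], [(1,1,9)], [(1,1,10)], [(1,1,10)], [(1,1,11)],
    [(1,1,11)], [(1,1,12)], [(1,1,12)], [(1,1,13)], [(1,1,13)], [(1,1,0)], [(1,1,4)],
    [(1,1,4)], [(1,1,5)], [(1,1,5)], [(1,1,6)], [(1,1,14)], [(1,1,15)], [(1,1,24)]]"

definition cell_side :: "nat list" where
  "cell_side = [1, 1, 1, 1, 1, 1, 1, 0, 0, 0, 0, 0, 0, 0, 0, 0, 0, 0, 0, 0, 0, 0, 0, 0, 0, 1, 1, 1, 1, 1, 1, 1, 1, 1, 1, 1, 1, 1, 1, 0, 0, 0, 0, 0, 0, 1, 1, 1]"

text \<open>The flags say whether there is a row above or below and a column to the left or right.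
  So \<open>\<not> lf\<close> means column 0, where alone vertices 6 and 7 of consecutive rows are
  joined.\<close>

definition present :: "bool \<Rightarrow> bool \<Rightarrow> bool \<Rightarrow> bool \<Rightarrow> nat \<Rightarrow> nat \<times> nat \<times> nat \<Rightarrow> bool" where
  "present up dn lf rt l = (\<lambda>(x, y, c). (x = 0 \<longrightarrow> up) \<and> (x = 2 \<longrightarrow> dn) \<and> (y = 0 \<longrightarrow> lf) \<and> (y = 2 \<longrightarrow> rt) \<and>
     (x = 2 \<and> l = 6 \<and> c = 7 \<or> x = 0 \<and> l = 7 \<and> c = 6 \<longrightarrow> \<not> lf))"

definition nbs :: "bool \<Rightarrow> bool \<Rightarrow> bool \<Rightarrow> bool \<Rightarrow> nat \<Rightarrow> (nat \<times> nat \<times> nat) list" where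
  "nbs up dn lf rt l = filter (present up dn lf rt l) (cell_nbs ! l)"

lemma length_cell_nbs: "length cell_nbs = 48"
  by code_simp

lemma cell_edges_nbs:
  "\<forall>(a, di, dj, b) \<in> set cell_edges. di \<le> 1 \<and> dj \<le> 1 \<and> \<not> (di = 1 \<and> dj = 1) \<and>
     (1 + di, 1 + dj, b) \<in> set (cell_nbs ! a) \<and> (1 - di, 1 - dj, a) \<in> set (cell_nbs ! b) \<and>
     (b = 7 \<and> a = 6 \<longrightarrow> di = 1)"
  by code_simp

lemma cell_nbs_edges:
  "\<forall>l \<in> set [0..<48]. distinct (cell_nbs ! l) \<and> (\<forall>(x, y, c) \<in> set (cell_nbs ! l). x \<le> 2 \<and> y \<le> 2 \<and> c < 48 \<and>
     (1 \<le> x \<and> 1 \<le> y \<and> (l, x - 1, y - 1, c) \<in> set cell_edges \<or>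
      x \<le> 1 \<and> y \<le> 1 \<and> (c, 1 - x, 1 - y, l) \<in> set cell_edges))"
  by code_simp

lemma cell_edge_nbs:
  assumes "(a, di, dj, b) \<in> set cell_edges"
  shows "di \<le> 1" "dj \<le> 1" "\<not> (di = 1 \<and> dj = 1)"
    "(1 + di, 1 + dj, b) \<in> set (cell_nbs ! a)" "(1 - di, 1 - dj, a) \<in> set (cell_nbs ! b)"
    "b = 7 \<Longrightarrow> a = 6 \<Longrightarrow> di = 1"
  using bspec[OF cell_edges_nbs assms] by simp_all

lemma cell_nb_edges:
  assumes "(x, y, c) \<in> set (cell_nbs ! l)" "l < 48"
  shows "x \<le> 2" "y \<le> 2" "c < 48"
    "1 \<le> x \<and> 1 \<le> y \<and> (l, x - 1, y - 1, c) \<in> set cell_edges \<or>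
      x \<le> 1 \<and> y \<le> 1 \<and> (c, 1 - x, 1 - y, l) \<in> set cell_edges"
proof -
  have "l \<in> set [0..<48]" using assms by simp
  note bspec[OF conjunct2[OF bspec[OF cell_nbs_edges this]] assms(1)]
  then show "x \<le> 2" "y \<le> 2" "c < 48"
    "1 \<le> x \<and> 1 \<le> y \<and> (l, x - 1, y - 1, c) \<in> set cell_edges \<or>
      x \<le> 1 \<and> y \<le> 1 \<and> (c, 1 - x, 1 - y, l) \<in> set cell_edges" by simp_all
qed

lemma all_bool: "(\<forall>b. P b) \<longleftrightarrow> (\<forall>b \<in> set [True, False]. P b)"
  by (metis (full_types) list.set_intros)

text \<open>The degree conditions of \<open>alliance_tree\<close> for one cell. They are evaluated
  for all sixteen border situations; the pendant vertices are placed such that each of these meets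
  the thresholds.\<close>

definition degree_ok :: "nat \<Rightarrow> (nat \<times> nat \<times> nat) list \<Rightarrow> bool" where
  "degree_ok l ns \<longleftrightarrow> length ns \<le> 9 \<and>
     (l < 14 \<longrightarrow> length ns - 2 * (length (filter (\<lambda>(x, y, c). c < 14) ns) + (if l < 7 then 1 else 0)) \<le> 1 \<and>
        2 * (length (filter (\<lambda>(x, y, c). c < 14) ns) + (if l < 7 then 1 else 0)) \<le> length ns) \<and>
     (14 \<le> l \<and> l < 25 \<longrightarrow> 2 \<le> length ns \<and> length ns \<le> 3 \<and> (\<exists>(x, y, c) \<in> set ns. c < 14))"

lemma degrees_ok:
  "\<forall>up dn lf rt. \<forall>(l, ns) \<in> set (zip [0..<48] cell_nbs). degree_ok l (filter (present up dn lf rt l) ns)"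
  unfolding all_bool by code_simp

lemma nbs_degrees:
  assumes "l \<in> set [0..<48]"
  shows "degree_ok l (nbs up dn lf rt l)"
proof -
  have "(l, cell_nbs ! l) \<in> set (zip [0..<48] cell_nbs)"
    using assms length_cell_nbs by (auto simp: set_zip intro!: exI[of _ l])
  then show ?thesis using degrees_ok unfolding nbs_def by fastforce
qed

lemma cell_side: "\<forall>(a, di, dj, b) \<in> set cell_edges. cell_side ! a \<noteq> cell_side ! b"
  by code_simp

lemma cell_roles:
  "\<forall>(a, di, dj, b) \<in> set cell_edges. \<not> (14 \<le> a \<and> a < 25 \<and> 14 \<le> b \<and> b < 25) \<and>
     \<not> (7 \<le> a \<and> a < 14 \<and> 14 \<le> b \<and> b < 25) \<and> \<not> (7 \<le> b \<and> b < 14 \<and> 14 \<le> a \<and> a < 25)"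
  by code_simp

text \<open>The tree of one cell, with root 7 and leaves 1, 5 and 6. Vertex 5 carries the root of
  the next cell on the right and, in column 0, vertex 6 that of the cell below. Groups are joined
  only through 7 to 13, which keeps the graph bipartite.\<close>

definition cell_parent :: "nat list" where
  "cell_parent = [7, 11, 8, 12, 9, 10, 13, 7, 0, 2, 4, 2, 4, 3]"

definition cell_depth :: "nat list" where
  "cell_depth = [1, 5, 3, 7, 5, 7, 9, 0, 2, 4, 6, 4, 6, 8]"

lemma cell_edges_parent:
  "\<forall>(a, di, dj, b) \<in> set cell_edges. a < 14 \<and> b < 14 \<longrightarrow>
     di = 0 \<and> dj = 0 \<and> a \<noteq> 7 \<and> cell_parent ! a = b \<or>
     b = 7 \<and> (di = 0 \<and> dj = 1 \<and> a = 5 \<or> di = 1 \<and> dj = 0 \<and> a = 6)"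
  by code_simp

lemma cell_parent_edges:
  "\<forall>l \<in> set [0..<14]. l \<noteq> 7 \<longrightarrow> (l, 0, 0, cell_parent ! l) \<in> set cell_edges \<and> cell_parent ! l < 14 \<and>
     cell_depth ! (cell_parent ! l) < cell_depth ! l"
  "(5, 0, 1, 7) \<in> set cell_edges" "(6, 1, 0, 7) \<in> set cell_edges"
  "cell_depth ! 5 < 20" "cell_depth ! 6 < 20"
  by code_simp+

lemma mesh_E_iff:
  "{v, w} \<in> mesh_E R C \<longleftrightarrow> (\<exists>i j a di dj b. (a, di, dj, b) \<in> set cell_edges \<and> i + di < R \<and> j + dj < C \<and>
     (a = 6 \<and> b = 7 \<longrightarrow> j = 0) \<and>
     (v = (i, j, a) \<and> w = (i + di, j + dj, b) \<or> w = (i, j, a) \<and> v = (i + di, j + dj, b)))"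
  unfolding mesh_E_def mem_Collect_eq doubleton_eq_iff by blast

text \<open>Offsets are stored increased by 1 to remain natural numbers; adding 1 on the left sides
  avoids subtraction.\<close>

lemma mesh_E_nbs:
  assumes v: "i < R" "j < C" "l < 48"
  shows "{(i, j, l), (i', j', l')} \<in> mesh_E R C \<longleftrightarrow>
    (\<exists>x y. (x, y, l') \<in> set (nbs (0 < i) (Suc i < R) (0 < j) (Suc j < C) l) \<and> i' + 1 = i + x \<and> j' + 1 = j + y)"
    (is "?L \<longleftrightarrow> ?R")
proof
  assume ?L
  then obtain i0 j0 a di dj b where *: "(a, di, dj, b) \<in> set cell_edges" "i0 + di < R" "j0 + dj < C"
     "a = 6 \<and> b = 7 \<longrightarrow> j0 = 0"
     "(i, j, l) = (i0, j0, a) \<and> (i', j', l') = (i0 + di, j0 + dj, b) \<or>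
      (i', j', l') = (i0, j0, a) \<and> (i, j, l) = (i0 + di, j0 + dj, b)"
    unfolding mesh_E_iff by blast
  note t = cell_edge_nbs[OF *(1)]
  have 01: "di = 0 \<or> di = 1" "dj = 0 \<or> dj = 1" using t(1,2) by auto
  from *(5) show ?R
  proof
    assume "(i, j, l) = (i0, j0, a) \<and> (i', j', l') = (i0 + di, j0 + dj, b)"
    then have e: "i0 = i" "j0 = j" "a = l" "b = l'" and e': "i' = i + di" "j' = j + dj" by auto
    have "(1 + di, 1 + dj, l') \<in> set (nbs (0 < i) (Suc i < R) (0 < j) (Suc j < C) l)"
      using t(3,4) *(2-4) 01 unfolding e nbs_def present_def by (elim disjE) simp_all
    then show ?R using e' by (intro exI[of _ "1 + di"] exI[of _ "1 + dj"]) simp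
  next
    assume "(i', j', l') = (i0, j0, a) \<and> (i, j, l) = (i0 + di, j0 + dj, b)"
    then have e: "i0 = i'" "j0 = j'" "a = l'" "b = l" and e': "i = i' + di" "j = j' + dj" by auto
    have "(1 - di, 1 - dj, l') \<in> set (nbs (0 < i) (Suc i < R) (0 < j) (Suc j < C) l)"
      using t(3,5,6) *(2-4) 01 unfolding e e' nbs_def present_def by (elim disjE) simp_all
    then show ?R using e' t(1,2) by (intro exI[of _ "1 - di"] exI[of _ "1 - dj"]) simp
  qed
next
  assume ?R
  then obtain x y where xy: "(x, y, l') \<in> set (cell_nbs ! l)" "i' + 1 = i + x" "j' + 1 = j + y"
    "x = 0 \<longrightarrow> 0 < i" "x = 2 \<longrightarrow> Suc i < R" "y = 0 \<longrightarrow> 0 < j" "y = 2 \<longrightarrow> Suc j < C"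
    "x = 2 \<and> l = 6 \<and> l' = 7 \<or> x = 0 \<and> l = 7 \<and> l' = 6 \<longrightarrow> j = 0"
    by (auto simp: nbs_def present_def)
  note n = cell_nb_edges[OF xy(1) v(3)]
  from n(4) show ?L
  proof
    assume a: "1 \<le> x \<and> 1 \<le> y \<and> (l, x - 1, y - 1, l') \<in> set cell_edges"
    have i': "i' = i + (x - 1)" "j' = j + (y - 1)" using a xy(2,3) by linarith+
    have 12: "x = 1 \<or> x = 2" "y = 1 \<or> y = 2" using a n(1,2) by linarith+
    have "i + (x - 1) < R" "j + (y - 1) < C" using 12 xy(5,7) v(1,2) by auto
    moreover have "l = 6 \<and> l' = 7 \<longrightarrow> j = 0"
    proof
      assume "l = 6 \<and> l' = 7"
      moreover from this have "x - 1 = 1" using cell_edge_nbs(6)[of l "x - 1" "y - 1" l'] a by blast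
      then have "x = 2" by simp
      ultimately show "j = 0" using xy(8) by blast
    qed
    ultimately show ?L unfolding mesh_E_iff using a i' by blast
  next
    assume a: "x \<le> 1 \<and> y \<le> 1 \<and> (l', 1 - x, 1 - y, l) \<in> set cell_edges"
    have i: "i = i' + (1 - x)" "j = j' + (1 - y)" using a xy(2,3) by linarith+
    have "l' = 6 \<and> l = 7 \<longrightarrow> j' = 0"
    proof
      assume 67: "l' = 6 \<and> l = 7"
      then have "1 - x = 1" using cell_edge_nbs(6)[of l' "1 - x" "1 - y" l] a by blast
      then show "j' = 0" using 67 xy(8) i by auto
    qed
    moreover have "i' + (1 - x) < R" "j' + (1 - y) < C" using i v by simp_all
    ultimately show ?L unfolding mesh_E_iff using a i by blast
  qed
qed

section \<open>Degrees, tree and bipartition of the mesh\<close>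

definition mesh_part :: "nat \<Rightarrow> nat \<Rightarrow> (nat \<Rightarrow> bool) \<Rightarrow> (nat \<times> nat \<times> nat) set" where
  "mesh_part R C P = {(i, j, l). i < R \<and> j < C \<and> l < 48 \<and> P l}"

lemma nbs_range:
  assumes v: "i < R" "j < C" "l < 48" and "(x, y, c) \<in> set (nbs (0 < i) (Suc i < R) (0 < j) (Suc j < C) l)"
  shows "i + x - 1 < R" "j + y - 1 < C" "c < 48" "1 \<le> i + x" "1 \<le> j + y"
proof -
  have 1: "(x, y, c) \<in> set (cell_nbs ! l)" "x = 0 \<longrightarrow> 0 < i" "x = 2 \<longrightarrow> Suc i < R" "y = 0 \<longrightarrow> 0 < j" "y = 2 \<longrightarrow> Suc j < C"
    using assms(4) by (auto simp: nbs_def present_def)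
  note n = cell_nb_edges[OF 1(1) v(3)]
  have 012: "x = 0 \<or> x = 1 \<or> x = 2" "y = 0 \<or> y = 1 \<or> y = 2" using n(1,2) by linarith+
  show "i + x - 1 < R" "1 \<le> i + x" using 012(1) 1 v by auto
  show "j + y - 1 < C" "1 \<le> j + y" using 012(2) 1 v by auto
  show "c < 48" by (rule n(3))
qed

text \<open>Turns degrees into sums over concrete neighbour lists, which evaluation and
  simplification can unfold.\<close>

lemma deg_mesh:
  assumes v: "i < R" "j < C" "l < 48"
  shows "deg (mesh_E R C) X (i, j, l) =
    (\<Sum>(x, y, c) \<leftarrow> nbs (0 < i) (Suc i < R) (0 < j) (Suc j < C) l. of_bool ((i + x - 1, j + y - 1, c) \<in> X))"
proof -
  let ?N = "nbs (0 < i) (Suc i < R) (0 < j) (Suc j < C) l"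
  let ?f = "\<lambda>(x, y, c). (i + x - 1, j + y - 1, c)"
  have inj: "inj_on ?f (set ?N)"
    by (rule inj_onI) (use nbs_range[OF v] in \<open>auto split: prod.splits\<close>; metis Nat.add_diff_assoc add_diff_cancel_left' add_left_cancel le_add_diff_inverse)
  have l: "l \<in> set [0..<48]" using v by simp
  then have dist: "distinct ?N" using cell_nbs_edges unfolding nbs_def by auto
  have "{w \<in> X. {(i, j, l), w} \<in> mesh_E R C} = ?f ` {p \<in> set ?N. ?f p \<in> X}"
  proof (intro equalityI subsetI)
    fix w assume w: "w \<in> {w \<in> X. {(i, j, l), w} \<in> mesh_E R C}"
    obtain i' j' l' where [simp]: "w = (i', j', l')" by (cases w)
    obtain x y where "(x, y, l') \<in> set ?N" "i' + 1 = i + x" "j' + 1 = j + y"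
      using w mesh_E_nbs[OF v, of i' j' l'] by auto
    moreover from this have "i' = i + x - 1" "j' = j + y - 1" by linarith+
    ultimately show "w \<in> ?f ` {p \<in> set ?N. ?f p \<in> X}"
      using w by (intro image_eqI[of _ _ "(x, y, l')"]) auto
  next
    fix w assume "w \<in> ?f ` {p \<in> set ?N. ?f p \<in> X}"
    then obtain x y c where xyc: "(x, y, c) \<in> set ?N" "w = (i + x - 1, j + y - 1, c)" "w \<in> X" by auto
    have "i + x - 1 + 1 = i + x" "j + y - 1 + 1 = j + y" using nbs_range[OF v xyc(1)] by simp_all
    then have "{(i, j, l), w} \<in> mesh_E R C"
      unfolding xyc(2) mesh_E_nbs[OF v] using xyc(1) by blast
    then show "w \<in> {w \<in> X. {(i, j, l), w} \<in> mesh_E R C}" using xyc by simp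
  qed
  then have "deg (mesh_E R C) X (i, j, l) = card {p \<in> set ?N. ?f p \<in> X}"
    unfolding deg_def using inj by (simp add: card_image inj_on_subset)
  also have "\<dots> = length (filter (\<lambda>p. ?f p \<in> X) ?N)"
    unfolding distinct_length_filter[OF dist] by (rule arg_cong[of _ _ card]) auto
  also have "\<dots> = (\<Sum>p \<leftarrow> ?N. of_bool (?f p \<in> X))"
    by (induction ("?N")) auto
  finally show ?thesis by (simp add: case_prod_unfold)
qed

lemma deg_mesh_part:
  assumes v: "i < R" "j < C" "l < 48"
  shows "deg (mesh_E R C) (mesh_part R C P) (i, j, l) =
    length (filter (\<lambda>(x, y, c). P c) (nbs (0 < i) (Suc i < R) (0 < j) (Suc j < C) l))"
proof -
  let ?N = "nbs (0 < i) (Suc i < R) (0 < j) (Suc j < C) l"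
  have "deg (mesh_E R C) (mesh_part R C P) (i, j, l) = (\<Sum>(x, y, c) \<leftarrow> ?N. of_bool ((i + x - 1, j + y - 1, c) \<in> mesh_part R C P))"
    by (rule deg_mesh[OF v])
  also have "\<dots> = (\<Sum>(x, y, c) \<leftarrow> ?N. of_bool (P c))"
    by (intro arg_cong[of _ _ sum_list] map_cong refl) (use nbs_range[OF v] in \<open>auto simp: mesh_part_def\<close>)
  also have "\<dots> = length (filter (\<lambda>(x, y, c). P c) ?N)"
    by (induction ("?N")) auto
  finally show ?thesis .
qed

lemma mesh_V_part: "mesh_V R C = mesh_part R C (\<lambda>_. True)"
  by (auto simp: mesh_V_def mesh_part_def)

lemma deg_mesh_le:
  assumes "v \<in> mesh_V R C"
  shows "deg (mesh_E R C) (mesh_V R C) v \<le> 9"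
proof -
  obtain i j l where v: "v = (i, j, l)" "i < R" "j < C" "l < 48" using assms by (auto simp: mesh_V_def)
  then have "l \<in> set [0..<48]" by simp
  then show ?thesis using nbs_degrees unfolding degree_ok_def v(1) mesh_V_part deg_mesh_part[OF v(2-4)] by simp
qed

lemma simple_mesh: "simple_graph (mesh_V R C) (mesh_E R C)"
  unfolding simple_graph_def
proof (intro conjI ballI)
  show "finite (mesh_V R C)" by (simp add: mesh_V_def)
  fix e assume e: "e \<in> mesh_E R C"
  obtain u v where "e = {u, v}" "u \<in> mesh_V R C" "v \<in> mesh_V R C" "u \<noteq> v"
    using mesh_E_seg[OF e] by metis
  then show "e \<subseteq> mesh_V R C" "card e = 2" by auto
qed

lemma bipartite_mesh: "bipartite (mesh_V R C) (mesh_E R C)"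
proof -
  let ?X = "mesh_part R C (\<lambda>l. cell_side ! l = 0)" and ?Y = "mesh_part R C (\<lambda>l. cell_side ! l \<noteq> 0)"
  have "\<exists>x \<in> ?X. \<exists>y \<in> ?Y. e = {x, y}" if e: "e \<in> mesh_E R C" for e
  proof -
    obtain i j a di dj b where *: "(a, di, dj, b) \<in> set cell_edges" "i + di < R" "j + dj < C"
      "e = {(i, j, a), (i + di, j + dj, b)}" using e unfolding mesh_E_def by blast
    have ab: "a < 48" "b < 48" using cell_edges_less *(1) by auto
    have "cell_side ! a \<noteq> cell_side ! b" using cell_side *(1) by auto
    moreover have "\<forall>l \<in> set [0..<48]. cell_side ! l \<le> 1" by code_simp
    then have "cell_side ! a \<le> 1" "cell_side ! b \<le> 1" using ab by auto
    ultimately have "cell_side ! a = 0 \<and> cell_side ! b \<noteq> 0 \<or> cell_side ! b = 0 \<and> cell_side ! a \<noteq> 0"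
      by arith
    then show ?thesis
    proof
      assume "cell_side ! a = 0 \<and> cell_side ! b \<noteq> 0"
      then show ?thesis using * ab
        by (intro bexI[of _ "(i, j, a)"] bexI[of _ "(i + di, j + dj, b)"]) (auto simp: mesh_part_def)
    next
      assume "cell_side ! b = 0 \<and> cell_side ! a \<noteq> 0"
      then show ?thesis using * ab
        by (intro bexI[of _ "(i, j, a)"] bexI[of _ "(i + di, j + dj, b)"]) (auto simp: mesh_part_def insert_commute)
    qed
  qed
  then show ?thesis unfolding bipartite_def
    by (intro exI[of _ ?X] exI[of _ ?Y]) (auto simp: mesh_V_def mesh_part_def)
qed

definition mesh_U :: "nat \<Rightarrow> nat \<Rightarrow> (nat \<times> nat \<times> nat) set" where
  "mesh_U R C = mesh_part R C (\<lambda>l. l < 14)"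

definition mesh_L :: "nat \<Rightarrow> nat \<Rightarrow> (nat \<times> nat \<times> nat) set" where
  "mesh_L R C = mesh_part R C (\<lambda>l. 14 \<le> l \<and> l < 25)"

text \<open>Only \<open>N\<close> depends on the formula; graph and \<open>U\<close> depend on its
  size alone. No clause is satisfied before column 0, which rules out 16 and 17 there. Whether the
  literal occurs in the clause decides between 18 and 20 and between 19 and 21. Pendant vertices are
  never chosen, the slack 24 only in the bottom row.\<close>

definition blocked :: "nat \<Rightarrow> nat \<Rightarrow> nat \<Rightarrow> bool \<Rightarrow> bool \<Rightarrow> nat \<Rightarrow> bool" where
  "blocked R i j p n l \<longleftrightarrow> 25 \<le> l \<or> (l = 16 \<or> l = 17) \<and> j = 0 \<or> l = 20 \<and> \<not> p \<or> l = 18 \<and> p \<or>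
     l = 21 \<and> \<not> n \<or> l = 19 \<and> n \<or> l = 24 \<and> Suc i \<noteq> R"

definition mesh_N :: "nat \<Rightarrow> nat \<Rightarrow> (nat \<Rightarrow> nat \<Rightarrow> bool) \<Rightarrow> (nat \<Rightarrow> nat \<Rightarrow> bool) \<Rightarrow> (nat \<times> nat \<times> nat) set" where
  "mesh_N R C pos neg = {(i, j, l) \<in> mesh_V R C. blocked R i j (pos i j) (neg i j) l}"

text \<open>Each row is a chain of cells, and the rows are linked in column 0 only: further links
  between rows would close cycles.\<close>

definition mesh_parent :: "nat \<times> nat \<times> nat \<Rightarrow> nat \<times> nat \<times> nat" where
  "mesh_parent v = (case v of (i, j, l) \<Rightarrow>
     if l \<noteq> 7 then (i, j, cell_parent ! l) else if j = 0 then (i - 1, j, 6) else (i, j - 1, 5))"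

text \<open>20 exceeds every depth within a cell, so the root of a cell ranks above the whole cell
  that carries it.\<close>

definition mesh_rank :: "nat \<times> nat \<times> nat \<Rightarrow> nat" where
  "mesh_rank v = (case v of (i, j, l) \<Rightarrow> 20 * (i + j) + cell_depth ! l)"

lemma alliance_tree_mesh:
  assumes RC: "0 < R" "0 < C"
  shows "alliance_tree (mesh_V R C) (mesh_E R C) (mesh_U R C) (mesh_L R C) (mesh_part R C (\<lambda>l. l < 7))
    mesh_parent (0, 0, 7) mesh_rank"
proof
  show "finite (mesh_V R C)" by (simp add: mesh_V_def)
  show "mesh_U R C \<subseteq> mesh_V R C" "mesh_L R C \<subseteq> mesh_V R C" "mesh_U R C \<inter> mesh_L R C = {}"
    "mesh_part R C (\<lambda>l. l < 7) \<subseteq> mesh_U R C" "(0, 0, 7) \<in> mesh_U R C" "(0, 0, 7) \<notin> mesh_part R C (\<lambda>l. l < 7)"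
    using RC by (auto simp: mesh_V_def mesh_U_def mesh_L_def mesh_part_def)
next
  fix u assume u: "u \<in> mesh_U R C" "u \<noteq> (0, 0, 7)"
  obtain i j l where [simp]: "u = (i, j, l)" by (cases u)
  have l: "i < R" "j < C" "l \<in> set [0..<14]" using u by (auto simp: mesh_U_def mesh_part_def)
  show "mesh_parent u \<in> mesh_U R C \<and> mesh_rank (mesh_parent u) < mesh_rank u"
  proof (cases "l = 7")
    case False
    then have "cell_parent ! l < 14" "cell_depth ! (cell_parent ! l) < cell_depth ! l"
      using cell_parent_edges(1) l by auto
    then show ?thesis using False l by (auto simp: mesh_parent_def mesh_rank_def mesh_U_def mesh_part_def)
  next
    case True
    then have "0 < i \<or> 0 < j" using u by auto
    then show ?thesis using True l cell_parent_edges(4,5)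
      by (cases "j = 0") (auto simp: mesh_parent_def mesh_rank_def mesh_U_def mesh_part_def)
  qed
next
  fix u w assume u: "u \<in> mesh_U R C" and w: "w \<in> mesh_U R C"
  have edge: "{u, mesh_parent u} \<in> mesh_E R C" if u: "u \<in> mesh_U R C" "u \<noteq> (0, 0, 7)" for u
  proof -
    obtain i j l where [simp]: "u = (i, j, l)" by (cases u)
    have l: "i < R" "j < C" "l \<in> set [0..<14]" using u by (auto simp: mesh_U_def mesh_part_def)
    consider "l \<noteq> 7" | "l = 7" "0 < j" | "l = 7" "j = 0" "0 < i" using u by auto
    then show ?thesis
    proof cases
      case 1
      then have e: "(l, 0, 0, cell_parent ! l) \<in> set cell_edges" using cell_parent_edges(1) l by auto
      have "\<not> (l = 6 \<and> cell_parent ! l = 7)" using cell_edge_nbs(6)[OF e] by auto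
      then have "{(i, j, l), (i + 0, j + 0, cell_parent ! l)} \<in> mesh_E R C"
        unfolding mesh_E_iff using e l(1,2) by (metis add_0_right)
      then show ?thesis using 1 by (simp add: mesh_parent_def)
    next
      case 2
      then have "{(i, j - 1, 5), (i + 0, j - 1 + 1, 7)} \<in> mesh_E R C"
        unfolding mesh_E_def using l(1,2) cell_parent_edges(2)
        by (intro CollectI exI conjI) (rule refl | assumption | simp)+
      then show ?thesis using 2 by (simp add: mesh_parent_def insert_commute)
    next
      case 3
      then have "{(i - 1, j, 6), (i - 1 + 1, j + 0, 7)} \<in> mesh_E R C"
        unfolding mesh_E_def using l(1,2) cell_parent_edges(3)
        by (intro CollectI exI conjI) (rule refl | assumption | simp)+
      then show ?thesis using 3 by (simp add: mesh_parent_def insert_commute)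
    qed
  qed
  show "{u, w} \<in> mesh_E R C \<longleftrightarrow> u \<noteq> (0, 0, 7) \<and> w = mesh_parent u \<or> w \<noteq> (0, 0, 7) \<and> u = mesh_parent w"
  proof
    assume "{u, w} \<in> mesh_E R C"
    then obtain i j a di dj b where *: "(a, di, dj, b) \<in> set cell_edges" "a = 6 \<and> b = 7 \<longrightarrow> j = 0"
      "u = (i, j, a) \<and> w = (i + di, j + dj, b) \<or> w = (i, j, a) \<and> u = (i + di, j + dj, b)"
      unfolding mesh_E_iff by blast
    have "a < 14" "b < 14" using * u w by (auto simp: mesh_U_def mesh_part_def)
    then have "di = 0 \<and> dj = 0 \<and> a \<noteq> 7 \<and> cell_parent ! a = b \<or>
       b = 7 \<and> (di = 0 \<and> dj = 1 \<and> a = 5 \<or> di = 1 \<and> dj = 0 \<and> a = 6)"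
      using bspec[OF cell_edges_parent *(1)] by simp
    then show "u \<noteq> (0, 0, 7) \<and> w = mesh_parent u \<or> w \<noteq> (0, 0, 7) \<and> u = mesh_parent w"
      using *(2,3) by (auto simp: mesh_parent_def)
  next
    assume "u \<noteq> (0, 0, 7) \<and> w = mesh_parent u \<or> w \<noteq> (0, 0, 7) \<and> u = mesh_parent w"
    then show "{u, w} \<in> mesh_E R C" using edge u w by (metis insert_commute)
  qed
next
  fix x y assume xy: "x \<in> mesh_L R C" "y \<in> mesh_L R C"
  show "{x, y} \<notin> mesh_E R C"
  proof
    assume "{x, y} \<in> mesh_E R C"
    then obtain i j a di dj b where *: "(a, di, dj, b) \<in> set cell_edges"
      "x = (i, j, a) \<and> y = (i + di, j + dj, b) \<or> y = (i, j, a) \<and> x = (i + di, j + dj, b)"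
      unfolding mesh_E_iff by blast
    then show False using bspec[OF cell_roles *(1)] xy by (auto simp: mesh_L_def mesh_part_def)
  qed
next
  fix u x assume ux: "u \<in> mesh_U R C" "u \<notin> mesh_part R C (\<lambda>l. l < 7)" "x \<in> mesh_L R C"
  show "{u, x} \<notin> mesh_E R C"
  proof
    assume "{u, x} \<in> mesh_E R C"
    then obtain i j a di dj b where *: "(a, di, dj, b) \<in> set cell_edges"
      "u = (i, j, a) \<and> x = (i + di, j + dj, b) \<or> x = (i, j, a) \<and> u = (i + di, j + dj, b)"
      unfolding mesh_E_iff by blast
    then show False using bspec[OF cell_roles *(1)] ux by (auto simp: mesh_L_def mesh_U_def mesh_part_def)
  qed
next
  fix x assume "x \<in> mesh_L R C"
  then obtain i j l where v: "x = (i, j, l)" "i < R" "j < C" "14 \<le> l \<and> l < 25" by (auto simp: mesh_L_def mesh_part_def)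
  then have l: "l < 48" "l \<in> set [0..<48]" by auto
  show "2 \<le> deg (mesh_E R C) (mesh_V R C) x \<and> deg (mesh_E R C) (mesh_V R C) x \<le> 3"
    using nbs_degrees[OF l(2)] v(4) unfolding degree_ok_def v(1) mesh_V_part deg_mesh_part[OF v(2,3) l(1)] by simp
  obtain a b c where abc: "(a, b, c) \<in> set (nbs (0 < i) (Suc i < R) (0 < j) (Suc j < C) l)" "c < 14"
    using nbs_degrees[OF l(2)] v(4) unfolding degree_ok_def by fastforce
  note r = nbs_range[OF v(2,3) l(1) abc(1)]
  have "i + a - 1 + 1 = i + a" "j + b - 1 + 1 = j + b" using r by simp_all
  then have "{(i, j, l), (i + a - 1, j + b - 1, c)} \<in> mesh_E R C"
    unfolding mesh_E_nbs[OF v(2,3) l(1)] using abc(1) by blast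
  moreover have "(i + a - 1, j + b - 1, c) \<in> mesh_U R C" using r abc by (auto simp: mesh_U_def mesh_part_def)
  ultimately show "\<exists>u \<in> mesh_U R C. {u, x} \<in> mesh_E R C" using v(1) by (metis insert_commute)
next
  fix u assume "u \<in> mesh_U R C"
  then obtain i j l where v: "u = (i, j, l)" "i < R" "j < C" "l < 14" by (auto simp: mesh_U_def mesh_part_def)
  then have l: "l < 48" "l \<in> set [0..<48]" by auto
  have s: "of_bool (u \<in> mesh_part R C (\<lambda>l. l < 7)) = (if l < 7 then 1 else 0 :: nat)"
    using v by (auto simp: mesh_part_def)
  have "length (nbs (0 < i) (Suc i < R) (0 < j) (Suc j < C) l) -
     2 * (length (filter (\<lambda>(x, y, c). c < 14) (nbs (0 < i) (Suc i < R) (0 < j) (Suc j < C) l)) + (if l < 7 then 1 else 0)) \<le> 1 \<and>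
     2 * (length (filter (\<lambda>(x, y, c). c < 14) (nbs (0 < i) (Suc i < R) (0 < j) (Suc j < C) l)) + (if l < 7 then 1 else 0))
       \<le> length (nbs (0 < i) (Suc i < R) (0 < j) (Suc j < C) l)"
    using nbs_degrees[OF l(2)] v(4) unfolding degree_ok_def by blast
  then show "deg (mesh_E R C) (mesh_V R C) u \<in>
       {2 * (deg (mesh_E R C) (mesh_U R C) u + of_bool (u \<in> mesh_part R C (\<lambda>l. l < 7))),
        2 * (deg (mesh_E R C) (mesh_U R C) u + of_bool (u \<in> mesh_part R C (\<lambda>l. l < 7))) + 1}"
    unfolding s unfolding v(1) mesh_V_part mesh_U_def deg_mesh_part[OF v(2,3) l(1)] by auto
qed

text \<open>The equations that a set of literals must satisfy: exactly one literal in every group.\<close>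

lemma group_equations:
  assumes v: "i < R" "j < C" and X: "X \<subseteq> mesh_L R C"
  defines "x \<equiv> \<lambda>i j l. of_bool ((i, j, l) \<in> X) :: nat"
  shows "deg (mesh_E R C) X (i, j, 0) = x i j 14 + x i j 16 + x i j 17"
    "deg (mesh_E R C) X (i, j, 1) = x i j 15 + x i j 16 + x i j 18 + x i j 20"
    "deg (mesh_E R C) X (i, j, 2) = x i j 16 + x i j 17 + x i j 18 + x i j 20 + x i j 19 + x i j 21"
    "deg (mesh_E R C) X (i, j, 3) = x i j 23 + x i j 17 + x i j 19 + x i j 21"
    "deg (mesh_E R C) X (i, j, 4) = x i j 22 + x i j 18 + x i j 19"
    "deg (mesh_E R C) X (i, j, 5) = x i j 22 + (if Suc j < C then x i (Suc j) 14 else 0)"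
    "deg (mesh_E R C) X (i, j, 6) = x i j 23 + x i j 24 + (if Suc i < R then x (Suc i) j 15 else 0)"
proof -
  have no: "(i', j', l) \<in> X \<longleftrightarrow> False" if "l < 14 \<or> 25 \<le> l" for i' j' l
    using X that by (auto simp: mesh_L_def mesh_part_def)
  note s = deg_mesh[OF v] nbs_def present_def cell_nbs_def no x_def
  show "deg (mesh_E R C) X (i, j, 0) = x i j 14 + x i j 16 + x i j 17"
    "deg (mesh_E R C) X (i, j, 1) = x i j 15 + x i j 16 + x i j 18 + x i j 20"
    "deg (mesh_E R C) X (i, j, 2) = x i j 16 + x i j 17 + x i j 18 + x i j 20 + x i j 19 + x i j 21"
    "deg (mesh_E R C) X (i, j, 3) = x i j 23 + x i j 17 + x i j 19 + x i j 21"
    "deg (mesh_E R C) X (i, j, 4) = x i j 22 + x i j 18 + x i j 19"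
    "deg (mesh_E R C) X (i, j, 5) = x i j 22 + (if Suc j < C then x i (Suc j) 14 else 0)"
    "deg (mesh_E R C) X (i, j, 6) = x i j 23 + x i j 24 + (if Suc i < R then x (Suc i) j 15 else 0)"
    by (simp_all add: s)
qed

text \<open>The formula is given by incidence predicates instead of lists of clauses, because the
  reduction decides for a single clause and variable whether the literal occurs.\<close>

definition cnf_sat :: "nat \<Rightarrow> nat \<Rightarrow> (nat \<Rightarrow> nat \<Rightarrow> bool) \<Rightarrow> (nat \<Rightarrow> nat \<Rightarrow> bool) \<Rightarrow> bool" where
  "cnf_sat R C pos neg \<longleftrightarrow> (\<exists>f. \<forall>i < R. \<exists>j < C. pos i j \<and> f j \<or> neg i j \<and> \<not> f j)"

lemma cnf_sat_if_mesh:
  assumes RC: "0 < R" "0 < C"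
    and ext: "ext_gm_defensive_alliance (mesh_V R C) (mesh_E R C) (mesh_U R C) (mesh_N R C pos neg)"
  shows "cnf_sat R C pos neg"
proof -
  interpret alliance_tree "mesh_V R C" "mesh_E R C" "mesh_U R C" "mesh_L R C" "mesh_part R C (\<lambda>l. l < 7)"
    mesh_parent "(0, 0, 7)" mesh_rank by (rule alliance_tree_mesh[OF RC])
  obtain A where A: "A \<subseteq> mesh_V R C - mesh_N R C pos neg" "mesh_U R C \<subseteq> A"
    "globally_minimal (mesh_V R C) (mesh_E R C) A"
    using ext unfolding ext_gm_defensive_alliance_def by blast
  have AUL: "A \<subseteq> mesh_U R C \<union> mesh_L R C"
    using A(1) by (auto simp: mesh_V_def mesh_N_def mesh_U_def mesh_L_def mesh_part_def blocked_def)
  define X where "X = A \<inter> mesh_L R C"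
  have XL: "X \<subseteq> mesh_L R C" unfolding X_def by blast
  have exact: "deg (mesh_E R C) X (i, j, l) = 1" if "i < R" "j < C" "l < 7" for i j l
    using globally_minimal_iff_exact[OF A(2) AUL] A(3) that unfolding X_def by (auto simp: mesh_part_def)
  define x where "x i j l = (of_bool ((i, j, l) \<in> X) :: nat)" for i j l
  have blk: "x i j l = 0" if "blocked R i j (pos i j) (neg i j) l" for i j l
    using that A(1) by (auto simp: x_def X_def mesh_N_def mesh_L_def mesh_part_def mesh_V_def)
  note eqs = group_equations[OF _ _ XL, folded x_def]
  have eq: "x i j 14 + x i j 16 + x i j 17 = 1"
    "x i j 15 + x i j 16 + x i j 18 + x i j 20 = 1"
    "x i j 16 + x i j 17 + x i j 18 + x i j 20 + x i j 19 + x i j 21 = 1"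
    "x i j 23 + x i j 17 + x i j 19 + x i j 21 = 1"
    "x i j 22 + x i j 18 + x i j 19 = 1"
    "x i j 22 + (if Suc j < C then x i (Suc j) 14 else 0) = 1"
    "x i j 23 + x i j 24 + (if Suc i < R then x (Suc i) j 15 else 0) = 1" if ij: "i < R" "j < C" for i j
    using eqs[OF ij] exact[OF ij, of 0] exact[OF ij, of 1] exact[OF ij, of 2] exact[OF ij, of 3]
      exact[OF ij, of 4] exact[OF ij, of 5] exact[OF ij, of 6] by simp_all
  define f where "f j \<longleftrightarrow> x 0 j 15 = 0" for j
  \<comment> \<open>Groups 1, 2 and 3 make 23 the complement of 15, and group 6, whose slack is
    blocked here, makes the next 15 the complement of 23.\<close>
  have T: "x i j 15 = x 0 j 15" if "i < R" "j < C" for i j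
    using that(1)
  proof (induction i)
    case (Suc i)
    have "x i j 24 = 0" by (rule blk) (use Suc.prems in \<open>simp add: blocked_def\<close>)
    then show ?case using eq[of i j] Suc that by simp
  qed simp
  \<comment> \<open>\<open>x i j 14 = 0\<close> says that the clause is reported satisfied on
    entering column \<open>j\<close>. At \<open>j = C\<close> no condition is left: group 5 of the
    last column sees only literal 22 and forces it.\<close>
  have sat: "\<exists>j' < j. pos i j' \<and> f j' \<or> neg i j' \<and> \<not> f j'"
    if "i < R" "j \<le> C" "j < C \<longrightarrow> x i j 14 = 0" for i j
    using that(2,3)
  proof (induction j)
    case 0
    have "x i 0 16 = 0" "x i 0 17 = 0" by (rule blk, simp add: blocked_def)+
    then show ?case using eq(1)[of i 0] 0 RC that(1) by simp
  next
    case (Suc j)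
    then have j: "j < C" by simp
    have H: "x i j 22 = 1" using eq(6)[OF that(1) j] Suc.prems by (simp split: if_splits)
    show ?case
    proof (cases "x i j 14 = 0")
      case True
      then show ?thesis using Suc by (meson less_Suc_eq Suc_leD)
    next
      case False
      note e = eq[OF that(1) j]
      \<comment> \<open>The signal enters unsatisfied and leaves satisfied, which excludes all cases
        except 20 and 21.\<close>
      have z: "x i j 16 = 0" "x i j 17 = 0" "x i j 18 = 0" "x i j 19 = 0" using e(1,5) H False by linarith+
      then have "x i j 20 = 1 \<or> x i j 21 = 1" using e(3) by linarith
      then have "pos i j \<and> f j \<or> neg i j \<and> \<not> f j"
      proof
        assume 1: "x i j 20 = 1"
        then have "pos i j" using blk[of i j 20] by (auto simp: blocked_def)
        moreover have "f j" using e(2) 1 T[OF that(1) j] unfolding f_def by linarith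
        ultimately show ?thesis by blast
      next
        assume 1: "x i j 21 = 1"
        then have "neg i j" using blk[of i j 21] by (auto simp: blocked_def)
        moreover have "\<not> f j" using e(2,3) z 1 T[OF that(1) j] unfolding f_def by linarith
        ultimately show ?thesis by blast
      qed
      then show ?thesis by blast
    qed
  qed
  then show ?thesis unfolding cnf_sat_def by (intro exI[of _ f]) blast
qed

lemma mesh_if_cnf_sat:
  assumes RC: "0 < R" "0 < C" and "cnf_sat R C pos neg"
  shows "ext_gm_defensive_alliance (mesh_V R C) (mesh_E R C) (mesh_U R C) (mesh_N R C pos neg)"
proof -
  interpret alliance_tree "mesh_V R C" "mesh_E R C" "mesh_U R C" "mesh_L R C" "mesh_part R C (\<lambda>l. l < 7)"
    mesh_parent "(0, 0, 7)" mesh_rank by (rule alliance_tree_mesh[OF RC])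
  obtain f where f: "\<And>i. i < R \<Longrightarrow> \<exists>j < C. pos i j \<and> f j \<or> neg i j \<and> \<not> f j"
    using assms(3) unfolding cnf_sat_def by blast
  define h where "h i j \<longleftrightarrow> (\<exists>j' < j. pos i j' \<and> f j' \<or> neg i j' \<and> \<not> f j')" for i j
  have h0: "\<not> h i 0" for i by (simp add: h_def)
  have hS: "h i (Suc j) \<longleftrightarrow> h i j \<or> (pos i j \<and> f j \<or> neg i j \<and> \<not> f j)" for i j
    by (auto simp: h_def less_Suc_eq)
  have hC: "h i C" if "i < R" for i using f[OF that] by (simp add: h_def)
  \<comment> \<open>Dictated by the meaning of the literals. In the bottom row 24 stands in for
    literal 15 of the missing cell below.\<close>
  define lit where "lit i j l \<longleftrightarrow> l = 14 \<and> \<not> h i j \<or> l = 15 \<and> \<not> f j \<or> l = 16 \<and> h i j \<and> f j \<or>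
     l = 17 \<and> h i j \<and> \<not> f j \<or> l = 18 \<and> \<not> h i j \<and> f j \<and> \<not> pos i j \<or> l = 20 \<and> \<not> h i j \<and> f j \<and> pos i j \<or>
     l = 19 \<and> \<not> h i j \<and> \<not> f j \<and> \<not> neg i j \<or> l = 21 \<and> \<not> h i j \<and> \<not> f j \<and> neg i j \<or>
     l = 22 \<and> h i (Suc j) \<or> l = 23 \<and> f j \<or> l = 24 \<and> Suc i = R \<and> \<not> f j" for i j l :: nat
  define X where "X = {(i, j, l). i < R \<and> j < C \<and> lit i j l}"
  have XL: "X \<subseteq> mesh_L R C" by (auto simp: X_def mesh_L_def mesh_part_def lit_def)
  have in_X: "(i, j, l) \<in> X \<longleftrightarrow> i < R \<and> j < C \<and> lit i j l" for i j l by (simp add: X_def)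
  let ?A = "mesh_U R C \<union> X"
  have AL: "?A \<inter> mesh_L R C = X" using XL U_L by blast
  have "deg (mesh_E R C) X u = 1" if u: "u \<in> mesh_part R C (\<lambda>l. l < 7)" for u
  proof -
    obtain i j l where ij: "u = (i, j, l)" "i < R" "j < C" and l: "l < 7" using u by (auto simp: mesh_part_def)
    note g = group_equations[OF ij(2,3) XL]
    have C: "Suc j = C \<Longrightarrow> h i (Suc j)" using hC[OF ij(2)] by simp
    have "l = 0 \<or> l = 1 \<or> l = 2 \<or> l = 3 \<or> l = 4 \<or> l = 5 \<or> l = 6" using l by linarith
    then show ?thesis
    proof (elim disjE)
      assume "l = 5"
      then show ?thesis unfolding ij(1) using g(6) ij C by (cases "Suc j < C") (auto simp: in_X lit_def)
    next
      assume "l = 6"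
      then show ?thesis unfolding ij(1) using g(7) ij by (cases "Suc i < R") (auto simp: in_X lit_def)
    next
      assume "l = 4"
      then show ?thesis unfolding ij(1) using g(5) ij hS[of i j] by (auto simp: in_X lit_def)
    qed (unfold ij(1), use g(1-4) ij in \<open>auto simp: in_X lit_def\<close>)
  qed
  then have "globally_minimal (mesh_V R C) (mesh_E R C) ?A"
    using globally_minimal_iff_exact[of ?A] XL AL by auto
  moreover have "?A \<subseteq> mesh_V R C - mesh_N R C pos neg"
  proof
    fix v assume v: "v \<in> ?A"
    obtain i j l where ij: "v = (i, j, l)" by (cases v)
    have "v \<in> mesh_V R C" using v XL U_V L_V by blast
    moreover have "\<not> blocked R i j (pos i j) (neg i j) l"
      using v h0[of i] unfolding ij by (auto simp: in_X lit_def blocked_def mesh_U_def mesh_part_def)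
    ultimately show "v \<in> mesh_V R C - mesh_N R C pos neg" unfolding ij by (auto simp: mesh_N_def)
  qed
  ultimately show ?thesis unfolding ext_gm_defensive_alliance_def by blast
qed

section \<open>Renaming the vertices\<close>

lemma image_edge_iff:
  assumes "inj_on g V" "\<And>e. e \<in> E \<Longrightarrow> e \<subseteq> V" "u \<in> V" "v \<in> V"
  shows "{g u, g v} \<in> (`) g ` E \<longleftrightarrow> {u, v} \<in> E"
proof
  assume "{g u, g v} \<in> (`) g ` E"
  then obtain e where e: "e \<in> E" "g ` {u, v} = g ` e" by auto
  then have "{u, v} = e" using inj_on_image_eq_iff[OF assms(1), of "{u, v}" e] assms by auto
  then show "{u, v} \<in> E" using e by simp
next
  assume "{u, v} \<in> E"
  then show "{g u, g v} \<in> (`) g ` E" by (intro image_eqI[of _ _ "{u, v}"]) auto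
qed

lemma deg_image:
  assumes "inj_on g V" "\<And>e. e \<in> E \<Longrightarrow> e \<subseteq> V" "X \<subseteq> V" "v \<in> V"
  shows "deg ((`) g ` E) (g ` X) (g v) = deg E X v"
proof -
  have "{w \<in> g ` X. {g v, w} \<in> (`) g ` E} = g ` {w \<in> X. {v, w} \<in> E}"
    using image_edge_iff[OF assms(1,2,4)] assms(3) by auto
  moreover have "inj_on g {w \<in> X. {v, w} \<in> E}" using assms by (auto intro: inj_on_subset)
  ultimately show ?thesis unfolding deg_def by (simp add: card_image)
qed

lemma defensive_alliance_image:
  assumes g: "inj_on g V" "\<And>e. e \<in> E \<Longrightarrow> e \<subseteq> V" and A: "A \<subseteq> V"
  shows "defensive_alliance (g ` V) ((`) g ` E) (g ` A) \<longleftrightarrow> defensive_alliance V E A"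
proof -
  have "g ` V - g ` A = g ` (V - A)" using inj_on_image_set_diff[OF g(1), of V A] A by auto
  then have "deg ((`) g ` E) (g ` A) (g v) = deg E A v"
    "deg ((`) g ` E) (g ` V - g ` A) (g v) = deg E (V - A) v" if "v \<in> A" for v
    using deg_image[OF g, where X = A and v = v] deg_image[OF g, where X = "V - A" and v = v] that A by auto
  then show ?thesis unfolding defensive_alliance_def using A by auto
qed

lemma globally_minimal_image:
  assumes g: "inj_on g V" "\<And>e. e \<in> E \<Longrightarrow> e \<subseteq> V" and A: "A \<subseteq> V"
  shows "globally_minimal (g ` V) ((`) g ` E) (g ` A) \<longleftrightarrow> globally_minimal V E A"
proof -
  have sub: "(\<exists>B'. B' \<subset> g ` A \<and> B' \<noteq> {} \<and> defensive_alliance (g ` V) ((`) g ` E) B') \<longleftrightarrow>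
     (\<exists>B. B \<subset> A \<and> B \<noteq> {} \<and> defensive_alliance V E B)"
  proof
    assume "\<exists>B'. B' \<subset> g ` A \<and> B' \<noteq> {} \<and> defensive_alliance (g ` V) ((`) g ` E) B'"
    then obtain B' where B': "B' \<subset> g ` A" "B' \<noteq> {}" "defensive_alliance (g ` V) ((`) g ` E) B'" by blast
    then obtain B where B: "B \<subseteq> A" "B' = g ` B" by (meson psubset_imp_subset subset_image_iff)
    have "B \<subseteq> V" using B A by blast
    then have "defensive_alliance V E B" using B' B defensive_alliance_image[OF g] by blast
    then show "\<exists>B. B \<subset> A \<and> B \<noteq> {} \<and> defensive_alliance V E B" using B B' by (intro exI[of _ B]) auto
  next
    assume "\<exists>B. B \<subset> A \<and> B \<noteq> {} \<and> defensive_alliance V E B"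
    then obtain B where B: "B \<subset> A" "B \<noteq> {}" "defensive_alliance V E B" by blast
    have BV: "B \<subseteq> V" using B A by blast
    have "g ` B \<noteq> g ` A" using inj_on_image_eq_iff[OF g(1) BV A] B(1) by blast
    then have "g ` B \<subset> g ` A" using B(1) by blast
    then show "\<exists>B'. B' \<subset> g ` A \<and> B' \<noteq> {} \<and> defensive_alliance (g ` V) ((`) g ` E) B'"
      using B defensive_alliance_image[OF g BV] by (intro exI[of _ "g ` B"]) auto
  qed
  show ?thesis unfolding globally_minimal_def sub using defensive_alliance_image[OF g A] by auto
qed

lemma ext_gm_image:
  assumes g: "inj_on g V" "\<And>e. e \<in> E \<Longrightarrow> e \<subseteq> V" and "U \<subseteq> V" "N \<subseteq> V"
  shows "ext_gm_defensive_alliance (g ` V) ((`) g ` E) (g ` U) (g ` N) \<longleftrightarrow> ext_gm_defensive_alliance V E U N"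
proof
  assume "ext_gm_defensive_alliance (g ` V) ((`) g ` E) (g ` U) (g ` N)"
  then obtain A' where A': "A' \<subseteq> g ` V - g ` N" "g ` U \<subseteq> A'" "globally_minimal (g ` V) ((`) g ` E) A'"
    unfolding ext_gm_defensive_alliance_def by blast
  have "A' \<subseteq> g ` (V - N)" using A'(1) by blast
  then obtain A where A: "A \<subseteq> V - N" "A' = g ` A" by (meson subset_image_iff)
  have "A \<subseteq> V" using A(1) by blast
  then have "U \<subseteq> A" using A'(2) inj_on_image_subset_iff[OF g(1) assms(3)] unfolding A(2) by blast
  moreover have "globally_minimal V E A"
    using A'(3) globally_minimal_image[OF g, where A = A] \<open>A \<subseteq> V\<close> unfolding A(2) by blast
  ultimately show "ext_gm_defensive_alliance V E U N"
    unfolding ext_gm_defensive_alliance_def using A(1) by (intro exI[of _ A] conjI)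
next
  assume "ext_gm_defensive_alliance V E U N"
  then obtain A where A: "A \<subseteq> V - N" "U \<subseteq> A" "globally_minimal V E A"
    unfolding ext_gm_defensive_alliance_def by blast
  have "g ` A \<subseteq> g ` V - g ` N"
    using image_mono[OF A(1), of g] inj_on_image_set_diff[OF g(1) _ assms(4), of V] by auto
  moreover have "A \<subseteq> V" using A(1) by blast
  then have "globally_minimal (g ` V) ((`) g ` E) (g ` A)"
    using globally_minimal_image[OF g, where A = A] A(3) by blast
  moreover have "g ` U \<subseteq> g ` A" using A(2) by (rule image_mono)
  ultimately show "ext_gm_defensive_alliance (g ` V) ((`) g ` E) (g ` U) (g ` N)"
    unfolding ext_gm_defensive_alliance_def by (intro exI[of _ "g ` A"] conjI)
qed

lemma simple_graph_image:
  assumes "inj_on g V" "simple_graph V E"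
  shows "simple_graph (g ` V) ((`) g ` E)"
  using assms unfolding simple_graph_def by (auto simp: card_image inj_on_subset)

lemma bipartite_image:
  assumes "inj_on g V" "bipartite V E"
  shows "bipartite (g ` V) ((`) g ` E)"
proof -
  obtain X Y where XY: "X \<union> Y = V" "X \<inter> Y = {}" "\<forall>e \<in> E. \<exists>x \<in> X. \<exists>y \<in> Y. e = {x, y}"
    using assms(2) unfolding bipartite_def by blast
  have "g ` X \<inter> g ` Y = {}" using inj_on_image_Int[OF assms(1), of X Y] XY by auto
  moreover have "\<exists>x \<in> g ` X. \<exists>y \<in> g ` Y. g ` e = {x, y}" if "e \<in> E" for e
    using bspec[OF XY(3) that] by auto
  ultimately show ?thesis unfolding bipartite_def using XY(1)
    by (intro exI[of _ "g ` X"] exI[of _ "g ` Y"]) (auto simp: image_Un[symmetric])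
qed

lemma planar_image:
  assumes g: "inj_on g V" "\<And>e. e \<in> E \<Longrightarrow> e \<subseteq> V" and "planar V E"
  shows "planar (g ` V) ((`) g ` E)"
proof -
  obtain pt and \<gamma> :: "'a set \<Rightarrow> real \<Rightarrow> complex" where pl: "inj_on pt V"
    "\<forall>e \<in> E. arc (\<gamma> e) \<and> {pathstart (\<gamma> e), pathfinish (\<gamma> e)} = pt ` e \<and> path_image (\<gamma> e) \<inter> pt ` V = pt ` e"
    "\<forall>e \<in> E. \<forall>e' \<in> E. e \<noteq> e' \<longrightarrow> path_image (\<gamma> e) \<inter> path_image (\<gamma> e') = pt ` (e \<inter> e')"
    using assms(3) unfolding planar_def by blast
  define k where "k = inv_into V g"
  have k: "k (g v) = v" if "v \<in> V" for v using that g(1) by (simp add: k_def)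
  have kim: "k ` g ` S = S" if "S \<subseteq> V" for S using k that by (force simp: image_image)
  have pim: "(pt \<circ> k) ` g ` S = pt ` S" if "S \<subseteq> V" for S by (simp only: image_comp[symmetric] kim[OF that])
  have int: "g ` e \<inter> g ` e' = g ` (e \<inter> e')" if "e \<in> E" "e' \<in> E" for e e'
    using inj_on_image_Int[OF g(1), of e e'] g(2) that by auto
  show ?thesis
    unfolding planar_def
  proof (intro exI[of _ "pt \<circ> k"] exI[of _ "\<lambda>e. \<gamma> (k ` e)"] conjI ballI impI)
    show "inj_on (pt \<circ> k) (g ` V)" using pl(1) k by (auto simp: inj_on_def)
  next
    fix e' assume "e' \<in> (`) g ` E"
    then obtain e where e: "e \<in> E" "e' = g ` e" by blast
    have s: "e \<subseteq> V" using g(2) e by blast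
    show "arc (\<gamma> (k ` e'))" "{pathstart (\<gamma> (k ` e')), pathfinish (\<gamma> (k ` e'))} = (pt \<circ> k) ` e'"
      "path_image (\<gamma> (k ` e')) \<inter> (pt \<circ> k) ` g ` V = (pt \<circ> k) ` e'"
      using bspec[OF pl(2) e(1)] unfolding e(2) kim[OF s] pim[OF s] pim[OF order_refl] by blast+
  next
    fix e1 e2 assume "e1 \<in> (`) g ` E" "e2 \<in> (`) g ` E" and ne: "e1 \<noteq> e2"
    then obtain a b where ab: "a \<in> E" "e1 = g ` a" "b \<in> E" "e2 = g ` b" by blast
    have s: "a \<subseteq> V" "b \<subseteq> V" using g(2) ab by blast+
    have "a \<inter> b \<subseteq> V" using s by blast
    then show "path_image (\<gamma> (k ` e1)) \<inter> path_image (\<gamma> (k ` e2)) = (pt \<circ> k) ` (e1 \<inter> e2)"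
      using pl(3) ab ne unfolding ab(2,4) int[OF ab(1,3)] kim[OF s(1)] kim[OF s(2)] pim[OF \<open>a \<inter> b \<subseteq> V\<close>] by blast
  qed
qed

section \<open>Numbering the mesh\<close>

definition vertex_id :: "nat \<Rightarrow> nat \<times> nat \<times> nat \<Rightarrow> nat" where
  "vertex_id C v = (case v of (i, j, l) \<Rightarrow> (i * C + j) * 48 + l)"

definition vertex_of :: "nat \<Rightarrow> nat \<Rightarrow> nat \<times> nat \<times> nat" where
  "vertex_of C u = (u div 48 div C, u div 48 mod C, u mod 48)"

lemma vertex_of_id:
  assumes "v \<in> mesh_V R C"
  shows "vertex_of C (vertex_id C v) = v"
proof -
  obtain i j l where v: "v = (i, j, l)" "i < R" "j < C" "l < 48" using assms by (auto simp: mesh_V_def)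
  have gen: "(a * c + b) div c = a" "(a * c + b) mod c = b" if "b < c" for a b c :: nat
    using that by simp_all
  have "((i * C + j) * 48 + l) div 48 = i * C + j" "((i * C + j) * 48 + l) mod 48 = l" "(i * C + j) div C = i" "(i * C + j) mod C = j"
    by (rule gen, rule v)+
  then show ?thesis unfolding v(1) vertex_id_def vertex_of_def prod.case by (simp only:)
qed

lemma vertex_id_of:
  "vertex_id C (vertex_of C u) = u"
  unfolding vertex_id_def vertex_of_def prod.case by (simp only: div_mult_mod_eq)

lemma vertex_of_mesh:
  assumes "0 < C" "u < R * C * 48"
  shows "vertex_of C u \<in> mesh_V R C"
proof -
  have "u div 48 < R * C" using assms by (simp add: less_mult_imp_div_less)
  then show ?thesis using assms by (simp add: vertex_of_def mesh_V_def less_mult_imp_div_less)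
qed

lemma vertex_id_less:
  assumes "v \<in> mesh_V R C"
  shows "vertex_id C v < R * C * 48"
proof -
  obtain i j l where v: "v = (i, j, l)" "i < R" "j < C" "l < 48" using assms by (auto simp: mesh_V_def)
  have "Suc i * C \<le> R * C" using v by (intro mult_le_mono1) simp
  then have "i * C + j + 1 \<le> R * C" using v by simp
  then have "(i * C + j + 1) * 48 \<le> R * C * 48" by (rule mult_le_mono1)
  then show ?thesis using v by (simp add: vertex_id_def)
qed

lemma vertex_id_image:
  assumes "0 < C"
  shows "vertex_id C ` {v \<in> mesh_V R C. P v} = {u. u < R * C * 48 \<and> P (vertex_of C u)}"
proof (intro equalityI subsetI)
  fix u assume u: "u \<in> {u. u < R * C * 48 \<and> P (vertex_of C u)}"
  then show "u \<in> vertex_id C ` {v \<in> mesh_V R C. P v}"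
    using vertex_of_mesh[OF assms, of u R] vertex_id_of[of C u] by (intro image_eqI[of _ _ "vertex_of C u"]) auto
qed (auto simp: vertex_of_id vertex_id_less)

lemma vertex_id_inj: "inj_on (vertex_id C) (mesh_V R C)"
  by (rule inj_on_inverseI[of _ "vertex_of C"]) (rule vertex_of_id)

definition num_E :: "nat \<Rightarrow> nat \<Rightarrow> nat set set" where
  "num_E R C = (`) (vertex_id C) ` mesh_E R C"

definition num_U :: "nat \<Rightarrow> nat \<Rightarrow> nat set" where
  "num_U R C = vertex_id C ` mesh_U R C"

definition num_N :: "nat \<Rightarrow> nat \<Rightarrow> (nat \<Rightarrow> nat \<Rightarrow> bool) \<Rightarrow> (nat \<Rightarrow> nat \<Rightarrow> bool) \<Rightarrow> nat set" where
  "num_N R C pos neg = vertex_id C ` mesh_N R C pos neg"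

lemma num_V: "0 < C \<Longrightarrow> {0..<R * C * 48} = vertex_id C ` mesh_V R C"
  using vertex_id_image[of C R "\<lambda>_. True"] by auto

lemma mesh_E_sub: "e \<in> mesh_E R C \<Longrightarrow> e \<subseteq> mesh_V R C"
  using simple_mesh unfolding simple_graph_def by blast

lemma mesh_sub: "mesh_U R C \<subseteq> mesh_V R C" "mesh_N R C pos neg \<subseteq> mesh_V R C"
  by (auto simp: mesh_U_def mesh_N_def mesh_V_def mesh_part_def)

lemma num_valid: "0 < C \<Longrightarrow> valid_input (R * C * 48) (num_E R C) (num_U R C) (num_N R C pos neg)"
  unfolding valid_input_def num_E_def num_U_def num_N_def num_V
  using simple_graph_image[OF vertex_id_inj simple_mesh] mesh_sub by blast

lemma num_planar_bipartite:
  assumes "0 < C"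
  shows "encode (R * C * 48) (num_E R C) (num_U R C) (num_N R C pos neg) \<in> planar_bipartite_inputs 9"
proof -
  have "planar {0..<R * C * 48} (num_E R C)" "bipartite {0..<R * C * 48} (num_E R C)"
    unfolding num_E_def num_V[OF assms]
    using planar_image[OF vertex_id_inj mesh_E_sub planar_mesh] bipartite_image[OF vertex_id_inj bipartite_mesh] by blast+
  moreover have "deg (num_E R C) {0..<R * C * 48} v \<le> 9" if "v \<in> {0..<R * C * 48}" for v
  proof -
    have "v \<in> vertex_id C ` mesh_V R C" using that num_V[OF assms, of R] by simp
    then obtain u where u: "u \<in> mesh_V R C" "v = vertex_id C u" by (elim imageE)
    have "deg (num_E R C) {0..<R * C * 48} v = deg (mesh_E R C) (mesh_V R C) u"
      unfolding num_E_def num_V[OF assms] u(2)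
      by (rule deg_image[OF vertex_id_inj mesh_E_sub order_refl u(1)])
    then show ?thesis using deg_mesh_le[OF u(1)] by simp
  qed
  ultimately show ?thesis unfolding planar_bipartite_inputs_def using num_valid[OF assms] by blast
qed

text \<open>Membership of a code only says that some input with this code is a yes-instance;
  injectivity of the encoding identifies that input with the mesh.\<close>

theorem num_ext_iff:
  assumes RC: "0 < R" "0 < C"
  shows "encode (R * C * 48) (num_E R C) (num_U R C) (num_N R C pos neg) \<in> Ext_GM_Defensive_Alliance \<longleftrightarrow>
    cnf_sat R C pos neg"
proof -
  have "encode (R * C * 48) (num_E R C) (num_U R C) (num_N R C pos neg) \<in> Ext_GM_Defensive_Alliance \<longleftrightarrow>
      ext_gm_defensive_alliance {0..<R * C * 48} (num_E R C) (num_U R C) (num_N R C pos neg)"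
  proof
    assume "encode (R * C * 48) (num_E R C) (num_U R C) (num_N R C pos neg) \<in> Ext_GM_Defensive_Alliance"
    then obtain n E U N where *: "encode (R * C * 48) (num_E R C) (num_U R C) (num_N R C pos neg) = encode n E U N"
      "valid_input n E U N" "ext_gm_defensive_alliance {0..<n} E U N"
      unfolding Ext_GM_Defensive_Alliance_def by blast
    from encode_inject[OF num_valid[OF RC(2)] *(2) *(1)] *(3)
    show "ext_gm_defensive_alliance {0..<R * C * 48} (num_E R C) (num_U R C) (num_N R C pos neg)" by simp
  next
    assume "ext_gm_defensive_alliance {0..<R * C * 48} (num_E R C) (num_U R C) (num_N R C pos neg)"
    then show "encode (R * C * 48) (num_E R C) (num_U R C) (num_N R C pos neg) \<in> Ext_GM_Defensive_Alliance"
      unfolding Ext_GM_Defensive_Alliance_def using num_valid[OF RC(2)] by blast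
  qed
  also have "\<dots> \<longleftrightarrow> ext_gm_defensive_alliance (mesh_V R C) (mesh_E R C) (mesh_U R C) (mesh_N R C pos neg)"
    unfolding num_V[OF RC(2)] num_E_def num_U_def num_N_def
    by (rule ext_gm_image[OF vertex_id_inj mesh_E_sub mesh_sub])
  also have "\<dots> \<longleftrightarrow> cnf_sat R C pos neg"
    using cnf_sat_if_mesh[OF RC] mesh_if_cnf_sat[OF RC] by blast
  finally show ?thesis .
qed

section \<open>From a language in NP to clause schemes\<close>

lemma step_halted: "states M \<le> q \<Longrightarrow> (step M ^^ t) (q, ts) = (q, ts)"
  by (induction t) simp_all

text \<open>\<open>T\<close> is the time bound for the longest certificates. By monotonicity it
  covers the shorter ones, where the machine halts and keeps its configuration until
  \<open>T\<close>.\<close>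

lemma NP_schemes:
  assumes "K \<in> NP"
  obtains M p q where "tm_wf M"
    "\<And>x r P T S. \<lbrakk>r 0 = length x; r 2 = T; r 3 = P; r 4 = S; P = poly p (length x);
       T = poly q (length x + P); S = T + length x + P + 4\<rbrakk> \<Longrightarrow>
       x \<in> K \<longleftrightarrow> (\<exists>\<alpha>. \<forall>c \<in> set (schemes M). scheme_sat (bits x) r T S \<alpha> c)"
proof -
  obtain R p where R: "poly_time_verifier R" "\<And>x. x \<in> K \<longleftrightarrow> (\<exists>y. length y \<le> poly p (length x) \<and> R x y)"
    using assms unfolding NP_def by blast
  obtain M q where M': "tm_wf M \<and> (\<forall>x y. outputs_within M (bits x @ [4] @ bits y) (bits [R x y]) (poly q (length x + length y)))"
    using R(1) unfolding poly_time_verifier_def by (elim exE)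
  note M = conjunct1[OF M'] conjunct2[OF M', rule_format]
  have "x \<in> K \<longleftrightarrow> (\<exists>\<alpha>. \<forall>c \<in> set (schemes M). scheme_sat (bits x) r T S \<alpha> c)"
    if r: "r 0 = length x" "r 2 = T" "r 3 = P" "r 4 = S" and P: "P = poly p (length x)"
      and T: "T = poly q (length x + P)" and S: "S = T + length x + P + 4" for x r P T S
  proof -
    interpret tableau M "bits x" r "length x" P T S
      by unfold_locales (auto simp: M(1) r S bits_def)
    have "run.accept M (bits x) T y \<longleftrightarrow> R x y" if y: "length y \<le> P" for y
    proof -
      interpret run M "bits x" r "length x" P T S y
        by unfold_locales (rule y)
      obtain t' where t': "t' \<le> poly q (length x + length y)"
        "case (step M ^^ t') (init M input) of (q, ts) \<Rightarrow> q = states M \<and> fst (ts ! 1) = contents (bits [R x y])"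
        using M(2)[of x y, folded input_def] unfolding outputs_within_def by (elim exE conjE) (rule that)
      obtain ts where ts: "cfg t' = (states M, ts)" "fst (ts ! 1) = contents (bits [R x y])"
        using t'(2) by (auto simp: cfg_def)
      have "t' \<le> T" using t'(1) poly_nat_mono[of "length x + length y" "length x + P" q] y T by simp
      then obtain k where k: "T = k + t'" by (metis le_add_diff_inverse2)
      have "cfg T = (step M ^^ k) (cfg t')" unfolding cfg_def k funpow_add by simp
      then have "cfg T = (states M, ts)" unfolding ts(1) by (simp add: step_halted)
      then show ?thesis using ts(2) unfolding accept_def st_def cell_def by (simp add: contents_def bits_def)
    qed
    then show ?thesis unfolding sat_iff R(2) P[symmetric] by (intro ex_cong1 conj_cong refl) blast
  qed
  then show ?thesis using that[OF M(1)] by (metis (no_types))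
qed

section \<open>Scheme instances as rows, tableau variables as columns\<close>

definition kinds :: "scheme list \<Rightarrow> kind list" where
  "kinds cs = concat (map (\<lambda>c. map (\<lambda>l. fst (snd l)) (snd c)) cs)"

text \<open>The list may repeat kinds; it is enough that a kind can be recovered from the position
  of its first occurrence.\<close>

definition kind_index :: "kind list \<Rightarrow> kind \<Rightarrow> nat" where
  "kind_index ks \<kappa> = length (takeWhile (\<lambda>x. x \<noteq> \<kappa>) ks)"

lemma kind_index:
  assumes "\<kappa> \<in> set ks"
  shows "kind_index ks \<kappa> < length ks" "ks ! kind_index ks \<kappa> = \<kappa>"
proof -
  show l: "kind_index ks \<kappa> < length ks"
    unfolding kind_index_def using assms by (metis (mono_tags, lifting) length_takeWhile_le le_neq_implies_less
        takeWhile_eq_all_conv takeWhile_eq_take take_all_iff order_refl)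
  show "ks ! kind_index ks \<kappa> = \<kappa>"
    using nth_length_takeWhile[of "\<lambda>x. x \<noteq> \<kappa>" ks] l unfolding kind_index_def by blast
qed

lemma pack_less:
  fixes a b m n :: nat
  assumes "a < m" "b < n"
  shows "a * n + b < m * n"
proof -
  have "Suc a * n \<le> m * n" using assms(1) by (intro mult_le_mono1) simp
  then show ?thesis using assms(2) by simp
qed

text \<open>
  Row \<open>((d (T + 1) + t) S + p) S + o'\<close> is scheme \<open>d\<close> at \<open>t\<close>, \<open>p\<close>, \<open>o'\<close>; column
  \<open>(c (T + 1) + t) S + p\<close> is the variable \<open>(\<kappa>, t, p)\<close> where \<open>c\<close> is the index of \<open>\<kappa>\<close>.
  A row whose guard fails contains all literals.
\<close>

definition row_env :: "(nat \<Rightarrow> nat) \<Rightarrow> nat \<Rightarrow> nat \<Rightarrow> nat \<Rightarrow> nat \<Rightarrow> nat" where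
  "row_env r T S i = r(10 := i div S div S mod (T + 1), 11 := i div S mod S, 12 := i mod S)"

definition occurs :: "scheme list \<Rightarrow> nat list \<Rightarrow> (nat \<Rightarrow> nat) \<Rightarrow> nat \<Rightarrow> nat \<Rightarrow> bool \<Rightarrow> nat \<Rightarrow> nat \<Rightarrow> bool" where
  "occurs cs w r T S s i j \<longleftrightarrow> (let c = cs ! (i div S div S div (T + 1)) in holds (fst c) w (row_env r T S i) \<longrightarrow>
     (\<exists>(s', \<kappa>, te, pe) \<in> set (snd c). s' = s \<and> j div S div (T + 1) = kind_index (kinds cs) \<kappa> \<and>
        j div S mod (T + 1) = eval te w (row_env r T S i) \<and> j mod S = eval pe w (row_env r T S i)))"

text \<open>Assignments are translated by the mixed-radix numbering of kind, time and position. A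
  row with a failing guard is satisfied already in column 0, whose existence needs
  \<open>kinds cs \<noteq> []\<close>.\<close>

theorem cnf_sat_schemes:
  assumes S: "0 < S" and ks: "kinds cs \<noteq> []"
  shows "cnf_sat (length cs * (T + 1) * S * S) (length (kinds cs) * (T + 1) * S)
      (occurs cs w r T S True) (occurs cs w r T S False) \<longleftrightarrow> (\<exists>\<alpha>. \<forall>c \<in> set cs. scheme_sat w r T S \<alpha> c)"
    (is "cnf_sat ?R ?C ?p ?n \<longleftrightarrow> _")
proof
  assume "cnf_sat ?R ?C ?p ?n"
  then obtain f where f: "\<And>i. i < ?R \<Longrightarrow> \<exists>j < ?C. ?p i j \<and> f j \<or> ?n i j \<and> \<not> f j" unfolding cnf_sat_def by blast
  define \<alpha> where "\<alpha> \<kappa> t p = f ((kind_index (kinds cs) \<kappa> * (T + 1) + t) * S + p)" for \<kappa> t p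
  have "scheme_sat w r T S \<alpha> c" if c: "c \<in> set cs" for c
    unfolding scheme_sat_def
  proof (intro allI impI)
    fix t p o' assume t: "t \<le> T" "p < S" "o' < S" and g: "holds (fst c) w (r(10 := t, 11 := p, 12 := o'))"
    obtain d where d: "d < length cs" "cs ! d = c" using c by (auto simp: in_set_conv_nth)
    define i where "i = ((d * (T + 1) + t) * S + p) * S + o'"
    have "i < ?R" unfolding i_def using d(1) t by (intro pack_less) simp_all
    then obtain j where j: "j < ?C" "?p i j \<and> f j \<or> ?n i j \<and> \<not> f j" using f by blast
    have i: "i mod S = o'" "i div S = (d * (T + 1) + t) * S + p" "i div S mod S = p" "i div S div S = d * (T + 1) + t"
      "i div S div S mod (T + 1) = t" "i div S div S div (T + 1) = d"
    proof -
      have dm: "(a * m + b) div m = a" "(a * m + b) mod m = b" if "b < m" for a b m :: nat using that by simp_all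
      show 1: "i mod S = o'" "i div S = (d * (T + 1) + t) * S + p" unfolding i_def by (rule dm, rule t)+
      show 2: "i div S mod S = p" "i div S div S = d * (T + 1) + t" unfolding 1 by (rule dm, rule t)+
      have "t < T + 1" using t by simp
      then show "i div S div S mod (T + 1) = t" "i div S div S div (T + 1) = d" unfolding 2 by (rule dm[rotated])+
    qed
    have e: "row_env r T S i = r(10 := t, 11 := p, 12 := o')" unfolding row_env_def i(1,3,5) ..
    obtain s \<kappa> te pe where l: "(s, \<kappa>, te, pe) \<in> set (snd c)" "f j = s" "j div S div (T + 1) = kind_index (kinds cs) \<kappa>"
      "j div S mod (T + 1) = eval te w (row_env r T S i)" "j mod S = eval pe w (row_env r T S i)"
      using j(2) g unfolding occurs_def Let_def i(6) d(2) e by blast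
    have "j = (j div S div (T + 1) * (T + 1) + j div S mod (T + 1)) * S + j mod S"
      by (simp only: div_mult_mod_eq)
    then have "f j = \<alpha> \<kappa> (eval te w (row_env r T S i)) (eval pe w (row_env r T S i))"
      unfolding \<alpha>_def l(3-5)[symmetric] by (rule arg_cong)
    moreover have "j div S mod (T + 1) < T + 1" "j mod S < S" using S by simp_all
    ultimately show "\<exists>(s, \<kappa>, te, pe) \<in> set (snd c).
        eval te w (r(10 := t, 11 := p, 12 := o')) \<le> T \<and> eval pe w (r(10 := t, 11 := p, 12 := o')) < S \<and>
        \<alpha> \<kappa> (eval te w (r(10 := t, 11 := p, 12 := o'))) (eval pe w (r(10 := t, 11 := p, 12 := o'))) = s"
      using l(1,2) unfolding l(4,5) e by (intro bexI[OF _ l(1)]) auto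
  qed
  then show "\<exists>\<alpha>. \<forall>c \<in> set cs. scheme_sat w r T S \<alpha> c" by blast
next
  assume "\<exists>\<alpha>. \<forall>c \<in> set cs. scheme_sat w r T S \<alpha> c"
  then obtain \<alpha> where \<alpha>: "\<And>c. c \<in> set cs \<Longrightarrow> scheme_sat w r T S \<alpha> c" by blast
  define f where "f j = \<alpha> (kinds cs ! (j div S div (T + 1))) (j div S mod (T + 1)) (j mod S)" for j
  have "\<exists>j < ?C. ?p i j \<and> f j \<or> ?n i j \<and> \<not> f j" if i: "i < ?R" for i
  proof -
    define c where "c = cs ! (i div S div S div (T + 1))"
    have "i div S < length cs * (T + 1) * S" using i by (rule less_mult_imp_div_less)
    then have "i div S div S < length cs * (T + 1)" by (rule less_mult_imp_div_less)
    then have "i div S div S div (T + 1) < length cs" by (rule less_mult_imp_div_less)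
    then have c: "c \<in> set cs" unfolding c_def by (rule nth_mem)
    show ?thesis
    proof (cases "holds (fst c) w (row_env r T S i)")
      case False
      then have "?p i 0" "?n i 0" unfolding occurs_def Let_def c_def by blast+
      moreover have "0 < ?C" using S ks by simp
      ultimately show ?thesis by blast
    next
      case True
      have "i div S div S mod (T + 1) \<le> T" "i div S mod S < S" "i mod S < S" using S by (simp_all add: less_Suc_eq_le[symmetric])
      then obtain s \<kappa> te pe where l: "(s, \<kappa>, te, pe) \<in> set (snd c)" "eval te w (row_env r T S i) \<le> T"
        "eval pe w (row_env r T S i) < S" "\<alpha> \<kappa> (eval te w (row_env r T S i)) (eval pe w (row_env r T S i)) = s"
        using \<alpha>[OF c] True unfolding scheme_sat_def row_env_def by blast
      define j where "j = (kind_index (kinds cs) \<kappa> * (T + 1) + eval te w (row_env r T S i)) * S + eval pe w (row_env r T S i)"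
      have dm: "(a * m + b) div m = a" "(a * m + b) mod m = b" if "b < m" for a b m :: nat using that by simp_all
      have 1: "j mod S = eval pe w (row_env r T S i)"
        "j div S = kind_index (kinds cs) \<kappa> * (T + 1) + eval te w (row_env r T S i)"
        unfolding j_def by (rule dm, rule l)+
      have te: "eval te w (row_env r T S i) < T + 1" using l(2) by simp
      have 2: "j div S mod (T + 1) = eval te w (row_env r T S i)" "j div S div (T + 1) = kind_index (kinds cs) \<kappa>"
        unfolding 1 by (rule dm, rule te)+
      have "\<kappa> \<in> set (kinds cs)" unfolding kinds_def using c l(1) by force
      note k = kind_index[OF this]
      have "j < ?C" unfolding j_def using k(1) te l(3) by (intro pack_less)
      moreover have "f j = s" unfolding f_def 1(1) 2 k(2) by (rule l(4))
      moreover have "occurs cs w r T S s i j"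
        unfolding occurs_def Let_def c_def[symmetric] 1(1) 2 by (intro impI bexI[OF _ l(1)]) simp
      ultimately show ?thesis by (cases s) auto
    qed
  qed
  then show "cnf_sat ?R ?C ?p ?n" unfolding cnf_sat_def by blast
qed

text \<open>The variables that schemes may read: input length, \<open>T\<close>, \<open>P\<close>,
  \<open>S\<close> and the three instance parameters. All others are free for the bookkeeping of the
  reduction.\<close>

definition agree :: "(nat \<Rightarrow> nat) \<Rightarrow> (nat \<Rightarrow> nat) \<Rightarrow> bool" where
  "agree r r' \<longleftrightarrow> (\<forall>v \<in> {0, 2, 3, 4, 10, 11, 12}. r v = r' v)"

definition scheme_ok :: "scheme \<Rightarrow> bool" where
  "scheme_ok c \<longleftrightarrow> (\<forall>w r r'. agree r r' \<longrightarrow> holds (fst c) w r = holds (fst c) w r' \<and>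
     (\<forall>(s, \<kappa>, te, pe) \<in> set (snd c). eval te w r = eval te w r' \<and> eval pe w r = eval pe w r'))"

lemma schemes_ok: "c \<in> set (schemes M) \<Longrightarrow> scheme_ok c"
proof -
  assume c: "c \<in> set (schemes M)"
  have "\<forall>c \<in> set (start_schemes M). scheme_ok c"
    by (auto simp: start_schemes_def scheme_ok_def agree_def)
  moreover have "\<forall>c \<in> set input_schemes. scheme_ok c"
    by (auto simp: input_schemes_def scheme_ok_def agree_def)
  moreover have "\<forall>c \<in> set (read_schemes M). scheme_ok c"
    by (auto simp: read_schemes_def scheme_ok_def agree_def)
  moreover have "\<forall>c \<in> set (delta_schemes M). scheme_ok c"
    by (auto simp: delta_schemes_def conditions_def scheme_ok_def agree_def)
  moreover have "\<forall>c \<in> set (step_schemes M). scheme_ok c"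
    by (auto simp: step_schemes_def all_moves_def scheme_ok_def agree_def)
  moreover have "\<forall>c \<in> set (end_schemes M). scheme_ok c"
    by (auto simp: end_schemes_def scheme_ok_def agree_def)
  ultimately show ?thesis using c unfolding schemes_def by auto
qed

section \<open>The reduction as an expression\<close>

text \<open>Selecting a scheme by a computed index has to become a finite disjunction over
  \<open>d\<close>, guarded by comparison with variable 22.\<close>

definition scheme_ex :: "scheme list \<Rightarrow> bool \<Rightarrow> nat \<Rightarrow> ex" where
  "scheme_ex cs s d = And (Eq (Var 22) (Num d)) (Or (Not (fst (cs ! d)))
     (Ors (map (\<lambda>(s', \<kappa>, te, pe). And (Eq (Var 23) (Num (kind_index (kinds cs) \<kappa>))) (And (Eq (Var 24) te) (Eq (Var 25) pe)))
        (filter (\<lambda>l. fst l = s) (snd (cs ! d))))))"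

text \<open>Row and column are expected in variables 13 and 14. The bindings undo the mixed-radix
  numbering and place \<open>t\<close>, \<open>p\<close> and the auxiliary position in the very
  variables 10 to 12 that the schemes read.\<close>

definition occurs_ex :: "scheme list \<Rightarrow> bool \<Rightarrow> ex" where
  "occurs_ex cs s =
     Bind 10 (Mod (Div (Div (Var 13) SE) SE) (Add TE One))
     (Bind 11 (Mod (Div (Var 13) SE) SE)
     (Bind 12 (Mod (Var 13) SE)
     (Bind 22 (Div (Div (Div (Var 13) SE) SE) (Add TE One))
     (Bind 23 (Div (Div (Var 14) SE) (Add TE One))
     (Bind 24 (Mod (Div (Var 14) SE) (Add TE One))
     (Bind 25 (Mod (Var 14) SE)
       (Ors (map (scheme_ex cs s) [0..<length cs]))))))))"

lemma holds_occurs_ex: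
  assumes cs: "\<And>c. c \<in> set cs \<Longrightarrow> scheme_ok c" and S: "0 < S"
    and r: "r 0 = r0 0" "r 2 = r0 2" "r 3 = r0 3" "r 4 = r0 4" and r0: "r0 2 = T" "r0 4 = S"
    and less: "r 13 div S div S div (T + 1) < length cs"
  shows "holds (occurs_ex cs s) w r \<longleftrightarrow> occurs cs w r0 T S s (r 13) (r 14)"
proof -
  define i where "i = r 13"
  define j where "j = r 14"
  define d where "d = i div S div S div (T + 1)"
  define r' where "r' = r(10 := i div S div S mod (T + 1), 11 := i div S mod S, 12 := i mod S, 22 := d,
    23 := j div S div (T + 1), 24 := j div S mod (T + 1), 25 := j mod S)"
  have 1: "holds (occurs_ex cs s) w r \<longleftrightarrow> holds (Ors (map (scheme_ex cs s) [0..<length cs])) w r'"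
    using S r r0 unfolding occurs_ex_def r'_def i_def j_def d_def by simp
  have a: "agree r' (row_env r0 T S i)" using r by (simp add: agree_def row_env_def r'_def)
  have len: "d < length cs" using less by (simp add: d_def i_def)
  then have "cs ! d \<in> set cs" by simp
  from cs[OF this] a have h: "holds (fst (cs ! d)) w r' \<longleftrightarrow> holds (fst (cs ! d)) w (row_env r0 T S i)"
    and l: "\<And>s \<kappa> te pe. (s, \<kappa>, te, pe) \<in> set (snd (cs ! d)) \<Longrightarrow>
      eval te w r' = eval te w (row_env r0 T S i) \<and> eval pe w r' = eval pe w (row_env r0 T S i)"
    unfolding scheme_ok_def by blast+
  have "r' 22 = d" by (simp add: r'_def)
  then have d: "holds (scheme_ex cs s d') w r' \<Longrightarrow> d' = d" for d' by (simp add: scheme_ex_def)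
  have "holds (Ors (map (scheme_ex cs s) [0..<length cs])) w r' \<longleftrightarrow> (\<exists>d' \<in> {0..<length cs}. holds (scheme_ex cs s d') w r')"
    unfolding holds_simps set_map set_upt bex_simps(7) ..
  also have "\<dots> \<longleftrightarrow> holds (scheme_ex cs s d) w r'"
    using d len by (metis atLeastLessThan_iff zero_le)
  finally have 2: "holds (Ors (map (scheme_ex cs s) [0..<length cs])) w r' \<longleftrightarrow> holds (scheme_ex cs s d) w r'" .
  have 3: "r' 22 = d" "r' 23 = j div S div (T + 1)" "r' 24 = j div S mod (T + 1)" "r' 25 = j mod S"
    by (simp_all add: r'_def)
  have "holds (scheme_ex cs s d) w r' \<longleftrightarrow> (holds (fst (cs ! d)) w (row_env r0 T S i) \<longrightarrow>
     (\<exists>l \<in> {l \<in> set (snd (cs ! d)). fst l = s}. holds ((\<lambda>(s', \<kappa>, te, pe). And (Eq (Var 23) (Num (kind_index (kinds cs) \<kappa>))) (And (Eq (Var 24) te) (Eq (Var 25) pe))) l) w r'))"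
    unfolding scheme_ex_def holds_simps h set_map bex_simps(7) set_filter by (simp only: 3 eval.simps eval_Num simp_thms imp_conv_disj)
  also have "\<dots> \<longleftrightarrow> occurs cs w r0 T S s i j"
    unfolding occurs_def Let_def d_def[symmetric] Bex_def split_paired_Ex mem_Collect_eq prod.case fst_conv holds_simps eval.simps eval_Num 3
    using l by (intro imp_cong refl ex_cong1) metis
  finally show ?thesis unfolding 1 2 i_def j_def .
qed

text \<open>Decodes the vertex number in variable \<open>u\<close> as \<open>vertex_of\<close> does,
  with the number of columns taken from variable 6.\<close>

definition cell_ex :: "nat \<Rightarrow> nat \<Rightarrow> nat \<Rightarrow> nat \<Rightarrow> ex \<Rightarrow> ex" where
  "cell_ex u i j l e = Bind i (Div (Div (Var u) (Num 48)) (Var 6))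
     (Bind j (Mod (Div (Var u) (Num 48)) (Var 6)) (Bind l (Mod (Var u) (Num 48)) e))"

definition direction_ex :: "nat \<Rightarrow> nat \<Rightarrow> nat \<Rightarrow> nat \<Rightarrow> nat \<Rightarrow> nat \<Rightarrow> nat \<times> nat \<times> nat \<times> nat \<Rightarrow> ex" where
  "direction_ex i j l i' j' l' = (\<lambda>(a, di, dj, b). And (Eq (Var l) (Num a)) (And (Eq (Var l') (Num b))
     (And (Eq (Var i') (Add (Var i) (Num di))) (And (Eq (Var j') (Add (Var j) (Num dj)))
       (if a = 6 \<and> b = 7 then Eq (Var j) Zero else One)))))"

definition adjacent_ex :: ex where
  "adjacent_ex = cell_ex 20 13 14 15 (cell_ex 21 16 17 18
     (Ors (map (direction_ex 13 14 15 16 17 18) cell_edges @ map (direction_ex 16 17 18 13 14 15) cell_edges)))"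

text \<open>The border conditions of \<open>mesh_E\<close> come from the hypotheses: both numbers
  are in range, so both ends lie in the mesh, and a finite disjunction over the edge table in both
  directions remains.\<close>

lemma holds_adjacent_ex:
  assumes C: "r 6 = C" "0 < C" and uv: "r 20 < R * C * 48" "r 21 < R * C * 48"
  shows "holds adjacent_ex w r \<longleftrightarrow> {r 20, r 21} \<in> num_E R C"
proof -
  obtain i j l where u: "vertex_of C (r 20) = (i, j, l)" by (cases "vertex_of C (r 20)")
  obtain i' j' l' where v: "vertex_of C (r 21) = (i', j', l')" by (cases "vertex_of C (r 21)")
  have m: "(i, j, l) \<in> mesh_V R C" "(i', j', l') \<in> mesh_V R C"
    using vertex_of_mesh[OF C(2) uv(1)] vertex_of_mesh[OF C(2) uv(2)] unfolding u v .
  have id: "vertex_id C (i, j, l) = r 20" "vertex_id C (i', j', l') = r 21"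
    unfolding u[symmetric] v[symmetric] by (rule vertex_id_of)+
  define r' where "r' = r(13 := i, 14 := j, 15 := l, 16 := i', 17 := j', 18 := l')"
  have 1: "holds adjacent_ex w r \<longleftrightarrow>
     holds (Ors (map (direction_ex 13 14 15 16 17 18) cell_edges @ map (direction_ex 16 17 18 13 14 15) cell_edges)) w r'"
    using u v C unfolding adjacent_ex_def cell_ex_def r'_def vertex_of_def by (simp del: holds_simps(9))
  have d: "holds (direction_ex p q k p' q' k' (a, di, dj, b)) w r' \<longleftrightarrow> r' k = a \<and> r' k' = b \<and> r' p' = r' p + di \<and>
      r' q' = r' q + dj \<and> (a = 6 \<and> b = 7 \<longrightarrow> r' q = 0)" for p q k p' q' k' a di dj b
    by (auto simp: direction_ex_def)
  have r': "r' 13 = i" "r' 14 = j" "r' 15 = l" "r' 16 = i'" "r' 17 = j'" "r' 18 = l'" by (simp_all add: r'_def)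
  have "holds adjacent_ex w r \<longleftrightarrow>
     (\<exists>a di dj b. (a, di, dj, b) \<in> set cell_edges \<and> l = a \<and> l' = b \<and> i' = i + di \<and> j' = j + dj \<and> (a = 6 \<and> b = 7 \<longrightarrow> j = 0)) \<or>
     (\<exists>a di dj b. (a, di, dj, b) \<in> set cell_edges \<and> l' = a \<and> l = b \<and> i = i' + di \<and> j = j' + dj \<and> (a = 6 \<and> b = 7 \<longrightarrow> j' = 0))" (is "_ \<longleftrightarrow> ?one \<or> ?two")
    unfolding 1 holds_simps set_append set_map bex_Un bex_simps(7) unfolding Bex_def split_paired_Ex d r' ..
  also have "\<dots> \<longleftrightarrow> {(i, j, l), (i', j', l')} \<in> mesh_E R C"
    unfolding mesh_E_iff
  proof (intro iffI; (elim disjE exE conjE)?)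
    fix a di dj b
    assume "(a, di, dj, b) \<in> set cell_edges" "l = a" "l' = b" "i' = i + di" "j' = j + dj" "a = 6 \<and> b = 7 \<longrightarrow> j = 0"
    then show "\<exists>i0 j0 a di dj b. (a, di, dj, b) \<in> set cell_edges \<and> i0 + di < R \<and> j0 + dj < C \<and> (a = 6 \<and> b = 7 \<longrightarrow> j0 = 0) \<and>
        ((i, j, l) = (i0, j0, a) \<and> (i', j', l') = (i0 + di, j0 + dj, b) \<or> (i', j', l') = (i0, j0, a) \<and> (i, j, l) = (i0 + di, j0 + dj, b))"
      using m(2) unfolding mesh_V_def by - (rule exI[of _ i], rule exI[of _ j], rule exI[of _ a], rule exI[of _ di], rule exI[of _ dj], rule exI[of _ b], simp)
  next
    fix a di dj b
    assume "(a, di, dj, b) \<in> set cell_edges" "l' = a" "l = b" "i = i' + di" "j = j' + dj" "a = 6 \<and> b = 7 \<longrightarrow> j' = 0"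
    then show "\<exists>i0 j0 a di dj b. (a, di, dj, b) \<in> set cell_edges \<and> i0 + di < R \<and> j0 + dj < C \<and> (a = 6 \<and> b = 7 \<longrightarrow> j0 = 0) \<and>
        ((i, j, l) = (i0, j0, a) \<and> (i', j', l') = (i0 + di, j0 + dj, b) \<or> (i', j', l') = (i0, j0, a) \<and> (i, j, l) = (i0 + di, j0 + dj, b))"
      using m(1) unfolding mesh_V_def by - (rule exI[of _ i'], rule exI[of _ j'], rule exI[of _ a], rule exI[of _ di], rule exI[of _ dj], rule exI[of _ b], simp)
  next
    fix i0 j0 a di dj b
    assume "(a, di, dj, b) \<in> set cell_edges" "a = 6 \<and> b = 7 \<longrightarrow> j0 = 0" "(i, j, l) = (i0, j0, a)" "(i', j', l') = (i0 + di, j0 + dj, b)"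
    then have "\<exists>a di dj b. (a, di, dj, b) \<in> set cell_edges \<and> l = a \<and> l' = b \<and> i' = i + di \<and> j' = j + dj \<and> (a = 6 \<and> b = 7 \<longrightarrow> j = 0)"
      by - (rule exI[of _ a], rule exI[of _ di], rule exI[of _ dj], rule exI[of _ b], simp)
    then show "?one \<or> ?two" by (rule disjI1)
  next
    fix i0 j0 a di dj b
    assume "(a, di, dj, b) \<in> set cell_edges" "a = 6 \<and> b = 7 \<longrightarrow> j0 = 0" "(i', j', l') = (i0, j0, a)" "(i, j, l) = (i0 + di, j0 + dj, b)"
    then have "\<exists>a di dj b. (a, di, dj, b) \<in> set cell_edges \<and> l' = a \<and> l = b \<and> i = i' + di \<and> j = j' + dj \<and> (a = 6 \<and> b = 7 \<longrightarrow> j' = 0)"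
      by - (rule exI[of _ a], rule exI[of _ di], rule exI[of _ dj], rule exI[of _ b], simp)
    then show "?one \<or> ?two" by (rule disjI2)
  qed
  also have "\<dots> \<longleftrightarrow> {r 20, r 21} \<in> num_E R C"
    unfolding num_E_def id[symmetric] by (rule image_edge_iff[OF vertex_id_inj mesh_E_sub m, symmetric])
  finally show ?thesis .
qed

definition blocked_ex :: "scheme list \<Rightarrow> ex" where
  "blocked_ex cs = Ors
     [Not (Less (Var 15) (Num 25)),
      And (Or (Eq (Var 15) (Num 16)) (Eq (Var 15) (Num 17))) (Eq (Var 14) Zero),
      And (Eq (Var 15) (Num 20)) (Not (occurs_ex cs True)), And (Eq (Var 15) (Num 18)) (occurs_ex cs True),
      And (Eq (Var 15) (Num 21)) (Not (occurs_ex cs False)), And (Eq (Var 15) (Num 19)) (occurs_ex cs False),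
      And (Eq (Var 15) (Num 24)) (Not (Eq (Add (Var 13) One) (Var 5)))]"

definition size_ex :: ex where
  "size_ex = Add (Add (Var 7) One) (Mul (Var 7) (Var 7))"

text \<open>One disjunct for each of the unary prefix, the matrix, \<open>U\<close> and
  \<open>N\<close>. The 0 that ends the prefix is the position that satisfies none of them.\<close>

definition bit_ex :: "scheme list \<Rightarrow> ex" where
  "bit_ex cs = Ors
     [Less (Var 1) (Var 7),
      And (And (Less (Var 7) (Var 1)) (Less (Var 1) size_ex))
        (Bind 19 (Sub (Var 1) (Add (Var 7) One)) (Bind 20 (Div (Var 19) (Var 7)) (Bind 21 (Mod (Var 19) (Var 7)) adjacent_ex))),
      And (And (Not (Less (Var 1) size_ex)) (Less (Var 1) (Add size_ex (Var 7))))
        (Less (Mod (Sub (Var 1) size_ex) (Num 48)) (Num 14)),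
      And (Not (Less (Var 1) (Add size_ex (Var 7))))
        (Bind 20 (Sub (Var 1) (Add size_ex (Var 7))) (cell_ex 20 13 14 15 (blocked_ex cs)))]"

text \<open>The binding order follows the dependencies: \<open>P\<close>, \<open>T\<close>,
  \<open>S\<close>, then the numbers of rows, columns and vertices.\<close>

definition parameters_ex :: "nat poly \<Rightarrow> nat poly \<Rightarrow> scheme list \<Rightarrow> ex \<Rightarrow> ex" where
  "parameters_ex p q cs e =
     Bind 3 (Pol p (Var 0)) (Bind 2 (Pol q (Add (Var 0) (Var 3))) (Bind 4 (Add (Add (Add (Var 2) (Var 0)) (Var 3)) (Num 4))
     (Bind 5 (Mul (Mul (Mul (Num (length cs)) (Add (Var 2) One)) (Var 4)) (Var 4))
     (Bind 6 (Mul (Mul (Num (length (kinds cs))) (Add (Var 2) One)) (Var 4))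
     (Bind 7 (Mul (Mul (Var 5) (Var 6)) (Num 48)) e)))))"

definition parameters :: "nat poly \<Rightarrow> nat poly \<Rightarrow> scheme list \<Rightarrow> nat \<Rightarrow> (nat \<Rightarrow> nat) \<Rightarrow> nat \<Rightarrow> nat" where
  "parameters p q cs n r = (let P = poly p n; T = poly q (n + P); S = T + n + P + 4;
     R = length cs * (T + 1) * S * S; C = length (kinds cs) * (T + 1) * S in
     r(3 := P, 2 := T, 4 := S, 5 := R, 6 := C, 7 := R * C * 48))"

lemma eval_parameters_ex: "eval (parameters_ex p q cs e) w r = eval e w (parameters p q cs (r 0) r)"
  by (simp add: parameters_ex_def parameters_def Let_def)

lemma holds_blocked_ex:
  assumes "\<And>c. c \<in> set cs \<Longrightarrow> scheme_ok c" "0 < S"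
    and "r 0 = r0 0" "r 2 = r0 2" "r 3 = r0 3" "r 4 = r0 4" "r0 2 = T" "r0 4 = S"
    and "r 13 div S div S div (T + 1) < length cs" and R: "r 5 = R"
  shows "holds (blocked_ex cs) w r \<longleftrightarrow>
    blocked R (r 13) (r 14) (occurs cs w r0 T S True (r 13) (r 14)) (occurs cs w r0 T S False (r 13) (r 14)) (r 15)"
  by (simp add: blocked_ex_def blocked_def holds_occurs_ex[OF assms(1-9)] R not_less)

lemma num_U_iff:
  assumes "0 < C" "u < R * C * 48"
  shows "u \<in> num_U R C \<longleftrightarrow> u mod 48 < 14"
proof -
  have "mesh_U R C = {v \<in> mesh_V R C. snd (snd v) < 14}"
    by (auto simp: mesh_U_def mesh_V_def mesh_part_def)
  then have "num_U R C = {u. u < R * C * 48 \<and> snd (snd (vertex_of C u)) < 14}"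
    unfolding num_U_def by (simp only: vertex_id_image[OF assms(1)])
  then show ?thesis using assms(2) by (simp add: vertex_of_def)
qed

lemma num_N_iff:
  assumes "0 < C" "u < R * C * 48" "vertex_of C u = (i, j, l)"
  shows "u \<in> num_N R C pos neg \<longleftrightarrow> blocked R i j (pos i j) (neg i j) l"
proof -
  have "mesh_N R C pos neg = {v \<in> mesh_V R C. case v of (i, j, l) \<Rightarrow> blocked R i j (pos i j) (neg i j) l}"
    by (auto simp: mesh_N_def)
  then have "num_N R C pos neg = {u. u < R * C * 48 \<and> (case vertex_of C u of (i, j, l) \<Rightarrow> blocked R i j (pos i j) (neg i j) l)}"
    unfolding num_N_def by (simp only: vertex_id_image[OF assms(1)])
  then show ?thesis using assms(2,3) by simp
qed

lemma holds_bit_ex: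
  assumes cs: "\<And>c. c \<in> set cs \<Longrightarrow> scheme_ok c" and S: "0 < S"
    and r: "r 0 = r0 0" "r 2 = r0 2" "r 3 = r0 3" "r 4 = r0 4" and r0: "r0 2 = T" "r0 4 = S"
    and R: "R = length cs * (T + 1) * S * S" "r 5 = R" and C: "0 < C" "r 6 = C" and N: "N = R * C * 48" "r 7 = N"
    and b: "r 1 = b" "b < N + 1 + N * N + N + N"
  shows "holds (bit_ex cs) w r \<longleftrightarrow>
    encode_bit N (num_E R C) (num_U R C) (num_N R C (occurs cs w r0 T S True) (occurs cs w r0 T S False)) b"
proof -
  have size: "eval size_ex w (r(v := x)) = N + 1 + N * N" if "v \<noteq> 7" for v x
    using N that by (simp add: size_ex_def)
  have size0: "eval size_ex w r = N + 1 + N * N" using N by (simp add: size_ex_def)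
  consider "b \<le> N" | "N < b" "b < N + 1 + N * N" | "N + 1 + N * N \<le> b" "b < N + 1 + N * N + N" | "N + 1 + N * N + N \<le> b"
    by linarith
  then show ?thesis
  proof cases
    case 1
    then show ?thesis using N b size0 by (simp add: bit_ex_def encode_bit_def)
  next
    case 2
    define k where "k = b - (N + 1)"
    have k: "k < N * N" using 2 unfolding k_def by linarith
    then have N0: "0 < N" by (cases N) auto
    define r' where "r' = r(19 := k, 20 := k div N, 21 := k mod N)"
    have "holds (bit_ex cs) w r \<longleftrightarrow> holds adjacent_ex w r'"
      using 2 N(2) b size0 N0 by (simp add: bit_ex_def r'_def k_def)
    also have "\<dots> \<longleftrightarrow> {k div N, k mod N} \<in> num_E R C"
    proof -
      have "r' 20 < R * C * 48" "r' 21 < R * C * 48"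
        using k N0 unfolding N(1)[symmetric] by (simp_all add: r'_def less_mult_imp_div_less)
      moreover have "r' 6 = C" using C by (simp add: r'_def)
      ultimately show ?thesis using holds_adjacent_ex[of r' C R w] C(1) by (simp add: r'_def)
    qed
    finally show ?thesis using 2 by (simp add: encode_bit_def k_def)
  next
    case 3
    define u where "u = b - (N + 1 + N * N)"
    have u: "u < R * C * 48" using 3 unfolding u_def N(1)[symmetric] by linarith
    have "holds (bit_ex cs) w r \<longleftrightarrow> u mod 48 < 14"
      using 3 N(2) b size0 by (simp add: bit_ex_def u_def)
    then show ?thesis using 3 num_U_iff[OF C(1) u] by (simp add: encode_bit_def u_def)
  next
    case 4
    define u where "u = b - (N + 1 + N * N + N)"
    have u: "u < R * C * 48" using 4 b(2) unfolding u_def N(1)[symmetric] by linarith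
    obtain i j l where v: "vertex_of C u = (i, j, l)" by (cases "vertex_of C u")
    have "i < R" using vertex_of_mesh[OF C(1) u] v by (simp add: mesh_V_def)
    define r' where "r' = r(20 := u, 13 := i, 14 := j, 15 := l)"
    have "holds (bit_ex cs) w r \<longleftrightarrow> holds (blocked_ex cs) w r'"
      using 4 N(2) b C v size size0 by (simp add: bit_ex_def cell_ex_def r'_def u_def vertex_of_def)
    also have "\<dots> \<longleftrightarrow> blocked R i j (occurs cs w r0 T S True i j) (occurs cs w r0 T S False i j) l"
    proof -
      have "i div S div S div (T + 1) < length cs"
        using \<open>i < R\<close> unfolding R(1) by (intro less_mult_imp_div_less)
      then show ?thesis
        using holds_blocked_ex[OF cs S, where r = "r'" and ?r0.0 = r0 and T = T and R = R and w = w] r r0 R(2) by (simp add: r'_def)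
    qed
    finally show ?thesis using 4 num_N_iff[OF C(1) u v, of "occurs cs w r0 T S True" "occurs cs w r0 T S False"]
      by (simp add: encode_bit_def u_def)
  qed
qed

text \<open>For fixed \<open>K\<close> the reduction is a pair of closed expressions built from the
  clauses of its verifier, so its running time is the general fact on
  \<open>out_bits\<close>.\<close>

theorem NP_reduction:
  assumes "K \<in> NP"
  obtains f where "poly_time f" "\<And>x. f x \<in> planar_bipartite_inputs 9" "\<And>x. x \<in> K \<longleftrightarrow> f x \<in> Ext_GM_Defensive_Alliance"
proof -
  obtain M p q where M: "tm_wf M"
    "\<And>x r P T S. \<lbrakk>r 0 = length x; r 2 = T; r 3 = P; r 4 = S; P = poly p (length x);
       T = poly q (length x + P); S = T + length x + P + 4\<rbrakk> \<Longrightarrow>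
       x \<in> K \<longleftrightarrow> (\<exists>\<alpha>. \<forall>c \<in> set (schemes M). scheme_sat (bits x) r T S \<alpha> c)"
    using NP_schemes[OF assms] by metis
  define cs where "cs = schemes M"
  define f where "f x = out_bits (parameters_ex p q cs (Add (Add size_ex (Var 7)) (Var 7))) (parameters_ex p q cs (bit_ex cs)) (bits x)" for x
  have "f x \<in> planar_bipartite_inputs 9 \<and> (x \<in> K \<longleftrightarrow> f x \<in> Ext_GM_Defensive_Alliance)" for x
  proof -
    define n where "n = length x"
    define w where "w = bits x"
    define P where "P = poly p n"
    define T where "T = poly q (n + P)"
    define S where "S = T + n + P + 4"
    define R where "R = length cs * (T + 1) * S * S"
    define C where "C = length (kinds cs) * (T + 1) * S"
    define N where "N = R * C * 48"
    define ps where "ps i = parameters p q cs n (env w i)" for i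
    have len: "length w = n" by (simp add: w_def n_def bits_def)
    have ps: "ps i 0 = n" "ps i 1 = i" "ps i 2 = T" "ps i 3 = P" "ps i 4 = S" "ps i 5 = R" "ps i 6 = C" "ps i 7 = N" for i
      unfolding ps_def parameters_def Let_def P_def[symmetric] T_def[symmetric] S_def[symmetric] R_def[symmetric]
        C_def[symmetric] N_def[symmetric]
      by (simp_all add: env_def len)
    \<comment> \<open>The start clauses are always present, so the mesh has at least one row and one
      column.\<close>
    have ne: "cs \<noteq> []" "kinds cs \<noteq> []" by (simp_all add: cs_def schemes_def start_schemes_def kinds_def)
    have pos: "0 < S" "0 < R" "0 < C" using ne by (simp_all add: S_def R_def C_def)
    have env0: "env w i 0 = n" for i by (simp add: env_def len)
    have e: "eval (parameters_ex p q cs e) w (env w i) = eval e w (ps i)" for e i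
      unfolding eval_parameters_ex env0 ps_def ..
    have "f x = map (\<lambda>i. holds (bit_ex cs) w (ps i)) [0..<N + 1 + N * N + N + N]"
      unfolding f_def w_def[symmetric] out_bits_def e holds_def[symmetric] by (simp add: size_ex_def ps)
    also have "\<dots> = encode N (num_E R C) (num_U R C) (num_N R C (occurs cs w (ps 0) T S True) (occurs cs w (ps 0) T S False))"
      unfolding encode_conv
    proof (rule map_cong[OF refl])
      fix i assume "i \<in> set [0..<N + 1 + N * N + N + N]"
      then have i: "i < N + 1 + N * N + N + N" by (simp only: set_upt atLeastLessThan_iff)
      show "holds (bit_ex cs) w (ps i) =
        encode_bit N (num_E R C) (num_U R C) (num_N R C (occurs cs w (ps 0) T S True) (occurs cs w (ps 0) T S False)) i"
        by (rule holds_bit_ex[OF schemes_ok[of _ M, folded cs_def] pos(1)])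
          (simp_all only: ps R_def[symmetric] N_def[symmetric] pos i)
    qed
    finally have f: "f x = encode (R * C * 48) (num_E R C) (num_U R C) (num_N R C (occurs cs w (ps 0) T S True) (occurs cs w (ps 0) T S False))"
      unfolding N_def .
    have "x \<in> K \<longleftrightarrow> (\<exists>\<alpha>. \<forall>c \<in> set cs. scheme_sat w (ps 0) T S \<alpha> c)"
      unfolding cs_def w_def
      by (rule M(2)) (simp_all only: ps P_def T_def S_def n_def)
    also have "\<dots> \<longleftrightarrow> cnf_sat R C (occurs cs w (ps 0) T S True) (occurs cs w (ps 0) T S False)"
      unfolding R_def C_def by (rule cnf_sat_schemes[OF pos(1) ne(2), symmetric])
    also have "\<dots> \<longleftrightarrow> f x \<in> Ext_GM_Defensive_Alliance"
      unfolding f by (rule num_ext_iff[OF pos(2,3), symmetric])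
    finally show ?thesis using num_planar_bipartite[OF pos(3)] f by simp
  qed
  moreover have "poly_time f" unfolding f_def by (rule poly_time_out_bits)
  ultimately show ?thesis using that by blast
qed

text \<open>For the restricted problem the language itself serves as the NP witness
  \<open>K\<close>, and since every reduction already lands in the restricted inputs, one
  construction settles both hardness claims.\<close>

theorem corollary3:
  "NP_complete Ext_GM_Defensive_Alliance \<and>
   NP_complete_on (planar_bipartite_inputs 9) Ext_GM_Defensive_Alliance"
proof -
  have "NP_hard Ext_GM_Defensive_Alliance"
    unfolding NP_hard_def by (metis NP_reduction)
  moreover have "\<forall>K \<in> NP. \<exists>f. poly_time f \<and> (\<forall>x. f x \<in> planar_bipartite_inputs 9) \<and> (\<forall>x. x \<in> K \<longleftrightarrow> f x \<in> Ext_GM_Defensive_Alliance)"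
    by (metis NP_reduction)
  ultimately show ?thesis
    unfolding NP_complete_def NP_complete_on_def using Ext_GM_in_NP by blast
qed

end
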